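(* Let $1<q\le2$ and $0<\alpha<1$, and let $q'$ be defined by $\frac1q+\frac1{q'}=1$. For $n\in\mathbb N$ let $R_n$ be the minimum $R$ for which the metric space $(B_q^n,d_2^\alpha)$ may be isometrically embedded on the surface of a Hilbert sphere of radius $R$. Then $R_n$ behaves asymptotically as $n^{\alpha/q'}$; that is, there exist constants $A,B>0$ (depending on $\alpha$ and $q$ but not on $n$) such that $A\,n^{\alpha/q'}\le R_n\le B\,n^{\alpha/q'}$ for every $n\in\mathbb N$.
   Context: $B_q^n=\{x\in\mathbb R^n:\sum_i|x_i|^q\le1\}$ is the closed unit ball of $\ell_q^n$; $d_2(x,y)=\|x-y\|_2$ is the Euclidean distance and $d_2^\alpha(x,y)=\|x-y\|_2^\alpha$. An isometric embedding of $(K,d_2^\alpha)$ on the surface of a Hilbert sphere of radius $R$ is a map $j:K\to R\cdot S_{\ell_2}=\{z\in\ell_2:\|z\|_{\ell_2}=R\}$ into the real Hilbert space $\ell_2$ with $\|j(x)-j(y)\|_{\ell_2}=\|x-y\|_2^\alpha$ for all $x,y\in K$. *)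

theory Defs
  imports "HOL-Analysis.Analysis"
begin

text \<open>
  Since the dimension n varies inside the theorem, the space of real n-tuples is modelled, as in the
  library's \<^const>\<open>Euclidean_space\<close>, by the functions on the naturals that vanish from index n on.
\<close>

definition lq_ball :: "real \<Rightarrow> nat \<Rightarrow> (nat \<Rightarrow> real) set" where
  "lq_ball q n = {x. (\<forall>i\<ge>n. x i = 0) \<and> (\<Sum>i<n. \<bar>x i\<bar> powr q) \<le> 1}"

definition euclid_dist :: "nat \<Rightarrow> (nat \<Rightarrow> real) \<Rightarrow> (nat \<Rightarrow> real) \<Rightarrow> real" where
  "euclid_dist n x y = L2_set (\<lambda>i. x i - y i) {..<n}"

definition ell2 :: "(nat \<Rightarrow> real) set" where
  "ell2 = {z. summable (\<lambda>k. (z k)\<^sup>2)}"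

text \<open>Meaningful only on \<^const>\<open>ell2\<close>.\<close>

definition ell2_norm :: "(nat \<Rightarrow> real) \<Rightarrow> real" where
  "ell2_norm z = sqrt (\<Sum>k. (z k)\<^sup>2)"

definition ell2_sphere :: "real \<Rightarrow> (nat \<Rightarrow> real) set" where
  "ell2_sphere R = {z \<in> ell2. ell2_norm z = R}"

definition sphere_embeddable :: "'a set \<Rightarrow> ('a \<Rightarrow> 'a \<Rightarrow> real) \<Rightarrow> real \<Rightarrow> bool" where
  "sphere_embeddable K d R \<longleftrightarrow>
     (\<exists>j. j \<in> K \<rightarrow> ell2_sphere R \<and>
          (\<forall>x\<in>K. \<forall>y\<in>K. ell2_norm (\<lambda>k. j x k - j y k) = d x y))"

text \<open>
  A genuine minimum: the radius R itself is attained.  Negative radii play no role for nonempty K,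
  since their spheres are empty.
\<close>

definition is_min_sphere_radius :: "'a set \<Rightarrow> ('a \<Rightarrow> 'a \<Rightarrow> real) \<Rightarrow> real \<Rightarrow> bool" where
  "is_min_sphere_radius K d R \<longleftrightarrow>
     sphere_embeddable K d R \<and> (\<forall>R'. sphere_embeddable K d R' \<longrightarrow> R \<le> R')"

end

theory Submission
  imports Defs "HOL-Probability.Probability" "HOL-Computational_Algebra.Polynomial"
begin

text \<open>Let \<open>E\<close> be the supremum of the energies \<open>\<Sum>\<^sub>x\<^sub>y c\<^sub>x c\<^sub>y d(x,y)\<^sup>2\<close> over finitely supported signed measures
  \<open>c\<close> of total mass 1. The kernel \<open>R\<^sup>2 - d\<^sup>2 / 2\<close> is positive semidefinite iff \<open>E \<le> 2 R\<^sup>2\<close>, so the minimal radius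
  satisfies \<open>2 R\<^sup>2 = E\<close>, and the task is to show that \<open>E\<close> has order \<open>n\<close> to the power \<open>2 \<alpha> / q'\<close>.

  Upper bound. On the line, the fractional Brownian motion kernels \<open>(t - u)\<^sub>+\<close> to the power \<open>\<alpha> - 1/2\<close>, corrected by
  one fixed function, embed an interval of length \<open>L\<close> into a sphere of \<open>L\<^sup>2(\<real>)\<close> whose squared radius is of order
  \<open>L\<close> to the power \<open>2 \<alpha>\<close>. For a Gaussian vector \<open>g\<close>, the mean of \<open>\<bar>\<langle>x - y, g\<rangle>\<bar>\<close> to the power \<open>2 \<alpha>\<close> is a
  multiple of \<open>d(x,y)\<^sup>2\<close>, the ball is mapped by \<open>\<langle>_, g\<rangle>\<close> into an interval of length \<open>2 \<parallel>g\<parallel>\<close> in the \<open>q'\<close>-norm, and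
  averaging over \<open>g\<close> gives the bound.

  Lower bound. By scaling it suffices to find a measure of energy of order \<open>n\<close> to the power \<open>\<alpha>\<close> in the Euclidean
  ball. Let \<open>P = \<Sum>\<^sub>m a\<^sub>m y\<^sup>m\<close> be the Fejer kernel of order \<open>D \<approx> n\<close>, as a polynomial in \<open>y = cos \<theta>\<close>, and take the
  combination with coefficients \<open>a\<^sub>m\<close> of the laws of \<open>m\<close> steps of the random walk with independent signs of size of
  order \<open>1/n\<close> as coordinates. Its characteristic function is \<open>P(\<Prod>\<^sub>i cos (h \<xi>\<^sub>i))\<close>, which lies in \<open>[0,1]\<close> and
  falls below a constant less than 1 already at \<open>\<bar>\<xi>\<bar>\<close> of order 1. The walks leave the ball with a probability
  that beats the exponential size of the coefficients \<open>a\<^sub>m\<close>, so these walks can be moved to the origin.\<close>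

section \<open>Spherical embeddings and energies\<close>

text \<open>The inequality is homogeneous instead of normalised to total mass 1, so it also covers
  mass 0, where it says that \<open>f\<close> is of negative type.\<close>

definition energy_bounded :: "'a set \<Rightarrow> ('a \<Rightarrow> 'a \<Rightarrow> real) \<Rightarrow> real \<Rightarrow> bool" where
  "energy_bounded K f C \<longleftrightarrow>
     (\<forall>X c. finite X \<longrightarrow> X \<subseteq> K \<longrightarrow> (\<Sum>x\<in>X. \<Sum>y\<in>X. c x * c y * f x y) \<le> C * (\<Sum>x\<in>X. c x)\<^sup>2)"

definition psd_kernel :: "'a set \<Rightarrow> ('a \<Rightarrow> 'a \<Rightarrow> real) \<Rightarrow> bool" where
  "psd_kernel K k \<longleftrightarrow> (\<forall>x\<in>K. \<forall>y\<in>K. k x y = k y x) \<and>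
     (\<forall>X c. finite X \<longrightarrow> X \<subseteq> K \<longrightarrow> 0 \<le> (\<Sum>x\<in>X. \<Sum>y\<in>X. c x * c y * k x y))"

text \<open>The squared distance of the feature vectors of \<open>x\<close> and \<open>y\<close> in
  the Hilbert space belonging to \<open>k\<close>.\<close>

definition kernel_dist2 :: "('a \<Rightarrow> 'a \<Rightarrow> real) \<Rightarrow> 'a \<Rightarrow> 'a \<Rightarrow> real" where
  "kernel_dist2 k x y = k x x - 2 * k x y + k y y"

text \<open>The Schur complement of \<open>k\<close> with respect to \<open>p\<close>; if \<open>k p p = 0\<close> then \<open>k x p = 0\<close> for all \<open>x\<close>,
  and the value \<open>0\<close> of the quotient is the right one.\<close>

definition schur :: "('a \<Rightarrow> 'a \<Rightarrow> real) \<Rightarrow> 'a \<Rightarrow> 'a \<Rightarrow> 'a \<Rightarrow> real" where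
  "schur k p x y = k x y - k x p * k y p / k p p"

section \<open>Positive semidefinite kernels and their Schur complements\<close>

lemma psd_kernel_sym: "psd_kernel K k \<Longrightarrow> x \<in> K \<Longrightarrow> y \<in> K \<Longrightarrow> k x y = k y x"
  by (auto simp: psd_kernel_def)

text \<open>This is the form of \<open>k\<close> at the measure \<open>c\<close> plus
  \<open>t\<close> times the unit mass at \<open>p\<close>. Since \<open>p\<close> may or may not
  lie in \<open>X\<close>, both summands are extended by zero to \<open>insert p X\<close>.\<close>

lemma psd_kernel_add_point:
  assumes k: "psd_kernel K k" and X: "finite X" "X \<subseteq> K" and p: "p \<in> K"
  shows "0 \<le> (\<Sum>x\<in>X. \<Sum>y\<in>X. c x * c y * k x y) + 2 * t * (\<Sum>x\<in>X. c x * k x p) + t\<^sup>2 * k p p"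
proof -
  define c0 where "c0 = (\<lambda>x. if x \<in> X then c x else 0)"
  define e where "e = (\<lambda>x. if x = p then t else 0)"
  define Y where "Y = insert p X"
  have Y: "finite Y" "Y \<subseteq> K" "p \<in> Y" "X \<subseteq> Y" using X p by (auto simp: Y_def)
  have 1: "(\<Sum>y\<in>Y. c0 y * g y) = (\<Sum>y\<in>X. c y * g y)" for g
    using Y by (intro sum.mono_neutral_cong_right) (auto simp: c0_def)
  have 2: "(\<Sum>y\<in>Y. e y * g y) = t * g p" for g
    using Y by (simp add: e_def if_distrib[of "\<lambda>u. u * _"] sum.delta cong: if_cong)
  have "(\<Sum>x\<in>Y. \<Sum>y\<in>Y. (c0 x + e x) * (c0 y + e y) * k x y)
      = (\<Sum>x\<in>Y. c0 x * (\<Sum>y\<in>Y. c0 y * k x y)) + (\<Sum>x\<in>Y. c0 x * (\<Sum>y\<in>Y. e y * k x y))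
        + (\<Sum>x\<in>Y. e x * (\<Sum>y\<in>Y. c0 y * k x y)) + (\<Sum>x\<in>Y. e x * (\<Sum>y\<in>Y. e y * k x y))"
    by (simp add: sum_distrib_left sum.distrib algebra_simps)
  also have "\<dots> = (\<Sum>x\<in>X. \<Sum>y\<in>X. c x * c y * k x y) + t * (\<Sum>x\<in>X. c x * k x p)
        + t * (\<Sum>y\<in>X. c y * k p y) + t\<^sup>2 * k p p"
    unfolding 1 2 by (simp add: sum_distrib_left mult_ac power2_eq_square)
  also have "(\<Sum>y\<in>X. c y * k p y) = (\<Sum>x\<in>X. c x * k x p)"
    using X p psd_kernel_sym[OF k] by (intro sum.cong) auto
  finally have "(\<Sum>x\<in>Y. \<Sum>y\<in>Y. (c0 x + e x) * (c0 y + e y) * k x y) =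
     (\<Sum>x\<in>X. \<Sum>y\<in>X. c x * c y * k x y) + 2 * t * (\<Sum>x\<in>X. c x * k x p) + t\<^sup>2 * k p p" by simp
  moreover have "0 \<le> (\<Sum>x\<in>Y. \<Sum>y\<in>Y. (c0 x + e x) * (c0 y + e y) * k x y)"
    using k Y(1,2) unfolding psd_kernel_def by (elim conjE allE[of _ Y] allE[of _ "\<lambda>x. c0 x + e x"]) auto
  ultimately show ?thesis by simp
qed

lemma psd_kernel_pair:
  assumes "psd_kernel K k" "x \<in> K" "p \<in> K"
  shows "0 \<le> c\<^sup>2 * k x x + 2 * t * c * k x p + t\<^sup>2 * k p p"
  using psd_kernel_add_point[OF assms(1), of "{x}" p "\<lambda>_. c" t] assms by (simp add: power2_eq_square mult_ac)

lemma psd_kernel_diag_nonneg: "psd_kernel K k \<Longrightarrow> x \<in> K \<Longrightarrow> 0 \<le> k x x"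
  using psd_kernel_pair[of K k x x 1 0] by simp

lemma psd_kernel_dist2_nonneg: "psd_kernel K k \<Longrightarrow> x \<in> K \<Longrightarrow> y \<in> K \<Longrightarrow> 0 \<le> kernel_dist2 k x y"
  using psd_kernel_pair[of K k x y 1 "-1"] by (simp add: kernel_dist2_def)

lemma psd_kernel_dist2_le:
  "psd_kernel K k \<Longrightarrow> x \<in> K \<Longrightarrow> y \<in> K \<Longrightarrow> kernel_dist2 k x y \<le> 2 * (k x x + k y y)"
  using psd_kernel_pair[of K k x y 1 1] by (simp add: kernel_dist2_def)

text \<open>With \<open>k p p = 0\<close> the form on the pair is affine in \<open>t\<close> with
  slope \<open>2 * k x p\<close>; at the \<open>t\<close> chosen below it would equal -1.\<close>

lemma psd_kernel_null:
  assumes "psd_kernel K k" "x \<in> K" "p \<in> K" "k p p = 0"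
  shows "k x p = 0"
proof (rule ccontr)
  assume "k x p \<noteq> 0"
  then show False
    using psd_kernel_pair[OF assms(1-3), of 1 "- (k x x + 1) / (2 * k x p)"] assms(4)
    by (simp add: field_simps)
qed

text \<open>For \<open>k p p > 0\<close> the form of the Schur complement at \<open>c\<close> is the
  minimum over \<open>t\<close> of the form of \<open>k\<close> at \<open>c\<close> plus
  \<open>t\<close> times the unit mass at \<open>p\<close>; it is attained at
  \<open>t = - B / k p p\<close>.\<close>

lemma psd_kernel_schur:
  assumes k: "psd_kernel K k" and p: "p \<in> K"
  shows "psd_kernel K (schur k p)"
  unfolding psd_kernel_def
proof (intro conjI allI impI ballI)
  fix x y assume "x \<in> K" "y \<in> K"
  then show "schur k p x y = schur k p y x"
    using psd_kernel_sym[OF k] by (simp add: schur_def)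
next
  fix X :: "'a set" and c :: "'a \<Rightarrow> real" assume X: "finite X" "X \<subseteq> K"
  define B where "B = (\<Sum>x\<in>X. c x * k x p)"
  define Q where "Q = (\<Sum>x\<in>X. \<Sum>y\<in>X. c x * c y * k x y)"
  have "(\<Sum>x\<in>X. \<Sum>y\<in>X. c x * c y * schur k p x y) = Q - (\<Sum>x\<in>X. \<Sum>y\<in>X. c x * k x p * (c y * k y p) / k p p)"
    by (simp add: schur_def Q_def sum_subtractf[symmetric] algebra_simps)
  also have "(\<Sum>x\<in>X. \<Sum>y\<in>X. c x * k x p * (c y * k y p) / k p p) = B\<^sup>2 / k p p"
    by (simp add: B_def power2_eq_square sum_product sum_divide_distrib)
  finally have eq: "(\<Sum>x\<in>X. \<Sum>y\<in>X. c x * c y * schur k p x y) = Q - B\<^sup>2 / k p p" .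
  have "0 \<le> Q + 2 * (- B / k p p) * B + (- B / k p p)\<^sup>2 * k p p"
    using psd_kernel_add_point[OF k X p, of c "- B / k p p"] by (simp add: Q_def B_def)
  \<comment> \<open>For \<open>k p p = 0\<close> both sides reduce to \<open>Q\<close>, because
    division by 0 gives 0.\<close>
  also have "\<dots> = Q - B\<^sup>2 / k p p"
    by (cases "k p p = 0") (simp_all add: field_simps power2_eq_square)
  finally show "0 \<le> (\<Sum>x\<in>X. \<Sum>y\<in>X. c x * c y * schur k p x y)" using eq by simp
qed

section \<open>Gram coordinates by iterated Schur complements\<close>

text \<open>Gaussian elimination with pivots \<open>p 0\<close>, \<open>p 1\<close>, and so on:
  stage \<open>m\<close> is the kernel of the components orthogonal to the feature vectors of the
  first \<open>m\<close> pivots.\<close>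

primrec schur_seq :: "('a \<Rightarrow> 'a \<Rightarrow> real) \<Rightarrow> (nat \<Rightarrow> 'a) \<Rightarrow> nat \<Rightarrow> 'a \<Rightarrow> 'a \<Rightarrow> real" where
  "schur_seq k p 0 = k"
| "schur_seq k p (Suc m) = schur (schur_seq k p m) (p m)"

text \<open>The Gram-Schmidt coordinate along the pivot \<open>p m\<close>. If the pivot depends on
  its predecessors, division by 0 makes the coordinate 0.\<close>

definition gram_coord :: "('a \<Rightarrow> 'a \<Rightarrow> real) \<Rightarrow> (nat \<Rightarrow> 'a) \<Rightarrow> 'a \<Rightarrow> nat \<Rightarrow> real" where
  "gram_coord k p x m = schur_seq k p m x (p m) / sqrt (schur_seq k p m (p m) (p m))"

context
  fixes K :: "'a set" and k :: "'a \<Rightarrow> 'a \<Rightarrow> real" and p :: "nat \<Rightarrow> 'a"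
  assumes k: "psd_kernel K k" and p: "\<And>m. p m \<in> K"
begin

lemma psd_kernel_schur_seq: "psd_kernel K (schur_seq k p m)"
  by (induction m) (auto simp: k p psd_kernel_schur)

text \<open>An eliminated pivot is orthogonal to all that remains, and later eliminations preserve
  this. A pivot with vanishing diagonal entry is covered by \<open>psd_kernel_null\<close>.\<close>

lemma schur_seq_vanish: "m < M \<Longrightarrow> x \<in> K \<Longrightarrow> schur_seq k p M x (p m) = 0"
proof (induction M arbitrary: x)
  case (Suc M)
  show ?case
  proof (cases "m = M")
    case True
    then show ?thesis
      using psd_kernel_null[OF psd_kernel_schur_seq Suc.prems(2) p, of M M] by (auto simp: schur_def)
  next
    case False
    with Suc.prems have "m < M" by simp
    then have "schur_seq k p M x (p m) = 0" "schur_seq k p M (p M) (p m) = 0"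
      using Suc.IH Suc.prems p by auto
    moreover have "schur_seq k p M (p m) (p M) = schur_seq k p M (p M) (p m)"
      using psd_kernel_sym[OF psd_kernel_schur_seq p p] .
    ultimately show ?thesis by (simp add: schur_def)
  qed
qed simp

lemma schur_seq_decomp:
  assumes "x \<in> K" "y \<in> K"
  shows "k x y = (\<Sum>m<M. gram_coord k p x m * gram_coord k p y m) + schur_seq k p M x y"
proof (induction M)
  case (Suc M)
  have "0 \<le> schur_seq k p M (p M) (p M)"
    by (rule psd_kernel_diag_nonneg[OF psd_kernel_schur_seq p])
  then have "gram_coord k p x M * gram_coord k p y M =
      schur_seq k p M x (p M) * schur_seq k p M y (p M) / schur_seq k p M (p M) (p M)"
    by (simp add: gram_coord_def)
  then show ?case using Suc by (simp add: schur_def)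
qed simp

lemma schur_seq_dist2:
  assumes "x \<in> K" "y \<in> K"
  shows "kernel_dist2 k x y =
     (\<Sum>m<M. (gram_coord k p x m - gram_coord k p y m)\<^sup>2) + kernel_dist2 (schur_seq k p M) x y"
proof -
  have "(\<Sum>m<M. (u m - v m)\<^sup>2) = (\<Sum>m<M. u m * u m) - 2 * (\<Sum>m<M. u m * v m) + (\<Sum>m<M. v m * v m)"
    for u v :: "nat \<Rightarrow> real"
    by (induction M) (auto simp: power2_eq_square algebra_simps)
  then show ?thesis
    using schur_seq_decomp[OF assms, of M] schur_seq_decomp[OF assms(1) assms(1), of M]
     schur_seq_decomp[OF assms(2) assms(2), of M] by (simp add: kernel_dist2_def)
qed

text \<open>After stage \<open>m\<close> the residual of \<open>p m\<close> is 0, so the residual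
  norm of \<open>x\<close> equals the residual distance from \<open>x\<close> to \<open>p m\<close>,
  which is at most the original distance. Density makes this small.\<close>

lemma schur_seq_diag_tendsto:
  assumes dense: "\<And>e. e > 0 \<Longrightarrow> \<exists>m. kernel_dist2 k x (p m) < e" and x: "x \<in> K"
  shows "(\<lambda>M. schur_seq k p M x x) \<longlonglongrightarrow> 0"
proof (rule LIMSEQ_I)
  fix e :: real assume "e > 0"
  then obtain m where m: "kernel_dist2 k x (p m) < e" using dense by blast
  have "norm (schur_seq k p M x x - 0) < e" if "M \<ge> Suc m" for M
  proof -
    have "0 \<le> (\<Sum>i<M. (gram_coord k p x i - gram_coord k p (p m) i)\<^sup>2)" by (intro sum_nonneg) auto
    moreover have "kernel_dist2 (schur_seq k p M) x (p m) = schur_seq k p M x x"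
      using schur_seq_vanish[of m M] that x p by (simp add: kernel_dist2_def)
    ultimately have "schur_seq k p M x x \<le> kernel_dist2 k x (p m)"
      using schur_seq_dist2[OF x p, of m M] by simp
    moreover have "0 \<le> schur_seq k p M x x"
      by (rule psd_kernel_diag_nonneg[OF psd_kernel_schur_seq x])
    ultimately show ?thesis using m by simp
  qed
  then show "\<exists>no. \<forall>M\<ge>no. norm (schur_seq k p M x x - 0) < e" by blast
qed

lemma gram_coord_norm_sums:
  assumes "\<And>e. e > 0 \<Longrightarrow> \<exists>m. kernel_dist2 k x (p m) < e" and x: "x \<in> K"
  shows "(\<lambda>m. (gram_coord k p x m)\<^sup>2) sums k x x"
proof -
  have "(\<Sum>m<M. (gram_coord k p x m)\<^sup>2) = k x x - schur_seq k p M x x" for M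
    using schur_seq_decomp[OF x x, of M] by (simp add: power2_eq_square)
  moreover have "(\<lambda>M. k x x - schur_seq k p M x x) \<longlonglongrightarrow> k x x - 0"
    by (intro tendsto_intros schur_seq_diag_tendsto assms)
  ultimately show ?thesis by (simp add: sums_def)
qed

text \<open>The residual distance is controlled by the two residual norms, which tend to 0, so the
  coordinates exhaust the whole distance.\<close>

lemma gram_coord_dist_sums:
  assumes dense: "\<And>x e. x \<in> K \<Longrightarrow> e > 0 \<Longrightarrow> \<exists>m. kernel_dist2 k x (p m) < e" and x: "x \<in> K" "y \<in> K"
  shows "(\<lambda>m. (gram_coord k p x m - gram_coord k p y m)\<^sup>2) sums kernel_dist2 k x y"
proof -
  have "(\<lambda>M. 2 * (schur_seq k p M x x + schur_seq k p M y y)) \<longlonglongrightarrow> 2 * (0 + 0)"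
    by (intro tendsto_intros schur_seq_diag_tendsto assms)
  then have "(\<lambda>M. 2 * (schur_seq k p M x x + schur_seq k p M y y)) \<longlonglongrightarrow> 0" by simp
  moreover have "norm (kernel_dist2 (schur_seq k p M) x y) \<le> 2 * (schur_seq k p M x x + schur_seq k p M y y)" for M
    using psd_kernel_dist2_nonneg[OF psd_kernel_schur_seq[of M] x] psd_kernel_dist2_le[OF psd_kernel_schur_seq[of M] x]
    by simp
  ultimately have "(\<lambda>M. kernel_dist2 (schur_seq k p M) x y) \<longlonglongrightarrow> 0"
    by (rule Lim_null_comparison[OF always_eventually[OF allI], rotated])
  then have "(\<lambda>M. kernel_dist2 k x y - kernel_dist2 (schur_seq k p M) x y) \<longlonglongrightarrow> kernel_dist2 k x y - 0"
    by (intro tendsto_intros)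
  moreover have "(\<Sum>m<M. (gram_coord k p x m - gram_coord k p y m)\<^sup>2) =
      kernel_dist2 k x y - kernel_dist2 (schur_seq k p M) x y" for M
    using schur_seq_dist2[OF x, of M] by simp
  ultimately show ?thesis by (simp add: sums_def)
qed

end

section \<open>Sphere embeddings versus energy bounds\<close>

text \<open>After expansion the two sides differ by
  \<open>2 * (\<Sum>x\<in>X. c x * g x)\<^sup>2\<close>. Applied to one scalar component at a time,
  this turns equality of norms into an energy bound, both in \<open>ell2\<close> and in the function
  space used for the interval.\<close>

lemma quad_diff_le:
  fixes c g :: "'a \<Rightarrow> real"
  shows "(\<Sum>x\<in>X. \<Sum>y\<in>X. c x * c y * (g x - g y)\<^sup>2) \<le> 2 * (\<Sum>x\<in>X. c x) * (\<Sum>x\<in>X. c x * (g x)\<^sup>2)"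
proof -
  have "(\<Sum>x\<in>X. \<Sum>y\<in>X. c x * c y * (g x - g y)\<^sup>2) =
      (\<Sum>x\<in>X. \<Sum>y\<in>X. (c x * (g x)\<^sup>2) * c y) + (\<Sum>x\<in>X. \<Sum>y\<in>X. c x * (c y * (g y)\<^sup>2))
       - 2 * (\<Sum>x\<in>X. \<Sum>y\<in>X. (c x * g x) * (c y * g y))"
    by (simp add: sum.distrib[symmetric] sum_subtractf[symmetric] sum_distrib_left power2_eq_square algebra_simps)
  also have "\<dots> = 2 * (\<Sum>x\<in>X. c x) * (\<Sum>x\<in>X. c x * (g x)\<^sup>2) - 2 * (\<Sum>x\<in>X. c x * g x)\<^sup>2"
    unfolding sum_product[symmetric] by (simp add: power2_eq_square)
  finally show ?thesis by simp
qed

text \<open>\<open>quad_diff_le\<close> is summed over the coordinates; since all norms equal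
  \<open>R\<close>, the right side becomes a multiple of the squared total mass.\<close>

lemma energy_bounded_of_sphere_embeddable:
  assumes emb: "sphere_embeddable K d R"
  shows "energy_bounded K (\<lambda>x y. (d x y)\<^sup>2) (2 * R\<^sup>2)"
  unfolding energy_bounded_def
proof (intro allI impI)
  fix X :: "'a set" and c :: "'a \<Rightarrow> real" assume X: "finite X" "X \<subseteq> K"
  from emb obtain j where j: "j \<in> K \<rightarrow> ell2_sphere R"
    and d: "\<And>x y. x \<in> K \<Longrightarrow> y \<in> K \<Longrightarrow> ell2_norm (\<lambda>k. j x k - j y k) = d x y"
    unfolding sphere_embeddable_def by blast
  have s: "summable (\<lambda>k. (j x k)\<^sup>2)" if "x \<in> X" for x
    using j X that by (auto simp: ell2_sphere_def ell2_def Pi_iff)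
  have nR: "(\<Sum>k. (j x k)\<^sup>2) = R\<^sup>2" if "x \<in> X" for x
  proof -
    have "ell2_norm (j x) = R" using j X that by (auto simp: ell2_sphere_def Pi_iff)
    then show ?thesis using suminf_nonneg[OF s[OF that]] by (auto simp: ell2_norm_def)
  qed
  have sd: "summable (\<lambda>k. (j x k - j y k)\<^sup>2)" if "x \<in> X" "y \<in> X" for x y
  proof (rule summable_comparison_test')
    show "summable (\<lambda>k. 2 * ((j x k)\<^sup>2 + (j y k)\<^sup>2))"
      by (intro summable_mult summable_add s that)
    show "norm ((j x k - j y k)\<^sup>2) \<le> 2 * ((j x k)\<^sup>2 + (j y k)\<^sup>2)" if "k \<ge> 0" for k
      using zero_le_power2[of "j x k + j y k"] unfolding real_norm_def abs_power2
      by (simp add: power2_eq_square algebra_simps)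
  qed
  have nd: "(d x y)\<^sup>2 = (\<Sum>k. (j x k - j y k)\<^sup>2)" if "x \<in> X" "y \<in> X" for x y
  proof -
    have "d x y = sqrt (\<Sum>k. (j x k - j y k)\<^sup>2)"
      using d[of x y, symmetric] that X unfolding ell2_norm_def by (metis subsetD)
    then show ?thesis using suminf_nonneg[OF sd[OF that]] by simp
  qed
  define S where "S = (\<Sum>x\<in>X. c x)"
  have "(\<lambda>k. \<Sum>x\<in>X. \<Sum>y\<in>X. c x * c y * (j x k - j y k)\<^sup>2) sums (\<Sum>x\<in>X. \<Sum>y\<in>X. c x * c y * (\<Sum>k. (j x k - j y k)\<^sup>2))"
    by (intro sums_sum sums_mult summable_sums sd)
  then have 1: "(\<lambda>k. \<Sum>x\<in>X. \<Sum>y\<in>X. c x * c y * (j x k - j y k)\<^sup>2) sums (\<Sum>x\<in>X. \<Sum>y\<in>X. c x * c y * (d x y)\<^sup>2)"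
    using nd by simp
  have "(\<lambda>k. 2 * S * (\<Sum>x\<in>X. c x * (j x k)\<^sup>2)) sums (2 * S * (\<Sum>x\<in>X. c x * (\<Sum>k. (j x k)\<^sup>2)))"
    by (intro sums_sum sums_mult summable_sums s)
  also have "(\<Sum>x\<in>X. c x * (\<Sum>k. (j x k)\<^sup>2)) = S * R\<^sup>2"
    using nR by (simp add: S_def sum_distrib_right)
  finally have 2: "(\<lambda>k. 2 * S * (\<Sum>x\<in>X. c x * (j x k)\<^sup>2)) sums (2 * S * (S * R\<^sup>2))" .
  have "(\<Sum>x\<in>X. \<Sum>y\<in>X. c x * c y * (j x k - j y k)\<^sup>2) \<le> 2 * S * (\<Sum>x\<in>X. c x * (j x k)\<^sup>2)" for k
    unfolding S_def by (rule quad_diff_le)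
  from sums_le[OF this 1 2] show "(\<Sum>x\<in>X. \<Sum>y\<in>X. c x * c y * (d x y)\<^sup>2) \<le> 2 * R\<^sup>2 * (\<Sum>x\<in>X. c x)\<^sup>2"
    by (simp add: S_def power2_eq_square mult_ac)
qed


lemma psd_kernel_of_energy_bounded:
  assumes e: "energy_bounded K f C" and sym: "\<And>x y. x \<in> K \<Longrightarrow> y \<in> K \<Longrightarrow> f x y = f y x"
  shows "psd_kernel K (\<lambda>x y. C / 2 - f x y / 2)"
  unfolding psd_kernel_def
proof (intro conjI ballI allI impI)
  fix X :: "'a set" and c :: "'a \<Rightarrow> real" assume X: "finite X" "X \<subseteq> K"
  have "(\<Sum>x\<in>X. \<Sum>y\<in>X. c x * c y * (C / 2 - f x y / 2)) =
     (C * (\<Sum>x\<in>X. \<Sum>y\<in>X. c x * c y) - (\<Sum>x\<in>X. \<Sum>y\<in>X. c x * c y * f x y)) / 2"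
    by (simp add: sum_subtractf[symmetric] sum_distrib_left sum_divide_distrib diff_divide_distrib algebra_simps)
  also have "(\<Sum>x\<in>X. \<Sum>y\<in>X. c x * c y) = (\<Sum>x\<in>X. c x)\<^sup>2"
    by (simp add: power2_eq_square sum_product)
  finally show "0 \<le> (\<Sum>x\<in>X. \<Sum>y\<in>X. c x * c y * (C / 2 - f x y / 2))"
    using e[unfolded energy_bounded_def, rule_format, OF X, of c] by simp
qed (simp add: sym)

text \<open>The kernel \<open>R\<^sup>2 - d\<^sup>2 / 2\<close> is positive semidefinite, has
  constant diagonal \<open>R\<^sup>2\<close> and induces the squared distance
  \<open>d\<^sup>2\<close>. Taking a dense sequence as pivots, its Gram coordinates are the
  embedding into \<open>ell2\<close>.\<close>

lemma sphere_embeddable_of_energy_bounded: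
  assumes e: "energy_bounded K (\<lambda>x y. (d x y)\<^sup>2) (2 * R\<^sup>2)" and R: "0 \<le> R"
    and sym: "\<And>x y. x \<in> K \<Longrightarrow> y \<in> K \<Longrightarrow> d x y = d y x"
    and diag: "\<And>x. x \<in> K \<Longrightarrow> d x x = 0"
    and nonneg: "\<And>x y. x \<in> K \<Longrightarrow> y \<in> K \<Longrightarrow> 0 \<le> d x y"
    and p: "\<And>m::nat. p m \<in> K" and dense: "\<And>x e. x \<in> K \<Longrightarrow> e > 0 \<Longrightarrow> \<exists>m. d x (p m) < e"
  shows "sphere_embeddable K d R"
proof -
  define k where "k = (\<lambda>x y. R\<^sup>2 - (d x y)\<^sup>2 / 2)"
  have k: "psd_kernel K k"
    using psd_kernel_of_energy_bounded[OF e] sym by (simp add: k_def)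
  have kd: "kernel_dist2 k x y = (d x y)\<^sup>2" if "x \<in> K" "y \<in> K" for x y
    using that diag by (simp add: k_def kernel_dist2_def)
  have de: "\<exists>m. kernel_dist2 k x (p m) < e" if x: "x \<in> K" and "e > 0" for x e
  proof -
    obtain m where "d x (p m) < sqrt e" using dense[OF x, of "sqrt e"] \<open>e > 0\<close> by auto
    then have "(d x (p m))\<^sup>2 < (sqrt e)\<^sup>2" using nonneg[OF x p] by (intro power_strict_mono) auto
    then show ?thesis using kd x p \<open>e > 0\<close> by auto
  qed
  show ?thesis
    unfolding sphere_embeddable_def
  proof (intro exI[of _ "gram_coord k p"] conjI ballI Pi_I)
    fix x assume x: "x \<in> K"
    note s = gram_coord_norm_sums[OF k p de[OF x] x]
    have "k x x = R\<^sup>2" using diag[OF x] by (simp add: k_def)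
    then show "gram_coord k p x \<in> ell2_sphere R"
      using s R by (auto simp: ell2_sphere_def ell2_def ell2_norm_def sums_iff)
  next
    fix x y assume x: "x \<in> K" "y \<in> K"
    have "(\<lambda>m. (gram_coord k p x m - gram_coord k p y m)\<^sup>2) sums kernel_dist2 k x y"
      by (rule gram_coord_dist_sums[OF k p de x])
    then show "ell2_norm (\<lambda>m. gram_coord k p x m - gram_coord k p y m) = d x y"
      using nonneg[OF x] kd[OF x] by (simp add: ell2_norm_def sums_iff)
  qed
qed

text \<open>Unit masses at two points. The case \<open>x = y\<close> shows that energy bounds are
  nonnegative; a pair at distance 1 later settles small dimensions in the lower bound.\<close>

lemma energy_bounded_two_points:
  assumes "energy_bounded K f C" "x \<in> K" "y \<in> K" "f x x = 0" "f y y = 0" "f x y = f y x"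
  shows "f x y / 2 \<le> C"
proof (cases "x = y")
  case True
  then show ?thesis
    using assms(1)[unfolded energy_bounded_def, rule_format, of "{x}" "\<lambda>_. 1"] assms by simp
next
  case False
  then show ?thesis
    using assms(1)[unfolded energy_bounded_def, rule_format, of "{x,y}" "\<lambda>_. 1"] assms by (simp add: power2_eq_square)
qed

text \<open>The set of energy bounds is closed, so its infimum is a bound; this is why the minimum is attained.\<close>

lemma is_min_sphere_radius_energy:
  assumes ne: "K \<noteq> {}" and bdd: "energy_bounded K (\<lambda>x y. (d x y)\<^sup>2) C0"
    and sym: "\<And>x y. x \<in> K \<Longrightarrow> y \<in> K \<Longrightarrow> d x y = d y x"
    and diag: "\<And>x. x \<in> K \<Longrightarrow> d x x = 0"
    and nonneg: "\<And>x y. x \<in> K \<Longrightarrow> y \<in> K \<Longrightarrow> 0 \<le> d x y"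
    and p: "\<And>m::nat. p m \<in> K" and dense: "\<And>x e. x \<in> K \<Longrightarrow> e > 0 \<Longrightarrow> \<exists>m. d x (p m) < e"
  obtains R where "is_min_sphere_radius K d R" "0 \<le> R"
    "energy_bounded K (\<lambda>x y. (d x y)\<^sup>2) (2 * R\<^sup>2)"
    "\<And>C. energy_bounded K (\<lambda>x y. (d x y)\<^sup>2) C \<Longrightarrow> 2 * R\<^sup>2 \<le> C"
proof -
  let ?f = "\<lambda>x y. (d x y)\<^sup>2"
  define S where "S = {C. energy_bounded K ?f C}"
  obtain x0 where x0: "x0 \<in> K" using ne by blast
  have S0: "0 \<le> C" if "C \<in> S" for C
    using energy_bounded_two_points[of K ?f C x0 x0] that x0 diag by (simp add: S_def)
  have Sne: "S \<noteq> {}" using bdd by (auto simp: S_def)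
  have bb: "bdd_below S" using S0 by (auto intro!: bdd_belowI)
  have eInf: "energy_bounded K ?f (Inf S)"
    unfolding energy_bounded_def
  proof (intro allI impI)
    fix X :: "'a set" and c :: "'a \<Rightarrow> real" assume X: "finite X" "X \<subseteq> K"
    let ?E = "\<Sum>x\<in>X. \<Sum>y\<in>X. c x * c y * (d x y)\<^sup>2" and ?s = "(\<Sum>x\<in>X. c x)\<^sup>2"
    have le: "?E \<le> C * ?s" if "C \<in> S" for C using that X by (auto simp: S_def energy_bounded_def)
    have "?E \<le> Inf S * ?s + e" if e: "e > 0" for e
    proof -
      \<comment> \<open>The \<open>+ 1\<close> keeps the denominator positive when the total mass is
        0.\<close>
      obtain C where C: "C \<in> S" "C < Inf S + e / (?s + 1)"
        using cInf_lessD[OF Sne, of "Inf S + e / (?s + 1)"] e by (auto simp: add_pos_nonneg add_nonneg_pos)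
      have "?E \<le> C * ?s" by (rule le[OF C(1)])
      also have "\<dots> \<le> (Inf S + e / (?s + 1)) * ?s" using C by (intro mult_right_mono) auto
      also have "\<dots> = Inf S * ?s + e * (?s / (?s + 1))" by (simp add: algebra_simps)
      also have "\<dots> \<le> Inf S * ?s + e * 1"
        using e zero_le_power2[of "\<Sum>x\<in>X. c x"] by (intro add_left_mono mult_left_mono) (auto simp: divide_le_eq_1 add_nonneg_pos)
      finally show ?thesis by simp
    qed
    then show "?E \<le> Inf S * ?s" by (rule field_le_epsilon)
  qed
  have Sinf: "Inf S \<in> S" using eInf by (simp add: S_def)
  define R where "R = sqrt (Inf S / 2)"
  have R0: "0 \<le> R" using S0[OF Sinf] by (simp add: R_def)
  have R2: "2 * R\<^sup>2 = Inf S" using S0[OF Sinf] by (simp add: R_def)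
  have eR: "energy_bounded K ?f (2 * R\<^sup>2)" using Sinf R2 by (simp add: S_def)
  have min: "2 * R\<^sup>2 \<le> C" if "energy_bounded K ?f C" for C
    using cInf_lower[OF _ bb, of C] that by (simp add: R2 S_def)
  have "is_min_sphere_radius K d R"
    unfolding is_min_sphere_radius_def
    proof (intro conjI allI impI)
      show "sphere_embeddable K d R"
        by (rule sphere_embeddable_of_energy_bounded[OF eR R0 sym diag nonneg p dense])
      fix R' assume R': "sphere_embeddable K d R'"
      then obtain z where "z \<in> ell2_sphere R'" using x0 by (auto simp: sphere_embeddable_def)
      then have "0 \<le> R'" by (auto simp: ell2_sphere_def ell2_def ell2_norm_def intro!: suminf_nonneg)
      moreover have "R\<^sup>2 \<le> R'\<^sup>2"
        using min[OF energy_bounded_of_sphere_embeddable[OF R']] by simp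
      ultimately show "R \<le> R'" using power2_le_imp_le by blast
    qed
  from that[OF this R0 eR min] show thesis .
qed

section \<open>Fractional Brownian kernels on a sphere\<close>


text \<open>Passes from gauge integrals, in which the integrals of real powers are available, to
  Lebesgue integrals; nonnegativity makes the two agree.\<close>

lemma set_integrable_lborel_nonneg:
  fixes f :: "real \<Rightarrow> real"
  assumes "f integrable_on S" "\<And>x. x \<in> S \<Longrightarrow> 0 \<le> f x"
    and [measurable]: "f \<in> borel_measurable borel" "S \<in> sets borel"
  shows "integrable lborel (\<lambda>x. indicator S x * f x)"
proof -
  have "f absolutely_integrable_on S"
    by (rule nonnegative_absolutely_integrable_1[OF assms(1,2)])
  then have "integrable lebesgue (\<lambda>x. indicator S x * f x)"
    by (simp add: set_integrable_def)
  then show ?thesis by (subst (asm) integrable_completion) auto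
qed

section \<open>Increments of the moving-average kernels\<close>

definition pos_powr :: "real \<Rightarrow> real \<Rightarrow> real" where
  "pos_powr b u = (max 0 u) powr b"

lemma pos_powr_measurable [measurable]: "pos_powr b \<in> borel_measurable borel"
  unfolding pos_powr_def[abs_def] by measurable

lemma pos_powr_nonpos [simp]: "u \<le> 0 \<Longrightarrow> pos_powr b u = 0"
  by (simp add: pos_powr_def max_def)

lemma pos_powr_pos: "0 < u \<Longrightarrow> pos_powr b u = u powr b"
  by (simp add: pos_powr_def max_def)

lemma pos_powr_nonneg: "0 \<le> pos_powr b u"
  by (simp add: pos_powr_def)

lemma pos_powr_mult: "0 \<le> c \<Longrightarrow> pos_powr b (c * u) = c powr b * pos_powr b u"
  by (cases "u \<le> 0") (auto simp: pos_powr_def max_def powr_mult mult_le_0_iff zero_le_mult_iff)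

lemma integrable_pos_powr_sq_interval:
  assumes "- (1 / 2) < b" "0 \<le> c"
  shows "integrable lborel (\<lambda>u. indicator {..c} u * (pos_powr b u)\<^sup>2)"
proof -
  have "integrable lborel (\<lambda>u. indicator {0..c} u * u powr (2 * b))"
    using assms by (intro set_integrable_lborel_nonneg integrable_on_powr_from_0) auto
  also have "(\<lambda>u. indicator {0..c} u * u powr (2 * b)) = (\<lambda>u. indicator {..c} u * (pos_powr b u)\<^sup>2)"
  proof
    fix u :: real
    consider "u < 0" | "u = 0" | "u > 0" by linarith
    then show "indicator {0..c} u * u powr (2 * b) = indicator {..c} u * (pos_powr b u)\<^sup>2"
      by cases (auto simp: indicator_def pos_powr_pos power2_eq_square powr_add[symmetric])
  qed
  finally show ?thesis .
qed

text \<open>Near the singularities the two powers are estimated separately, which needs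
  \<open>b > - 1 / 2\<close>. For \<open>u < - 1\<close> the mean value theorem gives decay of order
  \<open>b - 1\<close>, square integrable because \<open>b < 1 / 2\<close>.\<close>

lemma integrable_pos_powr_diff:
  assumes b: "- (1 / 2) < b" "b < 1 / 2"
  shows "integrable lborel (\<lambda>u. (pos_powr b (1 - u) - pos_powr b (- u))\<^sup>2)"
proof -
  let ?D = "\<lambda>u. 2 * (indicator {..2} (1 - u) * (pos_powr b (1 - u))\<^sup>2)
     + 2 * (indicator {..1} (- u) * (pos_powr b (- u))\<^sup>2) + b\<^sup>2 * (indicator {1..} (- u) * (- u) powr (2 * b - 2))"
  have i1: "integrable lborel (\<lambda>u. indicator {..2} (1 - u) * (pos_powr b (1 - u))\<^sup>2)"
    using lborel_integrable_real_affine[OF integrable_pos_powr_sq_interval[OF b(1), of 2], of "-1" 1] by simp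
  have i2: "integrable lborel (\<lambda>u. indicator {..1} (- u) * (pos_powr b (- u))\<^sup>2)"
    using lborel_integrable_real_affine[OF integrable_pos_powr_sq_interval[OF b(1), of 1], of "-1" 0] by simp
  have "(\<lambda>u::real. u powr (2 * b - 2)) integrable_on {1..}"
    using has_integral_powr_to_inf[of "2 * b - 2" 1] b by (auto simp: integrable_on_def)
  then have "integrable lborel (\<lambda>u. indicator {1..} u * u powr (2 * b - 2))"
    by (intro set_integrable_lborel_nonneg) auto
  then have i3: "integrable lborel (\<lambda>u. indicator {1..} (- u) * (- u) powr (2 * b - 2))"
    using lborel_integrable_real_affine[of "\<lambda>u. indicator {1..} u * u powr (2 * b - 2)" "-1" 0] by simp
  have "integrable lborel ?D" using i1 i2 i3 by simp
  then show ?thesis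
  proof (rule Bochner_Integration.integrable_bound)
    show "AE u in lborel. norm ((pos_powr b (1 - u) - pos_powr b (- u))\<^sup>2) \<le> norm (?D u)"
    proof (intro AE_I2)
      fix u :: real
      have D0: "0 \<le> ?D u" by (auto simp: indicator_def)
      have "(pos_powr b (1 - u) - pos_powr b (- u))\<^sup>2 \<le> ?D u"
      proof (cases "- 1 \<le> u")
        case True
        have "(pos_powr b (1 - u) - pos_powr b (- u))\<^sup>2 \<le> 2 * (pos_powr b (1 - u))\<^sup>2 + 2 * (pos_powr b (- u))\<^sup>2"
          using zero_le_power2[of "pos_powr b (1 - u) + pos_powr b (- u)"] by (simp add: power2_eq_square algebra_simps)
        also have "\<dots> \<le> ?D u" using True by (simp add: indicator_def)
        finally show ?thesis .
      next
        case False
        define v where "v = - u"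
        have v: "v > 1" using False by (simp add: v_def)
        have "\<exists>z>v. z < v + 1 \<and> (v + 1) powr b - v powr b = (v + 1 - v) * (b * z powr (b - 1))"
          by (rule MVT2) (use v in \<open>auto intro!: has_real_derivative_powr\<close>)
        then obtain z where z: "z > v" "(v + 1) powr b - v powr b = b * z powr (b - 1)" by auto
        have "(pos_powr b (1 - u) - pos_powr b (- u))\<^sup>2 = (b * z powr (b - 1))\<^sup>2"
          using v z by (simp add: v_def pos_powr_pos add.commute)
        also have "\<dots> \<le> b\<^sup>2 * (v powr (b - 1))\<^sup>2"
          unfolding power_mult_distrib using z v b by (intro mult_left_mono power_mono powr_mono2') auto
        also have "\<dots> = b\<^sup>2 * (indicator {1..} (- u) * (- u) powr (2 * b - 2))"
          using v by (simp add: v_def power2_eq_square powr_add[symmetric])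
        also have "\<dots> \<le> ?D u" by (simp add: indicator_def)
        finally show ?thesis .
      qed
      then show "norm ((pos_powr b (1 - u) - pos_powr b (- u))\<^sup>2) \<le> norm (?D u)"
        using D0 by simp
    qed
  qed measurable
qed

text \<open>The normalising constant in the moving-average representation of fractional Brownian
  motion with Hurst index \<open>b + 1 / 2\<close>.\<close>

definition frac_const :: "real \<Rightarrow> real" where
  "frac_const b = (\<integral>u. (pos_powr b (1 - u) - pos_powr b (- u))\<^sup>2 \<partial>lborel)"

lemma has_bochner_integral_mono:
  fixes f g :: "'a \<Rightarrow> real"
  assumes "has_bochner_integral M f I" "has_bochner_integral M g J" "\<And>x. f x \<le> g x"
  shows "I \<le> J"
  using integral_mono[OF integrable.intros[OF assms(1)] integrable.intros[OF assms(2)] assms(3)]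
  unfolding has_bochner_integral_integral_eq[OF assms(1)] has_bochner_integral_integral_eq[OF assms(2)] .

lemma integral_pos_pos:
  fixes f :: "real \<Rightarrow> real"
  assumes "integrable lborel f" "\<And>x. 0 \<le> f x" "\<And>x. 0 < x \<Longrightarrow> x < 1 \<Longrightarrow> 0 < f x"
  shows "0 < (\<integral>x. f x \<partial>lborel)"
proof (rule ccontr)
  assume "\<not> 0 < (\<integral>x. f x \<partial>lborel)"
  moreover have "0 \<le> (\<integral>x. f x \<partial>lborel)" by (simp add: assms(2))
  ultimately have "(\<integral>x. f x \<partial>lborel) = 0" by simp
  then have "AE x in lborel. f x = 0"
    using integral_nonneg_eq_0_iff_AE[OF assms(1)] assms(2) by simp
  then have "AE x in lborel. x \<notin> {0<..<1::real}"
    by eventually_elim (use assms(3) in force)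
  then have "emeasure lborel {0<..<1::real} = 0"
    by (subst (asm) AE_iff_measurable[of "{0<..<1}"]) auto
  then show False by simp
qed

lemma frac_const_pos:
  assumes b: "- (1 / 2) < b" "b < 1 / 2"
  shows "0 < frac_const b"
  unfolding frac_const_def
  by (rule integral_pos_pos[OF integrable_pos_powr_diff[OF b]]) (auto simp: pos_powr_pos)

text \<open>Substitute \<open>u = s + d * w\<close> with \<open>d = t - s\<close>: homogeneity
  contributes \<open>d powr (2 * b)\<close> and the Jacobian one more factor
  \<open>d\<close>.\<close>

lemma has_bochner_integral_pos_powr_diff:
  assumes b: "- (1 / 2) < b" "b < 1 / 2"
  shows "has_bochner_integral lborel (\<lambda>u. (pos_powr b (t - u) - pos_powr b (s - u))\<^sup>2)
     (frac_const b * \<bar>t - s\<bar> powr (2 * b + 1))"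
proof -
  have main: "has_bochner_integral lborel (\<lambda>u. (pos_powr b (t - u) - pos_powr b (s - u))\<^sup>2)
     (frac_const b * \<bar>t - s\<bar> powr (2 * b + 1))" if st: "s < t" for s t :: real
  proof -
    let ?f = "\<lambda>u. (pos_powr b (t - u) - pos_powr b (s - u))\<^sup>2"
    define d where "d = t - s"
    have d: "d > 0" using st by (simp add: d_def)
    have eq: "?f (s + d * w) = d powr (2 * b) * (pos_powr b (1 - w) - pos_powr b (- w))\<^sup>2" for w
    proof -
      have "t - (s + d * w) = d * (1 - w)" "s - (s + d * w) = d * (- w)" by (simp_all add: d_def algebra_simps)
      then have "?f (s + d * w) = (d powr b * pos_powr b (1 - w) - d powr b * pos_powr b (- w))\<^sup>2"
        using d by (simp only: pos_powr_mult)
      also have "\<dots> = (d powr b)\<^sup>2 * (pos_powr b (1 - w) - pos_powr b (- w))\<^sup>2"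
        by (simp add: power2_eq_square algebra_simps)
      finally show ?thesis by (simp add: power2_eq_square powr_add[symmetric])
    qed
    have "has_bochner_integral lborel (\<lambda>w. d powr (2 * b) * (pos_powr b (1 - w) - pos_powr b (- w))\<^sup>2) (d powr (2 * b) * frac_const b)"
      unfolding frac_const_def using integrable_pos_powr_diff[OF b]
      by (intro has_bochner_integral_mult_right has_bochner_integral_integrable)
    then have "has_bochner_integral lborel (\<lambda>w. ?f (s + d * w)) (d powr (2 * b) * frac_const b)"
      unfolding eq .
    moreover have "(d powr (2 * b + 1) * frac_const b) /\<^sub>R \<bar>d\<bar> = d powr (2 * b) * frac_const b"
      using d by (simp add: powr_add)
    ultimately have "has_bochner_integral lborel (\<lambda>w. ?f (s + d * w)) ((d powr (2 * b + 1) * frac_const b) /\<^sub>R \<bar>d\<bar>)"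
      by (simp only:)
    then show ?thesis
      using lborel_has_bochner_integral_real_affine_iff[of d ?f "d powr (2 * b + 1) * frac_const b" s] d
      by (simp add: d_def mult.commute)
  qed
  consider "s < t" | "s = t" | "t < s" by linarith
  then show ?thesis
  proof cases
    case 3
    then show ?thesis
      using main[of t s] by (simp add: power2_commute abs_minus_commute)
  qed (use main in \<open>auto simp: has_bochner_integral_zero\<close>)
qed

text \<open>The profile subtracted from the moving-average kernels of fractional Brownian motion; it is chosen
  such that the corrected kernels all have the same \<open>L\<^sup>2\<close> norm, that is, lie on a sphere.\<close>

definition unit_powr :: "real \<Rightarrow> real \<Rightarrow> real" where
  "unit_powr b u = (if 0 < u \<and> u < 1 then u powr b else 0)"

lemma unit_powr_measurable [measurable]: "unit_powr b \<in> borel_measurable borel"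
  unfolding unit_powr_def[abs_def] by measurable

lemma integrable_unit_powr_sq:
  assumes "- (1 / 2) < b"
  shows "integrable lborel (\<lambda>u. (unit_powr b u)\<^sup>2)"
  by (rule Bochner_Integration.integrable_bound[OF integrable_pos_powr_sq_interval[OF assms, of 1]])
     (auto simp: unit_powr_def pos_powr_pos)

text \<open>Euler's Beta integral with both parameters equal to \<open>b + 1\<close>.\<close>

definition beta_const :: "real \<Rightarrow> real" where
  "beta_const b = (\<integral>u. pos_powr b (1 - u) * unit_powr b u \<partial>lborel)"

lemma integrable_mult_of_sq:
  fixes f g :: "'a \<Rightarrow> real"
  assumes "integrable M (\<lambda>x. (f x)\<^sup>2)" "integrable M (\<lambda>x. (g x)\<^sup>2)"
    and [measurable]: "f \<in> borel_measurable M" "g \<in> borel_measurable M"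
  shows "integrable M (\<lambda>x. f x * g x)"
proof (rule Bochner_Integration.integrable_bound)
  show "integrable M (\<lambda>x. (f x)\<^sup>2 + (g x)\<^sup>2)" using assms by simp
  show "AE x in M. norm (f x * g x) \<le> norm ((f x)\<^sup>2 + (g x)\<^sup>2)"
  proof (intro AE_I2)
    fix x
    have "2 * \<bar>f x\<bar> * \<bar>g x\<bar> \<le> (f x)\<^sup>2 + (g x)\<^sup>2" using sum_squares_bound[of "\<bar>f x\<bar>" "\<bar>g x\<bar>"] by simp
    moreover have "0 \<le> \<bar>f x\<bar> * \<bar>g x\<bar>" by simp
    ultimately have "\<bar>f x\<bar> * \<bar>g x\<bar> \<le> (f x)\<^sup>2 + (g x)\<^sup>2" by linarith
    then show "norm (f x * g x) \<le> norm ((f x)\<^sup>2 + (g x)\<^sup>2)" by (simp add: abs_mult)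
  qed
qed measurable

lemma integrable_pos_unit_powr:
  assumes b: "- (1 / 2) < b" "b < 1 / 2"
  shows "integrable lborel (\<lambda>u. (pos_powr b (t - u) - pos_powr b (s - u)) * unit_powr b u)"
  using has_bochner_integral_pos_powr_diff[OF b, of t s] integrable_unit_powr_sq[OF b(1)]
  by (intro integrable_mult_of_sq) (auto simp: has_bochner_integral_iff)

text \<open>\<open>unit_powr b\<close> lives on positive \<open>u\<close>, where the second power
  vanishes. The difference is kept elsewhere because, for \<open>b > - 1 / 2\<close>, a single
  truncated power is not square integrable on the line.\<close>

lemma pos_unit_powr_eq: "(pos_powr b (t - u) - pos_powr b (- u)) * unit_powr b u = pos_powr b (t - u) * unit_powr b u"
  by (auto simp: unit_powr_def)

lemma beta_const_pos:
  assumes b: "- (1 / 2) < b" "b < 1 / 2"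
  shows "0 < beta_const b"
  unfolding beta_const_def
  using integrable_pos_unit_powr[OF b, of 1 0]
  by (intro integral_pos_pos) (simp add: pos_unit_powr_eq, auto simp: unit_powr_def pos_powr_pos pos_powr_nonneg)

text \<open>For \<open>t \<le> 1\<close> the product is supported in \<open>0 < u < t\<close>, so
  the cut-off at 1 is invisible and \<open>u = t * w\<close> scales out the same power of
  \<open>t\<close> as in the squared norm of the increment.\<close>

lemma has_bochner_integral_pos_unit_powr:
  assumes b: "- (1 / 2) < b" "b < 1 / 2" and t: "0 \<le> t" "t \<le> 1"
  shows "has_bochner_integral lborel (\<lambda>u. (pos_powr b (t - u) - pos_powr b (- u)) * unit_powr b u)
     (beta_const b * t powr (2 * b + 1))"
proof (cases "t = 0")
  case True
  then show ?thesis by (simp add: has_bochner_integral_zero)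
next
  case False
  then have t: "0 < t" "t \<le> 1" using t by auto
  let ?f = "\<lambda>u. pos_powr b (t - u) * unit_powr b u"
  have eq: "?f (0 + t * w) = t powr (2 * b) * (pos_powr b (1 - w) * unit_powr b w)" for w
  proof -
    have "pos_powr b (t - t * w) = t powr b * pos_powr b (1 - w)"
      using t pos_powr_mult[of t b "1 - w"] by (simp add: algebra_simps)
    moreover have "pos_powr b (1 - w) * unit_powr b (t * w) = pos_powr b (1 - w) * (t powr b * unit_powr b w)"
    proof (cases "w < 1")
      case True
      have "t * w < 1" if "0 < w" using t True that mult_strict_mono[of t 1 w 1]
        by (smt (verit) mult_less_cancel_left2 mult_less_cancel_right2)
      then show ?thesis using t True by (auto simp: unit_powr_def powr_mult zero_less_mult_iff)
    qed auto
    ultimately have "?f (0 + t * w) = t powr b * t powr b * (pos_powr b (1 - w) * unit_powr b w)" by simp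
    then show ?thesis by (simp add: powr_add[symmetric])
  qed
  have i: "integrable lborel (\<lambda>u. pos_powr b (1 - u) * unit_powr b u)"
    using integrable_pos_unit_powr[OF b, of 1 0] by (simp add: pos_unit_powr_eq)
  have "has_bochner_integral lborel (\<lambda>w. t powr (2 * b) * (pos_powr b (1 - w) * unit_powr b w)) (t powr (2 * b) * beta_const b)"
    unfolding beta_const_def by (intro has_bochner_integral_mult_right has_bochner_integral_integrable i)
  moreover have "(t powr (2 * b + 1) * beta_const b) /\<^sub>R \<bar>t\<bar> = t powr (2 * b) * beta_const b"
    using t by (simp add: powr_add)
  ultimately have "has_bochner_integral lborel (\<lambda>w. ?f (0 + t * w)) ((t powr (2 * b + 1) * beta_const b) /\<^sub>R \<bar>t\<bar>)"
    unfolding eq by (simp only:)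
  then show ?thesis
    unfolding pos_unit_powr_eq
    using lborel_has_bochner_integral_real_affine_iff[of t ?f "t powr (2 * b + 1) * beta_const b" 0] t
    by (simp add: mult.commute)
qed

section \<open>Energies of subsets of an interval\<close>

text \<open>The functions \<open>J t\<close> lie on a sphere of squared radius \<open>V\<close> in
  the square integrable functions, and their distances are the required powers up to the factor
  \<open>A\<close>. So \<open>quad_diff_le\<close> can be integrated over \<open>u\<close>.\<close>

lemma energy_unit_interval:
  fixes a :: real assumes a: "0 < a" "a < 1"
  obtains C where "0 \<le> C"
    "\<And>(X::'a set) c g. finite X \<Longrightarrow> (\<And>x. x \<in> X \<Longrightarrow> 0 \<le> g x \<and> g x \<le> 1) \<Longrightarrow>
      (\<Sum>x\<in>X. \<Sum>y\<in>X. c x * c y * \<bar>g x - g y\<bar> powr (2 * a)) \<le> C * (\<Sum>x\<in>X. c x)\<^sup>2"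
proof -
  define b where "b = a - 1 / 2"
  have b: "- (1 / 2) < b" "b < 1 / 2" using a by (auto simp: b_def)
  have ab: "2 * b + 1 = 2 * a" by (simp add: b_def)
  define A where "A = frac_const b"
  define B where "B = beta_const b"
  have A: "A > 0" and B: "B > 0" using frac_const_pos[OF b] beta_const_pos[OF b] by (auto simp: A_def B_def)
  define V where "V = (A / (2 * B))\<^sup>2 * (\<integral>u. (unit_powr b u)\<^sup>2 \<partial>lborel)"
  \<comment> \<open>The coefficient \<open>A / (2 * B)\<close> makes the cross term equal to
    \<open>- A * t powr (2 * a)\<close>, which cancels the squared norm of the increment.\<close>
  define J where "J = (\<lambda>t u. pos_powr b (t - u) - pos_powr b (- u) - A / (2 * B) * unit_powr b u)"
  have J: "has_bochner_integral lborel (\<lambda>u. (J t u)\<^sup>2) V" if t: "0 \<le> t \<and> t \<le> 1" for t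
  proof -
    have eq: "(\<lambda>u. (J t u)\<^sup>2) = (\<lambda>u. (pos_powr b (t - u) - pos_powr b (0 - u))\<^sup>2
       - A / B * ((pos_powr b (t - u) - pos_powr b (- u)) * unit_powr b u) + (A / (2 * B))\<^sup>2 * (unit_powr b u)\<^sup>2)"
      using B by (auto simp: J_def fun_eq_iff power2_eq_square field_simps)
    have "has_bochner_integral lborel (\<lambda>u. (J t u)\<^sup>2) (A * \<bar>t - 0\<bar> powr (2 * b + 1) - A / B * (B * t powr (2 * b + 1)) + V)"
      unfolding eq V_def A_def using t integrable_unit_powr_sq[OF b(1)]
      by (intro has_bochner_integral_add has_bochner_integral_diff has_bochner_integral_pos_powr_diff b
         has_bochner_integral_mult_right has_bochner_integral_pos_unit_powr[OF b, folded B_def] has_bochner_integral_integrable) auto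
    then show ?thesis using t B by simp
  qed
  have V: "0 \<le> V" by (simp add: V_def)
  show thesis
  proof (rule that[of "2 * V / A"])
    show "0 \<le> 2 * V / A" using V A by simp
    fix X :: "'a set" and c g :: "'a \<Rightarrow> real" assume X: "finite X" and g: "\<And>x. x \<in> X \<Longrightarrow> 0 \<le> g x \<and> g x \<le> 1"
    have 1: "has_bochner_integral lborel (\<lambda>u. \<Sum>x\<in>X. \<Sum>y\<in>X. c x * c y * (J (g x) u - J (g y) u)\<^sup>2)
       (\<Sum>x\<in>X. \<Sum>y\<in>X. c x * c y * (A * \<bar>g x - g y\<bar> powr (2 * a)))"
      unfolding A_def J_def ab[symmetric]
      using has_bochner_integral_pos_powr_diff[OF b]
      by (intro has_bochner_integral_sum has_bochner_integral_mult_right) simp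
    have 2: "has_bochner_integral lborel (\<lambda>u. 2 * (\<Sum>x\<in>X. c x) * (\<Sum>x\<in>X. c x * (J (g x) u)\<^sup>2))
       (2 * (\<Sum>x\<in>X. c x) * (\<Sum>x\<in>X. c x * V))"
      using J g by (intro has_bochner_integral_sum has_bochner_integral_mult_right) auto
    have "(\<Sum>x\<in>X. \<Sum>y\<in>X. c x * c y * (A * \<bar>g x - g y\<bar> powr (2 * a))) \<le> 2 * (\<Sum>x\<in>X. c x) * (\<Sum>x\<in>X. c x * V)"
      by (rule has_bochner_integral_mono[OF 1 2 quad_diff_le])
    also have "\<dots> = 2 * V * (\<Sum>x\<in>X. c x)\<^sup>2"
      by (simp add: sum_distrib_right[symmetric] power2_eq_square)
    also have "(\<Sum>x\<in>X. \<Sum>y\<in>X. c x * c y * (A * \<bar>g x - g y\<bar> powr (2 * a)))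
      = A * (\<Sum>x\<in>X. \<Sum>y\<in>X. c x * c y * \<bar>g x - g y\<bar> powr (2 * a))"
      by (simp add: sum_distrib_left mult_ac)
    finally show "(\<Sum>x\<in>X. \<Sum>y\<in>X. c x * c y * \<bar>g x - g y\<bar> powr (2 * a)) \<le> 2 * V / A * (\<Sum>x\<in>X. c x)\<^sup>2"
      using A by (simp add: field_simps)
  qed
qed

lemma energy_interval:
  fixes a :: real assumes a: "0 < a" "a < 1"
  obtains C where "0 \<le> C"
    "\<And>(X::'a set) c g L. finite X \<Longrightarrow> (\<And>x. x \<in> X \<Longrightarrow> \<bar>g x\<bar> \<le> L) \<Longrightarrow>
      (\<Sum>x\<in>X. \<Sum>y\<in>X. c x * c y * \<bar>g x - g y\<bar> powr (2 * a)) \<le> C * L powr (2 * a) * (\<Sum>x\<in>X. c x)\<^sup>2"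
proof -
  obtain C where C: "0 \<le> C" "\<And>(X::'a set) c g. finite X \<Longrightarrow> (\<And>x. x \<in> X \<Longrightarrow> 0 \<le> g x \<and> g x \<le> 1) \<Longrightarrow>
      (\<Sum>x\<in>X. \<Sum>y\<in>X. c x * c y * \<bar>g x - g y\<bar> powr (2 * a)) \<le> C * (\<Sum>x\<in>X. c x)\<^sup>2"
    using energy_unit_interval[OF a] by blast
  show thesis
  proof (rule that[of "C * 2 powr (2 * a)"])
    show "0 \<le> C * 2 powr (2 * a)" using C by simp
    fix X :: "'a set" and c g :: "'a \<Rightarrow> real" and L :: real
    assume X: "finite X" and g: "\<And>x. x \<in> X \<Longrightarrow> \<bar>g x\<bar> \<le> L"
    show "(\<Sum>x\<in>X. \<Sum>y\<in>X. c x * c y * \<bar>g x - g y\<bar> powr (2 * a)) \<le> C * 2 powr (2 * a) * L powr (2 * a) * (\<Sum>x\<in>X. c x)\<^sup>2"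
    proof (cases "L > 0")
      case False
      then have "g x = 0" if "x \<in> X" for x using g[OF that] by linarith
      then show ?thesis using C(1) by simp
    next
      case True
      define h where "h = (\<lambda>x. (g x + L) / (2 * L))"
      have h: "0 \<le> h x \<and> h x \<le> 1" if "x \<in> X" for x
        using g[OF that] True by (auto simp: h_def field_simps abs_le_iff)
      have "\<bar>g x - g y\<bar> powr (2 * a) = (2 * L) powr (2 * a) * \<bar>h x - h y\<bar> powr (2 * a)" for x y
      proof -
        have "\<bar>g x - g y\<bar> = 2 * L * \<bar>h x - h y\<bar>"
          using True by (simp add: h_def abs_if field_simps)
        then show ?thesis using True by (simp add: powr_mult)
      qed
      then have "(\<Sum>x\<in>X. \<Sum>y\<in>X. c x * c y * \<bar>g x - g y\<bar> powr (2 * a)) =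
         (2 * L) powr (2 * a) * (\<Sum>x\<in>X. \<Sum>y\<in>X. c x * c y * \<bar>h x - h y\<bar> powr (2 * a))"
        by (simp add: sum_distrib_left mult_ac)
      also have "\<dots> \<le> (2 * L) powr (2 * a) * (C * (\<Sum>x\<in>X. c x)\<^sup>2)"
        using C(2)[OF X h] by (intro mult_left_mono) auto
      finally show ?thesis using True by (simp add: powr_mult mult_ac)
    qed
  qed
qed

section \<open>Gaussian averages and the upper bound\<close>


definition gauss :: "nat \<Rightarrow> (nat \<Rightarrow> real) measure" where
  "gauss n = PiM {..<n} (\<lambda>_. density lborel (\<lambda>u. ennreal (std_normal_density u)))"

lemma prob_space_std_normal: "prob_space (density lborel (\<lambda>u. ennreal (std_normal_density u)))"
  by (rule prob_space_normal_density) simp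

lemma prob_space_gauss: "prob_space (gauss n)"
  unfolding gauss_def by (intro prob_space_PiM prob_space_std_normal)

lemma gauss_component_measurable: "i < n \<Longrightarrow> (\<lambda>g. g i) \<in> borel_measurable (gauss n)"
proof -
  assume i: "i < n"
  have "(\<lambda>g. g i) \<in> gauss n \<rightarrow>\<^sub>M density lborel (\<lambda>u. ennreal (std_normal_density u))"
    unfolding gauss_def using i by (intro measurable_component_singleton) simp
  then show ?thesis by (simp cong: measurable_cong_sets)
qed

lemma distr_gauss_component:
  assumes "i < n"
  shows "distr (gauss n) borel (\<lambda>g. g i) = density lborel (\<lambda>u. ennreal (std_normal_density u))"
proof -
  have "distr (gauss n) (density lborel (\<lambda>u. ennreal (std_normal_density u))) (\<lambda>g. g i)
      = density lborel (\<lambda>u. ennreal (std_normal_density u))"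
    unfolding gauss_def using assms prob_space_std_normal by (intro distr_PiM_component) auto
  moreover have "distr (gauss n) borel (\<lambda>g. g i) =
      distr (gauss n) (density lborel (\<lambda>u. ennreal (std_normal_density u))) (\<lambda>g. g i)"
    by (rule distr_cong) auto
  ultimately show ?thesis by simp
qed

lemma distributed_gauss_component:
  assumes "i < n"
  shows "distributed (gauss n) lborel (\<lambda>g. g i) std_normal_density"
proof -
  have "distr (gauss n) lborel (\<lambda>g. g i) = distr (gauss n) borel (\<lambda>g. g i)"
    by (rule distr_cong) auto
  then show ?thesis
    using distr_gauss_component[OF assms] gauss_component_measurable[OF assms]
    unfolding distributed_def by (simp cong: measurable_cong_sets)
qed

text \<open>The joint law is the product of its marginals. This criterion for independence asks for
  a nonempty index set, hence the separate case \<open>n = 0\<close>.\<close>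

lemma indep_vars_gauss: "prob_space.indep_vars (gauss n) (\<lambda>_. borel) (\<lambda>i g. g i) {..<n}"
proof (cases "n = 0")
  case True
  then show ?thesis
    by (simp add: prob_space.indep_vars_def2[OF prob_space_gauss] prob_space.indep_sets_def[OF prob_space_gauss])
next
  case False
  let ?N = "density lborel (\<lambda>u. ennreal (std_normal_density u))"
  interpret prob_space "gauss n" by (rule prob_space_gauss)
  have sets: "sets (gauss n) = sets (PiM {..<n} (\<lambda>_. borel :: real measure))"
    unfolding gauss_def by (intro sets_PiM_cong) auto
  have "distr (gauss n) (\<Pi>\<^sub>M i\<in>{..<n}. borel) (\<lambda>g. \<lambda>i\<in>{..<n}. g i) = distr (gauss n) (gauss n) (\<lambda>g. g)"
  proof (rule distr_cong)
    fix g assume "g \<in> space (gauss n)"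
    then show "restrict g {..<n} = g"
      by (auto simp: gauss_def space_PiM PiE_def extensional_restrict)
  qed (simp_all add: sets)
  also have "\<dots> = gauss n" by simp
  also have "\<dots> = PiM {..<n} (\<lambda>i. distr (gauss n) borel (\<lambda>g. g i))"
    unfolding gauss_def[of n] by (intro PiM_cong) (auto simp: distr_gauss_component[unfolded gauss_def])
  finally show ?thesis
    by (subst indep_vars_iff_distr_eq_PiM') (use False in \<open>auto simp: gauss_component_measurable\<close>)
qed

lemma distributed_gauss_inner:
  assumes z: "L2_set z {..<n} \<noteq> 0"
  shows "distributed (gauss n) lborel (\<lambda>g. (\<Sum>i<n. z i * g i) / L2_set z {..<n}) std_normal_density"
proof -
  interpret prob_space "gauss n" by (rule prob_space_gauss)
  \<comment> \<open>Zero coefficients are dropped, as the sum rule for independent normal variables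
    asks for positive standard deviations.\<close>
  define I where "I = {i. i < n \<and> z i \<noteq> 0}"
  have I: "I \<subseteq> {..<n}" "finite I" by (auto simp: I_def)
  have I0: "I \<noteq> {}"
  proof
    assume "I = {}"
    then have "\<forall>i\<in>{..<n}. z i = 0" by (auto simp: I_def)
    then show False using z by (simp add: L2_set_eq_0_iff)
  qed
  have sumI: "(\<Sum>i\<in>I. z i * g i) = (\<Sum>i<n. z i * g i)" for g :: "nat \<Rightarrow> real"
    by (rule sum.mono_neutral_left) (auto simp: I_def)
  have "(\<Sum>i\<in>I. \<bar>z i\<bar>\<^sup>2) = (\<Sum>i<n. (z i)\<^sup>2)"
    unfolding power2_abs by (rule sum.mono_neutral_left) (auto simp: I_def)
  then have L: "sqrt (\<Sum>i\<in>I. \<bar>z i\<bar>\<^sup>2) = L2_set z {..<n}" by (simp add: L2_set_def)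
  have "indep_vars (\<lambda>_. borel) (\<lambda>i g. g i) I"
    by (rule indep_vars_subset[OF indep_vars_gauss I(1)])
  then have ind: "indep_vars (\<lambda>_. borel) (\<lambda>i g. z i * g i) I"
    by (rule indep_vars_compose2) auto
  have "distributed (gauss n) lborel (\<lambda>g. \<Sum>i\<in>I. z i * g i) (normal_density (\<Sum>i\<in>I. 0) (sqrt (\<Sum>i\<in>I. \<bar>z i\<bar>\<^sup>2)))"
  proof (rule sum_indep_normal[OF I(2) I0 ind])
    fix i assume i: "i \<in> I"
    then show "0 < \<bar>z i\<bar>" by (simp add: I_def)
    show "distributed (gauss n) lborel (\<lambda>g. z i * g i) (normal_density 0 \<bar>z i\<bar>)"
      using normal_density_affine[OF distributed_gauss_component[of i n], of "z i" 0] i by (simp add: I_def)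
  qed
  then have "distributed (gauss n) lborel (\<lambda>g. \<Sum>i<n. z i * g i) (normal_density 0 (L2_set z {..<n}))"
    unfolding sumI L by simp
  moreover have "0 < L2_set z {..<n}" using z by (simp add: order_less_le)
  ultimately show ?thesis
    using normal_standard_normal_convert[of "L2_set z {..<n}" "\<lambda>g. \<Sum>i<n. z i * g i" 0] by simp
qed

definition normal_moment :: "real \<Rightarrow> real" where
  "normal_moment r = (\<integral>u. std_normal_density u * \<bar>u\<bar> powr r \<partial>lborel)"

lemma integrable_normal_moment_powr:
  assumes "0 \<le> r"
  shows "integrable lborel (\<lambda>u. std_normal_density u * \<bar>u\<bar> powr r)"
proof -
  define k where "k = nat \<lceil>r\<rceil>"
  have k: "r \<le> real k" by (simp add: k_def real_nat_ceiling_ge)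
  have "integrable lborel (\<lambda>u. std_normal_density u * \<bar>u\<bar> ^ 0 + std_normal_density u * \<bar>u\<bar> ^ k)"
    by (intro Bochner_Integration.integrable_add integrable_std_normal_moment_abs)
  then show ?thesis
  proof (rule Bochner_Integration.integrable_bound)
    show "AE u in lborel. norm (std_normal_density u * \<bar>u\<bar> powr r) \<le>
       norm (std_normal_density u * \<bar>u\<bar> ^ 0 + std_normal_density u * \<bar>u\<bar> ^ k)"
    proof (intro AE_I2)
      fix u :: real
      have "\<bar>u\<bar> powr r \<le> 1 + \<bar>u\<bar> ^ k"
      proof (cases "\<bar>u\<bar> \<le> 1")
        case True
        then have "\<bar>u\<bar> powr r \<le> 1" using assms by (intro powr_le1) auto
        then show ?thesis by (simp add: add_increasing2)
      next
        case False
        then have "\<bar>u\<bar> powr r \<le> \<bar>u\<bar> powr real k" using k by (intro powr_mono) auto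
        also have "\<dots> = \<bar>u\<bar> ^ k" using False by (simp add: powr_realpow)
        finally show ?thesis by simp
      qed
      then have "std_normal_density u * \<bar>u\<bar> powr r \<le> std_normal_density u * (1 + \<bar>u\<bar> ^ k)"
        by (intro mult_left_mono) auto
      then show "norm (std_normal_density u * \<bar>u\<bar> powr r) \<le>
         norm (std_normal_density u * \<bar>u\<bar> ^ 0 + std_normal_density u * \<bar>u\<bar> ^ k)"
        by (simp add: distrib_left abs_mult)
    qed
  qed measurable
qed

lemma normal_moment_pos:
  assumes "0 \<le> r" shows "0 < normal_moment r"
  unfolding normal_moment_def
  by (rule integral_pos_pos[OF integrable_normal_moment_powr[OF assms]]) (auto intro!: mult_pos_pos normal_density_pos)

text \<open>The inner product with a Gaussian vector is normal with standard deviation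
  \<open>L2_set z {..<n}\<close>. Averaging over \<open>g\<close> therefore turns energies on the
  line into Euclidean ones; both bounds rest on this.\<close>

lemma has_bochner_integral_gauss_inner:
  assumes r: "0 < r"
  shows "has_bochner_integral (gauss n) (\<lambda>g. \<bar>\<Sum>i<n. z i * g i\<bar> powr r) (normal_moment r * L2_set z {..<n} powr r)"
proof (cases "L2_set z {..<n} = 0")
  case True
  then have "z i = 0" if "i < n" for i using that by (simp add: L2_set_eq_0_iff)
  then have "(\<lambda>g. \<bar>\<Sum>i<n. z i * g i\<bar> powr r) = (\<lambda>g. 0)" by (intro ext) simp
  then show ?thesis using True by (simp add: has_bochner_integral_zero)
next
  case False
  define s where "s = L2_set z {..<n}"
  have s: "s > 0" using False by (simp add: s_def order_less_le)
  let ?X = "\<lambda>g. (\<Sum>i<n. z i * g i) / s"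
  note d = distributed_gauss_inner[OF False, folded s_def]
  have m: "(\<lambda>u::real. \<bar>u\<bar> powr r) \<in> borel_measurable lborel" by measurable
  have "integrable (gauss n) (\<lambda>g. \<bar>?X g\<bar> powr r)"
    using distributed_integrable[OF d m] integrable_normal_moment_powr[of r] r by simp
  moreover have "(\<integral>g. \<bar>?X g\<bar> powr r \<partial>gauss n) = normal_moment r"
    using distributed_integral[OF d m] by (simp add: normal_moment_def)
  ultimately have "has_bochner_integral (gauss n) (\<lambda>g. s powr r * \<bar>?X g\<bar> powr r) (s powr r * normal_moment r)"
    by (intro has_bochner_integral_mult_right) (simp add: has_bochner_integral_iff)
  also have "(\<lambda>g. s powr r * \<bar>?X g\<bar> powr r) = (\<lambda>g. \<bar>\<Sum>i<n. z i * g i\<bar> powr r)"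
    using s by (simp add: fun_eq_iff powr_mult[symmetric])
  finally show ?thesis by (simp add: s_def mult.commute)
qed

lemma has_bochner_integral_gauss_component:
  assumes r: "0 < r" and i: "i < n"
  shows "has_bochner_integral (gauss n) (\<lambda>g. \<bar>g i\<bar> powr r) (normal_moment r)"
proof -
  let ?z = "\<lambda>j. if j = i then 1 else 0 :: real"
  have "(\<Sum>j<n. ?z j * g j) = g i" for g :: "nat \<Rightarrow> real"
    using i by (simp add: if_distrib[of "\<lambda>u. u * _"] cong: if_cong)
  moreover have "L2_set ?z {..<n} = 1"
    using i by (simp add: L2_set_def if_distrib[of "\<lambda>u. u\<^sup>2"] cong: if_cong)
  ultimately show ?thesis using has_bochner_integral_gauss_inner[OF r, of n ?z] by simp
qed

section \<open>Hoelder's inequality and the upper energy bound\<close>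

text \<open>Young's inequality for \<open>x i\<close> and \<open>g i / L\<close>, where
  \<open>L\<close> is the \<open>q'\<close>-norm of \<open>g\<close>, summed over the
  coordinates.\<close>

lemma Holder_lq_ball:
  assumes q: "1 < q" "1 < q'" "1 / q + 1 / q' = 1" and x: "x \<in> lq_ball q n"
  shows "\<bar>\<Sum>i<n. x i * g i\<bar> \<le> (\<Sum>i<n. \<bar>g i\<bar> powr q') powr (1 / q')"
proof (cases "(\<Sum>i<n. \<bar>g i\<bar> powr q') = 0")
  case True
  then have "\<forall>i\<in>{..<n}. \<bar>g i\<bar> powr q' = 0" by (subst (asm) sum_nonneg_eq_0_iff) auto
  then show ?thesis by simp
next
  case False
  define L where "L = (\<Sum>i<n. \<bar>g i\<bar> powr q') powr (1 / q')"
  have S: "0 < (\<Sum>i<n. \<bar>g i\<bar> powr q')" using False sum_nonneg[of "{..<n}" "\<lambda>i. \<bar>g i\<bar> powr q'"] by simp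
  then have L: "L > 0" by (simp add: L_def)
  have Lq: "L powr q' = (\<Sum>i<n. \<bar>g i\<bar> powr q')" using S q by (simp add: L_def powr_powr)
  have "\<bar>\<Sum>i<n. x i * g i\<bar> \<le> (\<Sum>i<n. \<bar>x i * g i\<bar>)" by (rule sum_abs)
  also have "\<dots> \<le> (\<Sum>i<n. L * (\<bar>x i\<bar> powr q / q + (\<bar>g i\<bar> / L) powr q' / q'))"
  proof (rule sum_mono)
    fix i
    have "\<bar>x i\<bar> * (\<bar>g i\<bar> / L) \<le> \<bar>x i\<bar> powr q / q + (\<bar>g i\<bar> / L) powr q' / q'"
      using q L by (intro Youngs_inequality) auto
    then have "L * (\<bar>x i\<bar> * (\<bar>g i\<bar> / L)) \<le> L * (\<bar>x i\<bar> powr q / q + (\<bar>g i\<bar> / L) powr q' / q')"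
      using L by (intro mult_left_mono) auto
    then show "\<bar>x i * g i\<bar> \<le> L * (\<bar>x i\<bar> powr q / q + (\<bar>g i\<bar> / L) powr q' / q')"
      using L by (simp add: abs_mult)
  qed
  also have "\<dots> = L * ((\<Sum>i<n. \<bar>x i\<bar> powr q) / q + (\<Sum>i<n. \<bar>g i\<bar> powr q') / L powr q' / q')"
    using L by (simp add: sum_distrib_left sum.distrib sum_divide_distrib powr_divide distrib_left)
  also have "\<dots> \<le> L * (1 / q + 1 / q')"
    using L x q S Lq by (intro mult_left_mono add_mono divide_right_mono) (auto simp: lq_ball_def)
  finally show ?thesis using q by (simp add: L_def)
qed

text \<open>A concave power lies below its tangent at \<open>M\<close>. When \<open>M\<close> is the
  mean of \<open>Y\<close>, averaging the right side gives \<open>M powr t\<close>, that is,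
  Jensen's inequality.\<close>

lemma powr_le_tangent:
  fixes Y M t :: real
  assumes "0 \<le> Y" "0 < M" "0 < t" "t < 1"
  shows "Y powr t \<le> M powr t * (1 - t + t * (Y / M))"
proof (cases "Y = 0")
  case True
  then show ?thesis using assms by simp
next
  case False
  then have "(Y / M) powr t * 1 powr (1 - t) \<le> t * (Y / M) + (1 - t) * 1"
    using assms by (intro Youngs_inequality_0) auto
  then have "M powr t * (Y / M) powr t \<le> M powr t * (1 - t + t * (Y / M))"
    by (intro mult_left_mono) auto
  then show ?thesis using assms False by (simp add: powr_mult[symmetric])
qed

lemma energy_bounded_lq_ball:
  fixes q q' a :: real
  assumes q: "1 < q" "q \<le> 2" "1 / q + 1 / q' = 1" and a: "0 < a" "a < 1"
  obtains C where "0 < C"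
    "\<And>n. n \<ge> 1 \<Longrightarrow> energy_bounded (lq_ball q n) (\<lambda>x y. (euclid_dist n x y powr a)\<^sup>2) (C * real n powr (2 * a / q'))"
proof -
  have q': "2 \<le> q'"
  proof -
    have "1 / 2 \<le> 1 / q" "1 / q < 1" using q by (auto simp: field_simps)
    then have "1 / q' \<le> 1 / 2" "0 < 1 / q'" using q by linarith+
    then show ?thesis by (simp add: field_simps)
  qed
  obtain C0 where C0: "0 \<le> C0"
    "\<And>(X::(nat \<Rightarrow> real) set) c g L. finite X \<Longrightarrow> (\<And>x. x \<in> X \<Longrightarrow> \<bar>g x\<bar> \<le> L) \<Longrightarrow>
      (\<Sum>x\<in>X. \<Sum>y\<in>X. c x * c y * \<bar>g x - g y\<bar> powr (2 * a)) \<le> C0 * L powr (2 * a) * (\<Sum>x\<in>X. c x)\<^sup>2"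
    using energy_interval[OF a] by blast
  \<comment> \<open>The interval bound involves the \<open>q'\<close>-norm to the power
    \<open>2 * a\<close>, hence \<open>Y powr t\<close> with \<open>Y\<close> the sum of the
    \<open>q'\<close>-th powers. As \<open>q' \<ge> 2\<close>, this is concave in
    \<open>Y\<close>.\<close>
  define t where "t = 2 * a / q'"
  have t: "0 < t" "t < 1" using a q' by (auto simp: t_def field_simps)
  \<comment> \<open>\<open>C0 + 1\<close> replaces \<open>C0\<close>, which may be 0, because
    \<open>C\<close> has to be positive.\<close>
  define C where "C = (C0 + 1) * normal_moment q' powr t / normal_moment (2 * a)"
  have m: "0 < normal_moment q'" "0 < normal_moment (2 * a)" using q' a by (auto intro!: normal_moment_pos)
  show thesis
  proof (rule that[of C])
    show "0 < C" using m C0 by (simp add: C_def)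
    fix n :: nat assume n: "n \<ge> 1"
    \<comment> \<open>\<open>M\<close> is the mean of the sum of the \<open>q'\<close>-th powers of
      the Gaussian coordinates, the point at which the tangent is taken.\<close>
    define M where "M = real n * normal_moment q'"
    have M: "0 < M" using n m by (simp add: M_def)
    show "energy_bounded (lq_ball q n) (\<lambda>x y. (euclid_dist n x y powr a)\<^sup>2) (C * real n powr (2 * a / q'))"
      unfolding energy_bounded_def
    proof (intro allI impI)
      fix X :: "(nat \<Rightarrow> real) set" and c :: "(nat \<Rightarrow> real) \<Rightarrow> real" assume X: "finite X" "X \<subseteq> lq_ball q n"
      define S where "S = (\<Sum>x\<in>X. c x)\<^sup>2"
      define u where "u = (\<lambda>g x. \<Sum>i<n. x i * g i :: real)"
      have 1: "has_bochner_integral (gauss n) (\<lambda>g. \<Sum>x\<in>X. \<Sum>y\<in>X. c x * c y * \<bar>u g x - u g y\<bar> powr (2 * a))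
         (\<Sum>x\<in>X. \<Sum>y\<in>X. c x * c y * (normal_moment (2 * a) * euclid_dist n x y powr (2 * a)))"
      proof (intro has_bochner_integral_sum has_bochner_integral_mult_right)
        fix x y
        have "u g x - u g y = (\<Sum>i<n. (x i - y i) * g i)" for g
          by (simp add: u_def sum_subtractf left_diff_distrib)
        then show "has_bochner_integral (gauss n) (\<lambda>g. \<bar>u g x - u g y\<bar> powr (2 * a))
           (normal_moment (2 * a) * euclid_dist n x y powr (2 * a))"
          unfolding euclid_dist_def using has_bochner_integral_gauss_inner[of "2 * a" n "\<lambda>i. x i - y i"] a by simp
      qed
      have 2: "has_bochner_integral (gauss n) (\<lambda>g. C0 * S * (M powr t * (1 - t + t / M * (\<Sum>i<n. \<bar>g i\<bar> powr q'))))
         (C0 * S * (M powr t * (1 - t + t / M * (\<Sum>i<n. normal_moment q'))))"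
      proof -
        interpret prob_space "gauss n" by (rule prob_space_gauss)
        have "has_bochner_integral (gauss n) (\<lambda>g. 1 - t) (1 - t)"
          by (simp add: has_bochner_integral_iff prob_space)
        then show ?thesis using q'
          by (intro has_bochner_integral_mult_right has_bochner_integral_add has_bochner_integral_sum
             has_bochner_integral_gauss_component) auto
      qed
      have "(\<Sum>x\<in>X. \<Sum>y\<in>X. c x * c y * (normal_moment (2 * a) * euclid_dist n x y powr (2 * a)))
          \<le> C0 * S * (M powr t * (1 - t + t / M * (\<Sum>i<n. normal_moment q')))"
      proof (rule has_bochner_integral_mono[OF 1 2])
        fix g
        define Y where "Y = (\<Sum>i<n. \<bar>g i\<bar> powr q')"
        have Y: "0 \<le> Y" by (simp add: Y_def sum_nonneg)
        have "(\<Sum>x\<in>X. \<Sum>y\<in>X. c x * c y * \<bar>u g x - u g y\<bar> powr (2 * a)) \<le> C0 * (Y powr (1 / q')) powr (2 * a) * S"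
          unfolding S_def
        proof (rule C0(2)[OF X(1)])
          fix x assume "x \<in> X"
          then show "\<bar>u g x\<bar> \<le> Y powr (1 / q')"
            unfolding u_def Y_def using X q q' by (intro Holder_lq_ball[of q]) auto
        qed
        also have "\<dots> = C0 * S * Y powr t" by (simp add: powr_powr t_def)
        also have "\<dots> \<le> C0 * S * (M powr t * (1 - t + t * (Y / M)))"
          using C0 powr_le_tangent[OF Y M t] by (intro mult_left_mono) (auto simp: S_def)
        finally show "(\<Sum>x\<in>X. \<Sum>y\<in>X. c x * c y * \<bar>u g x - u g y\<bar> powr (2 * a)) \<le>
           C0 * S * (M powr t * (1 - t + t / M * (\<Sum>i<n. \<bar>g i\<bar> powr q')))" by (simp add: Y_def)
      qed
      also have "\<dots> = C0 * S * M powr t" using M by (simp add: M_def)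
      also have "\<dots> \<le> (C0 + 1) * S * M powr t" by (intro mult_right_mono) (auto simp: S_def)
      also have "(\<Sum>x\<in>X. \<Sum>y\<in>X. c x * c y * (normal_moment (2 * a) * euclid_dist n x y powr (2 * a)))
        = normal_moment (2 * a) * (\<Sum>x\<in>X. \<Sum>y\<in>X. c x * c y * (euclid_dist n x y powr a)\<^sup>2)"
        by (simp add: sum_distrib_left mult_ac power2_eq_square powr_add[symmetric])
      finally have "(\<Sum>x\<in>X. \<Sum>y\<in>X. c x * c y * (euclid_dist n x y powr a)\<^sup>2) \<le> (C0 + 1) * S * M powr t / normal_moment (2 * a)"
        using m by (simp add: field_simps)
      also have "\<dots> = C * real n powr (2 * a / q') * (\<Sum>x\<in>X. c x)\<^sup>2"
        using m by (simp add: C_def M_def S_def t_def powr_mult)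
      finally show "(\<Sum>x\<in>X. \<Sum>y\<in>X. c x * c y * (euclid_dist n x y powr a)\<^sup>2) \<le> C * real n powr (2 * a / q') * (\<Sum>x\<in>X. c x)\<^sup>2" .
    qed
  qed
qed

text \<open>The ball is separable in the product topology, and convergence of the finitely many
  coordinates below \<open>n\<close> gives Euclidean convergence.\<close>

lemma lq_ball_dense_sequence:
  assumes q: "0 < q" and a: "0 < a"
  obtains p :: "nat \<Rightarrow> nat \<Rightarrow> real" where "\<And>m. p m \<in> lq_ball q n"
    "\<And>x e. x \<in> lq_ball q n \<Longrightarrow> e > 0 \<Longrightarrow> \<exists>m. euclid_dist n x (p m) powr a < e"
proof -
  obtain T where T: "countable T" "T \<subseteq> lq_ball q n" "lq_ball q n \<subseteq> closure T"
    using separable by blast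
  have "(\<lambda>_. 0) \<in> lq_ball q n" by (simp add: lq_ball_def)
  then have "T \<noteq> {}" using T(3) by auto
  show thesis
  proof (rule that[of "from_nat_into T"])
    show "from_nat_into T m \<in> lq_ball q n" for m
      using from_nat_into[OF \<open>T \<noteq> {}\<close>] T(2) by blast
    fix x and e :: real assume x: "x \<in> lq_ball q n" and e: "e > 0"
    then have "x \<in> closure T" using T(3) by blast
    then obtain s where s: "\<And>k. s k \<in> T" "s \<longlonglongrightarrow> x"
      unfolding closure_sequential by blast
    have "(\<lambda>k. s k i) \<longlonglongrightarrow> x i" for i
      by (rule continuous_on_tendsto_compose[OF continuous_on_product_coordinates s(2)]) auto
    then have "(\<lambda>k. euclid_dist n x (s k) powr a) \<longlonglongrightarrow> euclid_dist n x x powr a"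
      unfolding euclid_dist_def L2_set_def using a by (intro tendsto_intros) (auto simp: sum_nonneg)
    then have "(\<lambda>k. euclid_dist n x (s k) powr a) \<longlonglongrightarrow> 0"
      by (simp add: euclid_dist_def L2_set_def)
    then obtain k where "euclid_dist n x (s k) powr a < e"
      using order_tendstoD(2)[of _ 0 sequentially e] e by (auto simp: eventually_sequentially)
    moreover obtain m where "s k = from_nat_into T m"
      using from_nat_into_surj[OF T(1) s(1)] by metis
    ultimately show "\<exists>m. euclid_dist n x (from_nat_into T m) powr a < e" by auto
  qed
qed

section \<open>The Fejer polynomials\<close>


text \<open>The Chebyshev polynomials of degree \<open>2 ^ i\<close>, sending
  \<open>cos \<theta>\<close> to \<open>cos (2 ^ i * \<theta>)\<close>, built by doubling the
  angle.\<close>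

primrec dyadic_cheb :: "nat \<Rightarrow> real poly" where
  "dyadic_cheb 0 = [:0, 1:]"
| "dyadic_cheb (Suc i) = 2 * (dyadic_cheb i)\<^sup>2 - 1"

text \<open>With \<open>y = cos \<theta>\<close> and \<open>D = 2\<^sup>k\<close> this is the Fejer kernel \<open>(sin (D \<theta>) / (D sin \<theta>))\<^sup>2\<close>.\<close>

definition fejer_poly :: "nat \<Rightarrow> real poly" where
  "fejer_poly k = (\<Prod>i<k. (dyadic_cheb i)\<^sup>2)"

text \<open>The angle may be doubled innermost as well as outermost; this yields the recursion on
  which the induction for the Fejer bound runs.\<close>

lemma dyadic_cheb_Suc_eval: "poly (dyadic_cheb (Suc i)) y = poly (dyadic_cheb i) (2 * y\<^sup>2 - 1)"
proof (induction i)
  case (Suc i)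
  have "poly (dyadic_cheb (Suc (Suc i))) y = 2 * (poly (dyadic_cheb (Suc i)) y)\<^sup>2 - 1"
    by (simp add: poly_power)
  also have "\<dots> = poly (dyadic_cheb (Suc i)) (2 * y\<^sup>2 - 1)"
    unfolding Suc by (simp add: poly_power)
  finally show ?case .
qed (simp add: poly_power power2_eq_square)

lemma fejer_poly_eval: "poly (fejer_poly k) y = (\<Prod>i<k. (poly (dyadic_cheb i) y)\<^sup>2)"
  by (simp add: fejer_poly_def poly_prod poly_power)

lemma fejer_poly_Suc_eval: "poly (fejer_poly (Suc k)) y = y\<^sup>2 * poly (fejer_poly k) (2 * y\<^sup>2 - 1)"
  unfolding fejer_poly_eval prod.lessThan_Suc_shift dyadic_cheb_Suc_eval by simp

lemma fejer_poly_nonneg: "0 \<le> poly (fejer_poly k) y"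
  unfolding fejer_poly_eval by (intro prod_nonneg) auto

lemma fejer_poly_one: "poly (fejer_poly k) 1 = 1"
proof -
  have "poly (dyadic_cheb i) 1 = 1" for i by (induction i) (simp_all add: poly_power)
  then show ?thesis by (simp add: fejer_poly_eval)
qed

text \<open>With \<open>y = cos \<theta>\<close>, the constant \<open>(4 ^ k - 1) / 3\<close> is the
  one exact to second order at \<theta> = 0. The induction uses
  \<open>1 - z\<^sup>2 = 4 * y\<^sup>2 * w\<close>, the recursion from \<open>E\<close> to
  \<open>4 * E + 3\<close>, and \<open>y\<^sup>2 * (1 + w) = 1 - w\<^sup>2 \<le> 1\<close>.\<close>

lemma fejer_poly_bound_aux:
  assumes "\<bar>y\<bar> \<le> 1"
  shows "poly (fejer_poly k) y * (1 + (4 ^ k - 1) / 3 * (1 - y\<^sup>2)) \<le> 1"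
  using assms
proof (induction k arbitrary: y)
  case 0
  then show ?case by (simp add: fejer_poly_def)
next
  case (Suc k)
  define E where "E = (4 ^ k - 1 :: real)"
  have E: "0 \<le> E" by (simp add: E_def)
  define z where "z = 2 * y\<^sup>2 - 1"
  have y2: "y\<^sup>2 \<le> 1" using Suc.prems by (simp add: abs_square_le_1)
  have z: "\<bar>z\<bar> \<le> 1" using y2 by (simp add: z_def abs_le_iff)
  define w where "w = 1 - y\<^sup>2"
  have w: "0 \<le> w" using y2 by (simp add: w_def)
  define p where "p = poly (fejer_poly k) z"
  have p: "0 \<le> p" by (simp add: p_def fejer_poly_nonneg)
  have IH: "p * (1 + E / 3 * (4 * y\<^sup>2 * w)) \<le> 1"
    using Suc.IH[OF z] by (simp add: p_def E_def z_def w_def power2_eq_square algebra_simps)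
  have "y\<^sup>2 * p * (1 + (4 * E + 3) / 3 * w) = p * (y\<^sup>2 * (1 + w) + E / 3 * (4 * y\<^sup>2 * w))"
    by (simp add: field_simps)
  also have "\<dots> \<le> p * (1 + E / 3 * (4 * y\<^sup>2 * w))"
  proof -
    have "y\<^sup>2 * (1 + w) = 1 - w\<^sup>2" by (simp add: w_def power2_eq_square algebra_simps)
    then have "y\<^sup>2 * (1 + w) \<le> 1" by simp
    then show ?thesis using p by (intro mult_left_mono) auto
  qed
  also have "\<dots> \<le> 1" by (rule IH)
  also have "4 * E + 3 = 4 ^ Suc k - 1" by (simp add: E_def)
  finally show ?case by (simp only: fejer_poly_Suc_eval p_def z_def w_def)
qed

lemma fejer_poly_bound:
  assumes "\<bar>y\<bar> \<le> 1" "1 \<le> k"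
  shows "poly (fejer_poly k) y * (1 + (2 ^ k)\<^sup>2 / 4 * (1 - y\<^sup>2)) \<le> 1"
proof -
  have w: "0 \<le> 1 - y\<^sup>2" using assms by (simp add: abs_square_le_1)
  have "(4::real) ^ 1 \<le> 4 ^ k" using assms by (intro power_increasing) auto
  moreover have "((2::real) ^ k)\<^sup>2 = 4 ^ k" by (simp add: power2_eq_square power_mult_distrib[symmetric])
  \<comment> \<open>With \<open>D = 2 ^ k\<close> this amounts to \<open>D\<^sup>2 \<ge> 4\<close>,
    which is where \<open>1 \<le> k\<close> enters.\<close>
  ultimately have "((2::real) ^ k)\<^sup>2 / 4 \<le> (4 ^ k - 1) / 3" by simp
  then have "poly (fejer_poly k) y * (1 + (2 ^ k)\<^sup>2 / 4 * (1 - y\<^sup>2)) \<le>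
      poly (fejer_poly k) y * (1 + (4 ^ k - 1) / 3 * (1 - y\<^sup>2))"
    using w fejer_poly_nonneg by (intro mult_left_mono add_left_mono mult_right_mono) auto
  also have "\<dots> \<le> 1" by (rule fejer_poly_bound_aux[OF assms(1)])
  finally show ?thesis .
qed

lemma fejer_poly_le_one:
  assumes "\<bar>y\<bar> \<le> 1"
  shows "poly (fejer_poly k) y \<le> 1"
proof -
  have w: "0 \<le> 1 - y\<^sup>2" using assms by (simp add: abs_square_le_1)
  have "poly (fejer_poly k) y * 1 \<le> poly (fejer_poly k) y * (1 + (4 ^ k - 1) / 3 * (1 - y\<^sup>2))"
    using w fejer_poly_nonneg by (intro mult_left_mono) auto
  also have "\<dots> \<le> 1" by (rule fejer_poly_bound_aux[OF assms])
  finally show ?thesis by simp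
qed

section \<open>Size of the coefficients of the Fejer polynomials\<close>

text \<open>Coefficientwise domination passes to products and bounds the sum of the absolute
  coefficients by the value of the majorant at 1.\<close>

definition poly_majorant :: "real poly \<Rightarrow> real poly \<Rightarrow> bool" where
  "poly_majorant p q \<longleftrightarrow> (\<forall>i. \<bar>coeff p i\<bar> \<le> coeff q i)"

lemma poly_majorant_mult:
  assumes "poly_majorant p p'" "poly_majorant q q'"
  shows "poly_majorant (p * q) (p' * q')"
  unfolding poly_majorant_def
proof
  fix m
  have "\<bar>coeff (p * q) m\<bar> \<le> (\<Sum>i\<le>m. \<bar>coeff p i * coeff q (m - i)\<bar>)"
    unfolding coeff_mult by (rule sum_abs)
  also have "\<dots> \<le> (\<Sum>i\<le>m. coeff p' i * coeff q' (m - i))"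
    using assms unfolding poly_majorant_def abs_mult
    by (intro sum_mono mult_mono) (auto intro: order_trans[OF abs_ge_zero])
  finally show "\<bar>coeff (p * q) m\<bar> \<le> coeff (p' * q') m" by (simp add: coeff_mult)
qed

text \<open>The doubling recursion with \<open>- 1\<close> turned into \<open>+ 1\<close>, so that
  all coefficients are nonnegative.\<close>

primrec dyadic_cheb_majorant :: "nat \<Rightarrow> real poly" where
  "dyadic_cheb_majorant 0 = [:0, 1:]"
| "dyadic_cheb_majorant (Suc i) = 2 * (dyadic_cheb_majorant i)\<^sup>2 + 1"

lemma poly_majorant_cheb: "poly_majorant (dyadic_cheb i) (dyadic_cheb_majorant i)"
proof (induction i)
  case 0
  then show ?case by (auto simp: poly_majorant_def coeff_pCons split: nat.splits)
next
  case (Suc i)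
  have sq: "poly_majorant ((dyadic_cheb i)\<^sup>2) ((dyadic_cheb_majorant i)\<^sup>2)"
    unfolding power2_eq_square by (rule poly_majorant_mult[OF Suc Suc])
  have two: "coeff (2 * p) m = 2 * coeff p m" for p :: "real poly" and m
    by (metis coeff_add mult_2)
  show ?case
    unfolding poly_majorant_def
  proof
    fix m
    have "\<bar>coeff (dyadic_cheb (Suc i)) m\<bar> \<le> 2 * \<bar>coeff ((dyadic_cheb i)\<^sup>2) m\<bar> + \<bar>coeff 1 m\<bar>"
      unfolding dyadic_cheb.simps coeff_diff two by linarith
    also have "\<dots> \<le> 2 * coeff ((dyadic_cheb_majorant i)\<^sup>2) m + coeff 1 m"
      using sq by (intro add_mono mult_left_mono) (auto simp: poly_majorant_def)
    finally show "\<bar>coeff (dyadic_cheb (Suc i)) m\<bar> \<le> coeff (dyadic_cheb_majorant (Suc i)) m"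
      by (simp add: two)
  qed
qed

lemma poly_majorant_fejer: "poly_majorant (fejer_poly k) (\<Prod>i<k. (dyadic_cheb_majorant i)\<^sup>2)"
proof (induction k)
  case 0
  then show ?case by (simp add: poly_majorant_def fejer_poly_def)
next
  case (Suc k)
  then show ?case
    using poly_majorant_mult[OF Suc poly_majorant_mult[OF poly_majorant_cheb poly_majorant_cheb]]
    by (simp add: fejer_poly_def power2_eq_square)
qed

text \<open>The factor 3 makes the bound reproduce itself: for \<open>v \<ge> 1\<close> one has
  \<open>2 * v\<^sup>2 + 1 \<le> 3 * v\<^sup>2\<close>, so three times the value is at most squared
  in each step.\<close>

lemma dyadic_cheb_majorant_one:
  "1 \<le> poly (dyadic_cheb_majorant i) 1 \<and> poly (dyadic_cheb_majorant i) 1 * 3 \<le> 3 ^ 2 ^ i"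
proof (induction i)
  case (Suc i)
  define v where "v = poly (dyadic_cheb_majorant i) 1"
  have v: "1 \<le> v" "v * 3 \<le> 3 ^ 2 ^ i" using Suc by (auto simp: v_def)
  have v2: "1 \<le> v\<^sup>2" using v by (simp add: one_le_power)
  have "(2 * v\<^sup>2 + 1) * 3 \<le> (v * 3)\<^sup>2" using v2 by (simp add: power2_eq_square)
  also have "\<dots> \<le> (3 ^ 2 ^ i)\<^sup>2" using v by (intro power_mono) auto
  also have "\<dots> = 3 ^ 2 ^ Suc i" by (simp add: power_mult[symmetric] mult.commute)
  finally show ?case using v2 by (simp add: v_def poly_power)
qed simp

lemma degree_dyadic_cheb: "degree (dyadic_cheb i) \<le> 2 ^ i"
proof (induction i)
  case (Suc i)
  have "degree (2 * (dyadic_cheb i)\<^sup>2) \<le> degree (2 :: real poly) + degree ((dyadic_cheb i)\<^sup>2)"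
    by (rule degree_mult_le)
  also have "\<dots> \<le> 2 ^ Suc i" using degree_power_le[of "dyadic_cheb i" 2] Suc by simp
  finally show ?case by (auto intro: degree_diff_le)
qed simp

lemma degree_dyadic_cheb_majorant: "degree (dyadic_cheb_majorant i) \<le> 2 ^ i"
proof (induction i)
  case (Suc i)
  have "degree (2 * (dyadic_cheb_majorant i)\<^sup>2) \<le> degree (2 :: real poly) + degree ((dyadic_cheb_majorant i)\<^sup>2)"
    by (rule degree_mult_le)
  also have "\<dots> \<le> 2 ^ Suc i" using degree_power_le[of "dyadic_cheb_majorant i" 2] Suc by simp
  finally show ?case by (auto intro: degree_add_le)
qed simp

lemma degree_prod_sq_dyadic:
  fixes p :: "nat \<Rightarrow> real poly"
  assumes "\<And>i. degree (p i) \<le> 2 ^ i"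
  shows "degree (\<Prod>i<k. (p i)\<^sup>2) \<le> 2 * 2 ^ k - 2"
proof (induction k)
  case (Suc k)
  have "degree (\<Prod>i<Suc k. (p i)\<^sup>2) \<le> degree (\<Prod>i<k. (p i)\<^sup>2) + degree ((p k)\<^sup>2)"
    by (simp add: degree_mult_le)
  also have "\<dots> \<le> (2 * 2 ^ k - 2) + 2 * 2 ^ k"
    using degree_power_le[of "p k" 2] assms[of k] by (intro add_mono Suc) auto
  also have "\<dots> \<le> 2 * 2 ^ Suc k - 2" by simp
  finally show ?case .
qed simp

lemma poly_eq_sum_coeff:
  fixes p :: "real poly"
  shows "degree p \<le> N \<Longrightarrow> poly p x = (\<Sum>i\<le>N. coeff p i * x ^ i)"
  unfolding poly_altdef by (rule sum.mono_neutral_left) (auto simp: coeff_eq_0)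

lemma fejer_poly_degree: "degree (fejer_poly k) \<le> 2 * 2 ^ k"
  using degree_prod_sq_dyadic[of dyadic_cheb k, OF degree_dyadic_cheb] by (simp add: fejer_poly_def)

lemma fejer_poly_coeff_sum: "(\<Sum>i\<le>2 * 2 ^ k. \<bar>coeff (fejer_poly k) i\<bar>) \<le> 3 ^ (2 * 2 ^ k)"
proof -
  let ?Q = "\<Prod>i<k. (dyadic_cheb_majorant i)\<^sup>2"
  have "(\<Sum>i\<le>2 * 2 ^ k. \<bar>coeff (fejer_poly k) i\<bar>) \<le> (\<Sum>i\<le>2 * 2 ^ k. coeff ?Q i)"
    using poly_majorant_fejer by (intro sum_mono) (auto simp: poly_majorant_def)
  also have "\<dots> = poly ?Q 1"
    using degree_prod_sq_dyadic[of dyadic_cheb_majorant k, OF degree_dyadic_cheb_majorant]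
    by (subst poly_eq_sum_coeff[of _ "2 * 2 ^ k"]) auto
  also have "\<dots> = (\<Prod>i<k. (poly (dyadic_cheb_majorant i) 1)\<^sup>2)" by (simp add: poly_prod poly_power)
  also have "\<dots> \<le> 3 ^ (2 * 2 ^ k)"
  proof (induction k)
    case (Suc k)
    have "(poly (dyadic_cheb_majorant k) 1)\<^sup>2 \<le> (3 ^ 2 ^ k)\<^sup>2"
      using dyadic_cheb_majorant_one[of k] by (intro power_mono) auto
    then have "(\<Prod>i<Suc k. (poly (dyadic_cheb_majorant i) 1)\<^sup>2) \<le> 3 ^ (2 * 2 ^ k) * (3 ^ 2 ^ k)\<^sup>2"
      using Suc by (simp add: mult_mono)
    also have "\<dots> = 3 ^ (2 * 2 ^ Suc k)" by (simp add: power_add[symmetric] power_mult[symmetric])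
    finally show ?case .
  qed simp
  finally show ?thesis .
qed

section \<open>Random sign walks\<close>


definition signs :: "nat \<Rightarrow> (nat \<Rightarrow> real) set" where
  "signs n = PiE {..<n} (\<lambda>_. {-1, 1})"

text \<open>Walks are indexed by their step sequences, so that counting is uniform; coinciding end
  points are merged only in \<open>energy_bounded_family\<close>.\<close>

definition sign_lists :: "nat \<Rightarrow> nat \<Rightarrow> (nat \<Rightarrow> real) list set" where
  "sign_lists n k = {es. set es \<subseteq> signs n \<and> length es = k}"

definition walk :: "nat \<Rightarrow> (nat \<Rightarrow> real) list \<Rightarrow> nat \<Rightarrow> real" where
  "walk n es i = (if i < n then (\<Sum>e\<leftarrow>es. e i) else 0)"

lemma finite_signs [simp]: "finite (signs n)"
  by (auto simp: signs_def intro!: finite_PiE)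

lemma finite_sign_lists [simp]: "finite (sign_lists n k)"
  unfolding sign_lists_def by (rule finite_lists_length_eq) simp

lemma card_signs: "card (signs n) = 2 ^ n"
  by (simp add: signs_def card_PiE numeral_2_eq_2)

lemma card_sign_lists: "card (sign_lists n k) = 2 ^ (n * k)"
  unfolding sign_lists_def by (subst card_lists_length_eq) (auto simp: card_signs power_mult)

lemma signs_abs: "e \<in> signs n \<Longrightarrow> i < n \<Longrightarrow> \<bar>e i\<bar> = 1"
  by (auto simp: signs_def PiE_def Pi_def)

text \<open>Independence of the coordinates, as a distributive law. The semiring is kept general to
  serve both complex exponentials and real exponential moments.\<close>

lemma sum_signs_prod:
  fixes F :: "nat \<Rightarrow> real \<Rightarrow> 'a::comm_semiring_1"
  shows "(\<Sum>e\<in>signs n. \<Prod>i<n. F i (e i)) = (\<Prod>i<n. F i (-1) + F i 1)"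
proof -
  have "(\<Prod>i<n. F i (-1) + F i 1) = (\<Prod>i<n. \<Sum>u\<in>{-1, 1}. F i u)" by simp
  also have "\<dots> = (\<Sum>e\<in>signs n. \<Prod>i<n. F i (e i))"
    unfolding signs_def by (rule prod_sum_PiE) auto
  finally show ?thesis by simp
qed

lemma sum_sign_lists_Suc:
  "(\<Sum>es\<in>sign_lists n (Suc k). G es) = (\<Sum>es\<in>sign_lists n k. \<Sum>e\<in>signs n. G (e # es))"
proof -
  have "sign_lists n (Suc k) = (\<lambda>(es, e). e # es) ` (sign_lists n k \<times> signs n)"
    unfolding sign_lists_def by (rule lists_length_Suc_eq)
  moreover have "inj_on (\<lambda>(es, e). e # es) (sign_lists n k \<times> signs n)"
    by (auto simp: inj_on_def)
  ultimately have "(\<Sum>es\<in>sign_lists n (Suc k). G es) = (\<Sum>(es, e)\<in>sign_lists n k \<times> signs n. G (e # es))"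
    by (simp add: sum.reindex case_prod_unfold)
  also have "\<dots> = (\<Sum>es\<in>sign_lists n k. \<Sum>e\<in>signs n. G (e # es))"
    by (simp add: sum.cartesian_product)
  finally show ?thesis .
qed

lemma sign_lists_0 [simp]: "sign_lists n 0 = {[]}"
  by (auto simp: sign_lists_def)

lemma walk_Nil [simp]: "walk n [] i = 0"
  by (simp add: walk_def)

lemma walk_Cons: "i < n \<Longrightarrow> walk n (e # es) i = e i + walk n es i"
  by (simp add: walk_def)

lemma cis_sum: "cis (\<Sum>i\<in>A. f i) = (\<Prod>i\<in>A. cis (f i))"
  by (induction A rule: infinite_finite_induct) (auto simp: cis_mult[symmetric])

lemma sum_signs_cis: "(\<Sum>e\<in>signs n. cis (\<Sum>i<n. e i * \<xi> i)) = of_real (2 ^ n * (\<Prod>i<n. cos (\<xi> i)))"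
proof -
  have "(\<Sum>e\<in>signs n. cis (\<Sum>i<n. e i * \<xi> i)) = (\<Prod>i<n. cis (- 1 * \<xi> i) + cis (1 * \<xi> i))"
    unfolding cis_sum by (rule sum_signs_prod)
  also have "\<dots> = (\<Prod>i<n. of_real (2 * cos (\<xi> i)))"
    by (intro prod.cong) (auto simp: complex_eq_iff)
  also have "\<dots> = of_real (2 ^ n * (\<Prod>i<n. cos (\<xi> i)))"
    by (simp add: prod.distrib)
  finally show ?thesis .
qed

lemma sum_sign_lists_cis:
  "(\<Sum>es\<in>sign_lists n k. cis (\<Sum>i<n. walk n es i * \<xi> i)) = of_real (2 ^ (n * k) * (\<Prod>i<n. cos (\<xi> i)) ^ k)"
proof (induction k)
  case (Suc k)
  have "cis (\<Sum>i<n. walk n (e # es) i * \<xi> i) = cis (\<Sum>i<n. e i * \<xi> i) * cis (\<Sum>i<n. walk n es i * \<xi> i)" for e es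
    by (simp add: walk_Cons distrib_right sum.distrib cis_mult)
  then have "(\<Sum>es\<in>sign_lists n (Suc k). cis (\<Sum>i<n. walk n es i * \<xi> i)) =
     (\<Sum>es\<in>sign_lists n k. (\<Sum>e\<in>signs n. cis (\<Sum>i<n. e i * \<xi> i)) * cis (\<Sum>i<n. walk n es i * \<xi> i))"
    unfolding sum_sign_lists_Suc by (simp add: sum_distrib_right)
  also have "\<dots> = (\<Sum>e\<in>signs n. cis (\<Sum>i<n. e i * \<xi> i)) * (\<Sum>es\<in>sign_lists n k. cis (\<Sum>i<n. walk n es i * \<xi> i))"
    by (rule sum_distrib_left[symmetric])
  also have "\<dots> = of_real (2 ^ (n * Suc k) * (\<Prod>i<n. cos (\<xi> i)) ^ Suc k)"
    unfolding Suc sum_signs_cis by (simp add: power_add mult_ac)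
  finally show ?case .
qed simp

lemma walk_abs_le:
  assumes "es \<in> sign_lists n k"
  shows "\<bar>walk n es i\<bar> \<le> real k"
  using assms
proof (induction k arbitrary: es)
  case (Suc k)
  then obtain e es' where es: "es = e # es'" "e \<in> signs n" "es' \<in> sign_lists n k"
    by (cases es) (auto simp: sign_lists_def)
  show ?case
  proof (cases "i < n")
    case True
    then show ?thesis using Suc.IH[OF es(3)] signs_abs[OF es(2) True] by (simp add: es(1) walk_Cons)
  qed (simp add: walk_def)
qed simp

section \<open>Tail bounds for the walks\<close>

lemma sinh_le_mult_cosh:
  fixes t :: real
  assumes "0 \<le> t" shows "sinh t \<le> t * cosh t"
proof -
  have "0 * cosh 0 - sinh 0 \<le> t * cosh t - sinh t"
  proof (rule DERIV_nonneg_imp_nondecreasing[OF assms])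
    fix x :: real assume x: "0 \<le> x" "x \<le> t"
    have "((\<lambda>t. t * cosh t - sinh t) has_real_derivative x * sinh x) (at x)"
      by (auto intro!: derivative_eq_intros)
    then show "\<exists>y. ((\<lambda>t. t * cosh t - sinh t) has_real_derivative y) (at x) \<and> 0 \<le> y"
      using x by (intro exI[of _ "x * sinh x"]) auto
  qed
  then show ?thesis by simp
qed

text \<open>For \<open>t \<ge> 0\<close> compare logarithms: the derivative of
  \<open>t\<^sup>2 / 2 - ln (cosh t)\<close> is \<open>t - sinh t / cosh t \<ge> 0\<close>. Evenness
  gives the rest.\<close>

lemma cosh_le_exp_half_sq: "cosh t \<le> exp (t\<^sup>2 / 2)" for t :: real
proof -
  have main: "cosh t \<le> exp (t\<^sup>2 / 2)" if t: "0 \<le> t" for t :: real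
  proof -
    have "0\<^sup>2 / 2 - ln (cosh 0) \<le> t\<^sup>2 / 2 - ln (cosh t)"
    proof (rule DERIV_nonneg_imp_nondecreasing[OF t])
      fix x :: real assume x: "0 \<le> x" "x \<le> t"
      have "((\<lambda>t. t\<^sup>2 / 2 - ln (cosh t)) has_real_derivative (x - sinh x / cosh x)) (at x)"
        by (auto intro!: derivative_eq_intros)
      moreover have "0 \<le> x - sinh x / cosh x"
        using sinh_le_mult_cosh[OF x(1)] by (simp add: field_simps)
      ultimately show "\<exists>y. ((\<lambda>t. t\<^sup>2 / 2 - ln (cosh t)) has_real_derivative y) (at x) \<and> 0 \<le> y"
        by blast
    qed
    then have "ln (cosh t) \<le> t\<^sup>2 / 2" by simp
    then have "exp (ln (cosh t)) \<le> exp (t\<^sup>2 / 2)" by (simp only: exp_le_cancel_iff)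
    then show ?thesis by simp
  qed
  show ?thesis using main[of "\<bar>t\<bar>"] by simp
qed

text \<open>One step of the walk turns \<open>exp (\<mu> \<bar>y\<bar>\<^sup>2)\<close> into at most
  \<open>exp (\<mu> n) exp ((\<mu> + 2 \<mu>\<^sup>2) \<bar>y\<bar>\<^sup>2)\<close>, so the exponent only grows by a bounded factor over \<open>k\<close> steps.\<close>

lemma sum_sign_lists_exp:
  assumes "0 \<le> \<mu>" "0 \<le> M" "\<mu> * (1 + 2 * M) ^ k \<le> M"
  shows "(\<Sum>es\<in>sign_lists n k. exp (\<mu> * (\<Sum>i<n. (walk n es i)\<^sup>2))) \<le> 2 ^ (n * k) * exp (M * n * k)"
  using assms
proof (induction k arbitrary: \<mu>)
  case (Suc k)
  have "\<mu> * 1 \<le> \<mu> * (1 + 2 * M) ^ Suc k"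
    using Suc.prems by (intro mult_left_mono one_le_power) auto
  then have \<mu>M: "\<mu> \<le> M" using Suc.prems by simp
  \<comment> \<open>The increment \<open>2 * \<mu>\<^sup>2\<close> comes from bounding
    \<open>cosh (2 * \<mu> * y i)\<close> by a Gaussian exponential. As \<nu> is at most
    \<open>\<mu> * (1 + 2 * M)\<close>, one step uses up one factor of the hypothesis.\<close>
  define \<nu> where "\<nu> = \<mu> + 2 * \<mu>\<^sup>2"
  have \<nu>0: "0 \<le> \<nu>" using Suc.prems by (simp add: \<nu>_def)
  have "\<nu> = \<mu> * (1 + 2 * \<mu>)" by (simp add: \<nu>_def power2_eq_square distrib_left)
  also have "\<dots> \<le> \<mu> * (1 + 2 * M)" using Suc.prems \<mu>M by (intro mult_left_mono) auto
  finally have "\<nu> * (1 + 2 * M) ^ k \<le> \<mu> * (1 + 2 * M) * (1 + 2 * M) ^ k"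
    using Suc.prems by (intro mult_right_mono) auto
  then have \<nu>: "\<nu> * (1 + 2 * M) ^ k \<le> M" using Suc.prems(3) by (simp add: mult.assoc)
  have step: "(\<Sum>e\<in>signs n. exp (\<mu> * (\<Sum>i<n. (e i + y i)\<^sup>2))) \<le> 2 ^ n * exp (M * n) * exp (\<nu> * (\<Sum>i<n. (y i)\<^sup>2))" for y
  proof -
    have "(\<Sum>e\<in>signs n. exp (\<mu> * (\<Sum>i<n. (e i + y i)\<^sup>2))) =
        (\<Sum>e\<in>signs n. \<Prod>i<n. exp (\<mu> * (e i + y i)\<^sup>2))"
      by (simp add: sum_distrib_left exp_sum)
    also have "\<dots> = (\<Prod>i<n. exp (\<mu> * (- 1 + y i)\<^sup>2) + exp (\<mu> * (1 + y i)\<^sup>2))"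
      by (rule sum_signs_prod)
    also have "\<dots> \<le> (\<Prod>i<n. 2 * exp M * exp (\<nu> * (y i)\<^sup>2))"
    proof (intro prod_mono conjI)
      fix i
      have "exp (\<mu> * (- 1 + y i)\<^sup>2) + exp (\<mu> * (1 + y i)\<^sup>2) = exp (\<mu> + \<mu> * (y i)\<^sup>2) * (2 * cosh (2 * \<mu> * y i))"
        by (simp add: cosh_field_def exp_add[symmetric] distrib_left power2_eq_square algebra_simps)
      also have "\<dots> \<le> exp (M + \<mu> * (y i)\<^sup>2) * (2 * exp ((2 * \<mu> * y i)\<^sup>2 / 2))"
        using \<mu>M by (intro mult_mono cosh_le_exp_half_sq mult_left_mono) auto
      also have "\<dots> = 2 * exp M * exp (\<nu> * (y i)\<^sup>2)"
        by (simp add: \<nu>_def exp_add[symmetric] power2_eq_square algebra_simps)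
      finally show "exp (\<mu> * (- 1 + y i)\<^sup>2) + exp (\<mu> * (1 + y i)\<^sup>2) \<le> 2 * exp M * exp (\<nu> * (y i)\<^sup>2)" .
    qed (auto intro!: add_nonneg_nonneg)
    also have "\<dots> = 2 ^ n * exp (M * n) * exp (\<nu> * (\<Sum>i<n. (y i)\<^sup>2))"
      by (simp add: prod.distrib exp_sum sum_distrib_left exp_of_nat_mult mult.commute[of M])
    finally show ?thesis .
  qed
  have "(\<Sum>es\<in>sign_lists n (Suc k). exp (\<mu> * (\<Sum>i<n. (walk n es i)\<^sup>2))) =
     (\<Sum>es\<in>sign_lists n k. \<Sum>e\<in>signs n. exp (\<mu> * (\<Sum>i<n. (e i + walk n es i)\<^sup>2)))"
    unfolding sum_sign_lists_Suc by (simp add: walk_Cons)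
  also have "\<dots> \<le> (\<Sum>es\<in>sign_lists n k. 2 ^ n * exp (M * n) * exp (\<nu> * (\<Sum>i<n. (walk n es i)\<^sup>2)))"
    by (intro sum_mono step)
  also have "\<dots> = 2 ^ n * exp (M * n) * (\<Sum>es\<in>sign_lists n k. exp (\<nu> * (\<Sum>i<n. (walk n es i)\<^sup>2)))"
    by (simp add: sum_distrib_left)
  also have "\<dots> \<le> 2 ^ n * exp (M * n) * (2 ^ (n * k) * exp (M * n * k))"
    using Suc.IH[OF \<nu>0 Suc.prems(2) \<nu>] by (intro mult_left_mono) auto
  also have "\<dots> = 2 ^ (n * Suc k) * exp (M * n * Suc k)"
    by (simp add: power_add exp_add[symmetric] algebra_simps)
  finally show ?case .
qed simp

text \<open>Markov's inequality for the exponential moment of the squared norm.\<close>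

lemma walk_tail:
  fixes r :: real and n k N :: nat
  assumes N: "1 \<le> N" "k \<le> N"
  shows "real (card {es \<in> sign_lists n k. r < (\<Sum>i<n. (walk n es i)\<^sup>2)}) \<le> 2 ^ (n * k) * exp (n / 4 - r / (8 * N))"
proof -
  \<comment> \<open>With \<open>M = 2 * \<mu>\<close>, the moment bound asks for
    \<open>(1 + 2 * M) ^ k \<le> 2\<close>, which holds since \<open>2 * M * k \<le> 1 / 2\<close>.
    Moreover \<open>M * n * k \<le> n / 4\<close>.\<close>
  define M where "M = 1 / (4 * real N)"
  define \<mu> where "\<mu> = 1 / (8 * real N)"
  let ?B = "{es \<in> sign_lists n k. r < (\<Sum>i<n. (walk n es i)\<^sup>2)}"
  have M: "0 \<le> M" "0 \<le> \<mu>" using N by (auto simp: M_def \<mu>_def)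
  have "(1 + 2 * M) ^ k \<le> exp (2 * M) ^ k" using M by (intro power_mono exp_ge_add_one_self) auto
  also have "\<dots> = exp (real k * (2 * M))" by (simp add: exp_of_nat_mult)
  also have "\<dots> \<le> exp (1 / 2)" using N by (simp add: M_def field_simps)
  also have "\<dots> \<le> 2" by (rule exp_half_le2)
  finally have "\<mu> * (1 + 2 * M) ^ k \<le> \<mu> * 2" using M by (intro mult_left_mono)
  also have "\<dots> = M" by (simp add: M_def \<mu>_def)
  finally have *: "\<mu> * (1 + 2 * M) ^ k \<le> M" .
  have "real (card ?B) * exp (\<mu> * r) = (\<Sum>es\<in>?B. exp (\<mu> * r))" by simp
  also have "\<dots> \<le> (\<Sum>es\<in>?B. exp (\<mu> * (\<Sum>i<n. (walk n es i)\<^sup>2)))"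
    using M by (intro sum_mono) (auto intro!: mult_left_mono)
  also have "\<dots> \<le> (\<Sum>es\<in>sign_lists n k. exp (\<mu> * (\<Sum>i<n. (walk n es i)\<^sup>2)))"
    by (intro sum_mono2) auto
  also have "\<dots> \<le> 2 ^ (n * k) * exp (M * n * k)" by (rule sum_sign_lists_exp[OF M(2,1) *])
  also have "\<dots> \<le> 2 ^ (n * k) * exp (n / 4)"
    using N by (intro mult_left_mono) (auto simp: M_def field_simps intro!: mult_right_mono)
  finally have "real (card ?B) \<le> 2 ^ (n * k) * exp (n / 4) / exp (\<mu> * r)"
    by (simp add: field_simps)
  also have "\<dots> = 2 ^ (n * k) * exp (n / 4 - r / (8 * N))"
    by (simp add: exp_diff \<mu>_def)
  finally show ?thesis .
qed

section \<open>The Fourier representation of powers of the distance\<close>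


definition riesz_weight :: "real \<Rightarrow> real \<Rightarrow> real" where
  "riesz_weight b t = indicator {0<..} t * t powr (- b - 1)"

lemma riesz_weight_measurable [measurable]: "riesz_weight b \<in> borel_measurable borel"
  unfolding riesz_weight_def[abs_def] by measurable

lemma riesz_weight_nonneg: "0 \<le> riesz_weight b t"
  by (simp add: riesz_weight_def)

lemma riesz_weight_scale: "0 < c \<Longrightarrow> riesz_weight b (c * t) = c powr (- b - 1) * riesz_weight b t"
  by (auto simp: riesz_weight_def indicator_def powr_mult zero_less_mult_iff)

text \<open>The quadratic bound controls the singularity at 0 because \<open>b < 2\<close>, the
  uniform bound controls infinity because \<open>b > 0\<close>.\<close>

lemma integrable_riesz_weight:
  assumes b: "0 < b" "b < 2" and [measurable]: "F \<in> borel_measurable borel"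
    and F: "\<And>t. \<bar>F t\<bar> \<le> C * t\<^sup>2" "\<And>t. \<bar>F t\<bar> \<le> C"
  shows "integrable lborel (\<lambda>t. riesz_weight b t * F t)"
proof -
  have C: "0 \<le> C" using F(2)[of 0] by linarith
  have "integrable lborel (\<lambda>t. indicator {0..1} t * t powr (1 - b))"
    using b by (intro set_integrable_lborel_nonneg integrable_on_powr_from_0) auto
  moreover have "integrable lborel (\<lambda>t. indicator {1..} t * t powr (- b - 1))"
  proof (intro set_integrable_lborel_nonneg)
    show "(\<lambda>t::real. t powr (- b - 1)) integrable_on {1..}"
      using has_integral_powr_to_inf[of "- b - 1" 1] b by (auto simp: integrable_on_def)
  qed auto
  ultimately have "integrable lborel (\<lambda>t. C * (indicator {0..1} t * t powr (1 - b)) + C * (indicator {1..} t * t powr (- b - 1)))"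
    by simp
  then show ?thesis
  proof (rule Bochner_Integration.integrable_bound)
    show "AE t in lborel. norm (riesz_weight b t * F t) \<le>
      norm (C * (indicator {0..1} t * t powr (1 - b)) + C * (indicator {1..} t * t powr (- b - 1)))"
    proof (intro AE_I2)
      fix t :: real
      consider "t \<le> 0" | "0 < t" "t < 1" | "1 \<le> t" by linarith
      then show "norm (riesz_weight b t * F t) \<le>
        norm (C * (indicator {0..1} t * t powr (1 - b)) + C * (indicator {1..} t * t powr (- b - 1)))"
      proof cases
        case 2
        have "t powr (- b - 1) * \<bar>F t\<bar> \<le> t powr (- b - 1) * (C * t\<^sup>2)"
          by (intro mult_left_mono F) auto
        also have "t\<^sup>2 = t powr 2" using 2 by simp
        also have "t powr (- b - 1) * (C * t powr 2) = C * t powr (1 - b)"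
          by (simp add: powr_add[symmetric])
        finally show ?thesis using 2 C by (simp add: riesz_weight_def abs_mult)
      next
        case 3
        have "t powr (- b - 1) * \<bar>F t\<bar> \<le> t powr (- b - 1) * C"
          by (intro mult_left_mono F) auto
        then show ?thesis using 3 C by (auto simp: riesz_weight_def abs_mult indicator_def mult.commute)
      qed (simp add: riesz_weight_def)
    qed
  qed measurable
qed

text \<open>Homogeneity of the weight and the Jacobian together leave the power \<open>b\<close>;
  evenness of \<open>F\<close> absorbs the sign of \<open>u\<close>. It is applied to
  \<open>1 - cos t\<close> and to the saturation profile.\<close>

lemma has_bochner_integral_riesz_scale:
  assumes b: "0 < b" and i: "integrable lborel (\<lambda>t. riesz_weight b t * F t)"
    and F: "F 0 = 0" "\<And>t. F (- t) = F t"
  shows "has_bochner_integral lborel (\<lambda>t. riesz_weight b t * F (u * t)) (\<bar>u\<bar> powr b * (\<integral>t. riesz_weight b t * F t \<partial>lborel))"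
proof (cases "u = 0")
  case True
  then show ?thesis using F b by (simp add: has_bochner_integral_zero)
next
  case False
  define c where "c = \<bar>u\<bar>"
  have c: "c > 0" using False by (simp add: c_def)
  define I where "I = (\<integral>t. riesz_weight b t * F t \<partial>lborel)"
  have Fc: "F (u * t) = F (c * t)" for t
    using F(2)[of "u * t"] by (cases "u \<ge> 0") (auto simp: c_def)
  have "has_bochner_integral lborel (\<lambda>t. riesz_weight b t * F t) I"
    unfolding I_def by (rule has_bochner_integral_integrable[OF i])
  then have "has_bochner_integral lborel (\<lambda>t. riesz_weight b (0 + c * t) * F (0 + c * t)) (I /\<^sub>R \<bar>c\<bar>)"
    using lborel_has_bochner_integral_real_affine_iff[of c "\<lambda>t. riesz_weight b t * F t" I 0] c by simp
  then have "has_bochner_integral lborel (\<lambda>t. c powr (b + 1) * (riesz_weight b (c * t) * F (c * t))) (c powr (b + 1) * (I /\<^sub>R \<bar>c\<bar>))"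
    by (intro has_bochner_integral_mult_right) simp
  also have "(\<lambda>t. c powr (b + 1) * (riesz_weight b (c * t) * F (c * t))) = (\<lambda>t. riesz_weight b t * F (u * t))"
    using c by (simp add: riesz_weight_scale Fc mult.assoc[symmetric] powr_add[symmetric])
  also have "c powr (b + 1) * (I /\<^sub>R \<bar>c\<bar>) = \<bar>u\<bar> powr b * I"
    using c by (simp add: powr_add c_def[symmetric])
  finally show ?thesis unfolding I_def .
qed

definition riesz_const :: "real \<Rightarrow> real" where
  "riesz_const b = (\<integral>t. riesz_weight b t * (1 - cos t) \<partial>lborel)"

lemma one_minus_cos_le: "\<bar>1 - cos t\<bar> \<le> 2 * t\<^sup>2" for t :: real
proof -
  have "1 - cos t = 2 * (sin (t / 2))\<^sup>2" using cos_double_sin[of "t / 2"] by simp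
  also have "(sin (t / 2))\<^sup>2 \<le> (t / 2)\<^sup>2"
    using abs_sin_x_le_abs_x[of "t / 2"] by (simp only: abs_le_square_iff)
  finally have "1 - cos t \<le> 2 * t\<^sup>2 - 3 / 2 * t\<^sup>2" by (simp add: power_divide)
  then show ?thesis using zero_le_power2[of t] cos_le_one[of t] by linarith
qed

lemma integrable_riesz_cos:
  assumes b: "0 < b" "b < 2"
  shows "integrable lborel (\<lambda>t. riesz_weight b t * (1 - cos t))"
proof (rule integrable_riesz_weight[OF b, where C = 2])
  show "\<bar>1 - cos t\<bar> \<le> 2 * t\<^sup>2" for t :: real by (rule one_minus_cos_le)
  show "\<bar>1 - cos t\<bar> \<le> 2" for t :: real using cos_ge_minus_one[of t] cos_le_one[of t] by linarith
qed measurable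

lemma has_bochner_integral_riesz_cos:
  assumes b: "0 < b" "b < 2"
  shows "has_bochner_integral lborel (\<lambda>t. riesz_weight b t * (1 - cos (u * t))) (riesz_const b * \<bar>u\<bar> powr b)"
  using has_bochner_integral_riesz_scale[OF b(1) integrable_riesz_cos[OF b], of u]
  by (simp add: riesz_const_def mult.commute)

lemma riesz_const_pos:
  assumes b: "0 < b" "b < 2"
  shows "0 < riesz_const b"
  unfolding riesz_const_def
proof (rule integral_pos_pos[OF integrable_riesz_cos[OF b]])
  show "0 \<le> riesz_weight b t * (1 - cos t)" for t by (intro mult_nonneg_nonneg riesz_weight_nonneg) simp
  fix t :: real assume t: "0 < t" "t < 1"
  have "cos t < cos 0" using t pi_gt3 by (intro cos_monotone_0_pi) auto
  then show "0 < riesz_weight b t * (1 - cos t)" using t by (simp add: riesz_weight_def)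
qed

text \<open>This profile bounds \<open>1 - P\<^sup>2\<close> from below for the Fejer polynomial \<open>P\<close> of order \<open>D\<close>. It is concave,
  and Jensen's inequality reduces the lower bound for the energy to one coordinate of the Gaussian vector.\<close>

definition saturation :: "real \<Rightarrow> real \<Rightarrow> real" where
  "saturation D s = D\<^sup>2 * s / (4 + 4 * s + D\<^sup>2 * s)"

lemma saturation_zero [simp]: "saturation D 0 = 0"
  by (simp add: saturation_def)

lemma saturation_eq: "saturation D s = D\<^sup>2 * s / (4 + (4 + D\<^sup>2) * s)"
  by (simp add: saturation_def algebra_simps)

section \<open>Concavity and weighted integrals of the profile\<close>

text \<open>Tangent minus function is an explicit nonnegative multiple of
  \<open>(s - m)\<^sup>2\<close>.\<close>

lemma saturation_tangent:
  assumes "0 \<le> s" "0 \<le> m"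
  shows "saturation D s \<le> saturation D m + 4 * D\<^sup>2 / (4 + (4 + D\<^sup>2) * m)\<^sup>2 * (s - m)"
proof -
  define B where "B = 4 + D\<^sup>2"
  have B: "0 \<le> B" by (simp add: B_def)
  have p: "0 < 4 + B * s" "0 < 4 + B * m" using assms B by (auto intro!: add_pos_nonneg)
  have "D\<^sup>2 * m / (4 + B * m) + 4 * D\<^sup>2 / (4 + B * m)\<^sup>2 * (s - m) - D\<^sup>2 * s / (4 + B * s)
     = D\<^sup>2 * 4 * B * (s - m)\<^sup>2 / ((4 + B * m)\<^sup>2 * (4 + B * s))"
    using p by (simp add: divide_simps) (simp add: power2_eq_square algebra_simps)
  also have "0 \<le> \<dots>" using p B by (intro divide_nonneg_nonneg mult_nonneg_nonneg) auto
  finally show ?thesis by (simp add: saturation_eq B_def)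
qed

lemma saturation_mono:
  assumes "0 \<le> s" "s \<le> m"
  shows "saturation D s \<le> saturation D m"
proof -
  have "saturation D s * 1 \<le> saturation D m"
  proof -
    define B where "B = 4 + D\<^sup>2"
    have B: "0 \<le> B" by (simp add: B_def)
    have p: "0 < 4 + B * s" "0 < 4 + B * m" using assms B by (auto intro!: add_pos_nonneg)
    have "D\<^sup>2 * (s * (4 + B * m)) \<le> D\<^sup>2 * (m * (4 + B * s))"
      using assms by (intro mult_left_mono) (auto simp: algebra_simps)
    then show ?thesis using p by (simp add: saturation_eq B_def[symmetric] frac_le_eq divide_simps mult.assoc)
  qed
  then show ?thesis by simp
qed

lemma saturation_nonneg: "0 \<le> s \<Longrightarrow> 0 \<le> saturation D s"
  unfolding saturation_def by (intro divide_nonneg_nonneg) (auto intro!: add_nonneg_nonneg)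

lemma saturation_le_one: "0 \<le> s \<Longrightarrow> saturation D s \<le> 1"
  unfolding saturation_def by (auto simp: divide_le_eq_1 intro!: add_nonneg_nonneg add_pos_nonneg)

lemma saturation_le_linear:
  assumes "0 \<le> s" shows "saturation D s \<le> D\<^sup>2 * s"
proof -
  have "D\<^sup>2 * s / (4 + 4 * s + D\<^sup>2 * s) \<le> D\<^sup>2 * s / 1"
    using assms by (intro divide_left_mono) (auto intro!: add_nonneg_nonneg add_pos_nonneg simp: add_increasing2)
  then show ?thesis by (simp add: saturation_def)
qed

text \<open>Jensen's inequality at the points \<open>real n * s i\<close>, whose mean is the sum of
  the \<open>s i\<close>: the slope terms of the tangent cancel.\<close>

lemma saturation_sum:
  assumes s: "\<And>i. i < n \<Longrightarrow> 0 \<le> s i" and n: "0 < n"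
  shows "(\<Sum>i<n. saturation D (real n * s i)) \<le> real n * saturation D (\<Sum>i<n. s i)"
proof -
  define m where "m = (\<Sum>i<n. s i)"
  have m: "0 \<le> m" unfolding m_def by (rule sum_nonneg) (use s in auto)
  define c where "c = 4 * D\<^sup>2 / (4 + (4 + D\<^sup>2) * m)\<^sup>2"
  have "(\<Sum>i<n. saturation D (real n * s i)) \<le> (\<Sum>i<n. saturation D m + c * (real n * s i - m))"
    unfolding c_def using s m by (intro sum_mono saturation_tangent) auto
  also have "\<dots> = real n * saturation D m + c * (real n * (\<Sum>i<n. s i) - real n * m)"
    by (simp add: sum.distrib sum_distrib_left[symmetric] sum_subtractf)
  also have "\<dots> = real n * saturation D m" by (simp add: m_def)
  finally show ?thesis by (simp add: m_def)
qed

definition saturation_const :: "real \<Rightarrow> real \<Rightarrow> nat \<Rightarrow> real" where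
  "saturation_const b D n = (\<integral>t. riesz_weight b t * saturation D (real n * (sin t)\<^sup>2) \<partial>lborel)"

lemma saturation_measurable [measurable]: "saturation D \<in> borel_measurable borel"
  unfolding saturation_def[abs_def] by measurable

lemma integrable_riesz_saturation:
  assumes b: "0 < b" "b < 2"
  shows "integrable lborel (\<lambda>t. riesz_weight b t * saturation D (real n * (sin t)\<^sup>2))"
proof (rule integrable_riesz_weight[OF b, where C = "1 + D\<^sup>2 * real n"])
  fix t :: real
  have s: "0 \<le> real n * (sin t)\<^sup>2" by simp
  have "\<bar>saturation D (real n * (sin t)\<^sup>2)\<bar> = saturation D (real n * (sin t)\<^sup>2)"
    using saturation_nonneg[OF s] by simp
  also have "\<dots> \<le> D\<^sup>2 * (real n * (sin t)\<^sup>2)" by (rule saturation_le_linear[OF s])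
  also have "\<dots> \<le> D\<^sup>2 * (real n * t\<^sup>2)"
    using abs_sin_x_le_abs_x[of t] by (intro mult_left_mono) (auto simp: abs_le_square_iff)
  also have "\<dots> \<le> (1 + D\<^sup>2 * real n) * t\<^sup>2" by (simp add: algebra_simps)
  finally show "\<bar>saturation D (real n * (sin t)\<^sup>2)\<bar> \<le> (1 + D\<^sup>2 * real n) * t\<^sup>2" .
  have "0 \<le> D\<^sup>2 * real n" by simp
  then show "\<bar>saturation D (real n * (sin t)\<^sup>2)\<bar> \<le> 1 + D\<^sup>2 * real n"
    using saturation_nonneg[OF s, of D] saturation_le_one[OF s, of D] by linarith
qed measurable

lemma has_bochner_integral_riesz_saturation:
  assumes b: "0 < b" "b < 2"
  shows "has_bochner_integral lborel (\<lambda>t. riesz_weight b t * saturation D (real n * (sin (u * t))\<^sup>2))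
    (saturation_const b D n * \<bar>u\<bar> powr b)"
  using has_bochner_integral_riesz_scale[OF b(1) integrable_riesz_saturation[OF b, of D n], of u]
  by (simp add: saturation_const_def mult.commute)

lemma sin_ge_half:
  assumes "0 \<le> t" "t \<le> 1" shows "t / 2 \<le> sin (t::real)"
proof -
  have "0 - 0 / 2 \<le> sin t - t / 2"
  proof -
    have "sin 0 - 0 / 2 \<le> sin t - t / 2"
    proof (rule DERIV_nonneg_imp_nondecreasing[OF assms(1)])
      fix x :: real assume x: "0 \<le> x" "x \<le> t"
      have "cos (pi / 3) \<le> cos x" using x assms pi_gt3 by (intro cos_monotone_0_pi_le) auto
      then have "0 \<le> cos x - 1 / 2" by (simp add: cos_60)
      moreover have "((\<lambda>t. sin t - t / 2) has_real_derivative (cos x - 1 / 2)) (at x)"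
        by (auto intro!: derivative_eq_intros)
      ultimately show "\<exists>y. ((\<lambda>t. sin t - t / 2) has_real_derivative y) (at x) \<and> 0 \<le> y" by blast
    qed
    then show ?thesis by simp
  qed
  then show ?thesis by simp
qed

lemma saturation_const_ge:
  assumes b: "0 < b" "b < 2" and D: "1 \<le> D" and n: "1 \<le> n"
  shows "(D * sqrt (real n)) powr b / 256 \<le> saturation_const b D n"
proof -
  \<comment> \<open>For \<open>t\<close> of size \<tau> the product of \<open>D\<^sup>2\<close> and
    \<open>real n * (sin t)\<^sup>2\<close> is of order 1, so the profile is bounded below; only
    \<open>{\<tau> / 2..\<tau>}\<close> is kept.\<close>
  define \<tau> where "\<tau> = 1 / (D * sqrt (real n))"
  have Dn: "1 \<le> D * sqrt (real n)" using D n mult_mono[of 1 D 1 "sqrt (real n)"] by simp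
  have \<tau>: "0 < \<tau>" "\<tau> \<le> 1" using Dn by (auto simp: \<tau>_def)
  have \<tau>2: "D\<^sup>2 * (real n * \<tau>\<^sup>2) = 1" using D n by (simp add: \<tau>_def power_divide power_mult_distrib)
  have "has_bochner_integral lborel (\<lambda>t. \<tau> powr (- b - 1) / 128 * indicator {\<tau> / 2..\<tau>} t)
     (\<tau> powr (- b - 1) / 128 * measure lborel {\<tau> / 2..\<tau>})"
    by (intro has_bochner_integral_mult_right has_bochner_integral_real_indicator)
       (auto simp: emeasure_lborel_Icc_eq)
  moreover have "has_bochner_integral lborel (\<lambda>t. riesz_weight b t * saturation D (real n * (sin t)\<^sup>2)) (saturation_const b D n)"
    unfolding saturation_const_def by (rule has_bochner_integral_integrable[OF integrable_riesz_saturation[OF b]])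
  moreover have "\<tau> powr (- b - 1) / 128 * indicator {\<tau> / 2..\<tau>} t \<le> riesz_weight b t * saturation D (real n * (sin t)\<^sup>2)" for t
  proof (cases "t \<in> {\<tau> / 2..\<tau>}")
    case True
    then have t: "\<tau> / 2 \<le> t" "t \<le> \<tau>" "0 < t" "t \<le> 1" using \<tau> by auto
    define s0 where "s0 = real n * (\<tau> / 4)\<^sup>2"
    have s0: "D\<^sup>2 * s0 = 1 / 16" using \<tau>2 by (simp add: s0_def power_divide)
    have "0 \<le> s0" by (simp add: s0_def)
    have "1 * s0 \<le> D\<^sup>2 * s0" using D \<open>0 \<le> s0\<close> by (intro mult_right_mono) (auto simp: one_le_power)
    then have s01: "s0 \<le> 1 / 16" using s0 by simp
    have "\<tau> / 4 \<le> sin t" using sin_ge_half[of t] t by simp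
    then have "s0 \<le> real n * (sin t)\<^sup>2" unfolding s0_def using \<tau> by (intro mult_left_mono power_mono) auto
    then have "saturation D s0 \<le> saturation D (real n * (sin t)\<^sup>2)" by (rule saturation_mono[OF \<open>0 \<le> s0\<close>])
    \<comment> \<open>By \<open>D\<^sup>2 * s0 = 1 / 16\<close> the profile equals
      \<open>1 / (65 + 64 * s0)\<close>, which is at least \<open>1 / 69\<close>.\<close>
    moreover have "1 / 128 \<le> saturation D s0"
      using s01 \<open>0 \<le> s0\<close> unfolding saturation_def s0 by (simp add: field_simps)
    ultimately have "1 / 128 \<le> saturation D (real n * (sin t)\<^sup>2)" by linarith
    moreover have "\<tau> powr (- b - 1) \<le> t powr (- b - 1)"
      using t b by (intro powr_mono2') auto
    ultimately have "\<tau> powr (- b - 1) * (1 / 128) \<le> t powr (- b - 1) * saturation D (real n * (sin t)\<^sup>2)"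
      by (intro mult_mono) auto
    then show ?thesis using True t by (simp add: riesz_weight_def)
  next
    case False
    then show ?thesis by (auto intro!: mult_nonneg_nonneg riesz_weight_nonneg saturation_nonneg)
  qed
  ultimately have "\<tau> powr (- b - 1) / 128 * measure lborel {\<tau> / 2..\<tau>} \<le> saturation_const b D n"
    by (rule has_bochner_integral_mono)
  moreover have "\<tau> powr (- b - 1) / 128 * measure lborel {\<tau> / 2..\<tau>} = (D * sqrt (real n)) powr b / 256"
  proof -
    have "\<tau> powr (- b - 1) * \<tau> = \<tau> powr (- b - 1 + 1)" using \<tau> unfolding powr_add by simp
    also have "\<dots> = (D * sqrt (real n)) powr b"
      using Dn by (simp add: \<tau>_def powr_minus powr_divide)
    finally show ?thesis using \<tau> by simp
  qed
  ultimately show ?thesis by simp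
qed

section \<open>The energy of a signed combination of walks\<close>


definition walk_lists :: "nat \<Rightarrow> nat \<Rightarrow> (nat \<Rightarrow> real) list set" where
  "walk_lists n N = (\<Union>m\<le>N. sign_lists n m)"

text \<open>The \<open>2 ^ (n * m)\<close> walks of length \<open>m\<close> share the coefficient of
  degree \<open>m\<close> equally, giving a signed mixture of walk laws with characteristic function
  \<open>poly (fejer_poly k)\<close> of the product of cosines.\<close>

definition fejer_weight :: "nat \<Rightarrow> nat \<Rightarrow> (nat \<Rightarrow> real) list \<Rightarrow> real" where
  "fejer_weight k n es = coeff (fejer_poly k) (length es) / 2 ^ (n * length es)"

lemma finite_walk_lists [simp]: "finite (walk_lists n N)"
  by (simp add: walk_lists_def)

lemma sum_walk_lists: "(\<Sum>es\<in>walk_lists n N. G es) = (\<Sum>m\<le>N. \<Sum>es\<in>sign_lists n m. G es)"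
  unfolding walk_lists_def by (rule sum.UNION_disjoint) (simp, simp, auto simp: sign_lists_def)

lemma length_sign_lists: "es \<in> sign_lists n m \<Longrightarrow> length es = m"
  by (simp add: sign_lists_def)

lemma fejer_weight_sign_lists:
  "es \<in> sign_lists n m \<Longrightarrow> fejer_weight k n es = coeff (fejer_poly k) m / 2 ^ (n * m)"
  by (simp add: fejer_weight_def length_sign_lists)

lemma fejer_weight_sum: "(\<Sum>es\<in>walk_lists n (2 * 2 ^ k). fejer_weight k n es) = 1"
proof -
  have "(\<Sum>es\<in>walk_lists n (2 * 2 ^ k). fejer_weight k n es) = (\<Sum>m\<le>2 * 2 ^ k. coeff (fejer_poly k) m * 1 ^ m)"
    unfolding sum_walk_lists
    by (intro sum.cong refl) (simp add: fejer_weight_sign_lists card_sign_lists)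
  also have "\<dots> = 1" by (subst poly_eq_sum_coeff[symmetric]) (auto simp: fejer_poly_degree fejer_poly_one)
  finally show ?thesis .
qed

lemma fejer_weight_cis:
  "(\<Sum>es\<in>walk_lists n (2 * 2 ^ k). of_real (fejer_weight k n es) * cis (\<Sum>i<n. walk n es i * \<xi> i))
    = of_real (poly (fejer_poly k) (\<Prod>i<n. cos (\<xi> i)))"
proof -
  have "(\<Sum>es\<in>sign_lists n m. of_real (fejer_weight k n es) * cis (\<Sum>i<n. walk n es i * \<xi> i))
      = of_real (coeff (fejer_poly k) m * (\<Prod>i<n. cos (\<xi> i)) ^ m)" for m
  proof -
    have "(\<Sum>es\<in>sign_lists n m. of_real (fejer_weight k n es) * cis (\<Sum>i<n. walk n es i * \<xi> i))
      = of_real (coeff (fejer_poly k) m / 2 ^ (n * m)) * (\<Sum>es\<in>sign_lists n m. cis (\<Sum>i<n. walk n es i * \<xi> i))"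
      unfolding sum_distrib_left by (intro sum.cong) (auto simp: fejer_weight_sign_lists)
    then show ?thesis unfolding sum_sign_lists_cis by (simp add: field_simps)
  qed
  then show ?thesis
    unfolding sum_walk_lists poly_eq_sum_coeff[OF fejer_poly_degree] by simp
qed

lemma fejer_weight_abs_sum: "(\<Sum>es\<in>walk_lists n (2 * 2 ^ k). \<bar>fejer_weight k n es\<bar>) \<le> 3 ^ (2 * 2 ^ k)"
proof -
  have "(\<Sum>es\<in>walk_lists n (2 * 2 ^ k). \<bar>fejer_weight k n es\<bar>) = (\<Sum>m\<le>2 * 2 ^ k. \<bar>coeff (fejer_poly k) m\<bar>)"
    unfolding sum_walk_lists
    by (intro sum.cong refl) (simp add: fejer_weight_sign_lists card_sign_lists)
  then show ?thesis using fejer_poly_coeff_sum by simp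
qed

lemma fejer_weight_tail:
  fixes r :: real
  shows "(\<Sum>es\<in>walk_lists n (2 * 2 ^ k). \<bar>fejer_weight k n es\<bar> * of_bool (r < (\<Sum>i<n. (walk n es i)\<^sup>2)))
    \<le> 3 ^ (2 * 2 ^ k) * exp (n / 4 - r / (8 * (2 * 2 ^ k)))"
proof -
  let ?N = "2 * 2 ^ k :: nat"
  let ?e = "exp (n / 4 - r / (8 * real ?N))"
  have "(\<Sum>es\<in>walk_lists n ?N. \<bar>fejer_weight k n es\<bar> * of_bool (r < (\<Sum>i<n. (walk n es i)\<^sup>2)))
      \<le> (\<Sum>m\<le>?N. \<bar>coeff (fejer_poly k) m\<bar> * ?e)"
    unfolding sum_walk_lists
  proof (rule sum_mono)
    fix m assume m: "m \<in> {..?N}"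
    have "(\<Sum>es\<in>sign_lists n m. \<bar>fejer_weight k n es\<bar> * of_bool (r < (\<Sum>i<n. (walk n es i)\<^sup>2)))
       = \<bar>coeff (fejer_poly k) m\<bar> / 2 ^ (n * m) * (\<Sum>es\<in>sign_lists n m. of_bool (r < (\<Sum>i<n. (walk n es i)\<^sup>2)))"
      unfolding sum_distrib_left by (intro sum.cong) (auto simp: fejer_weight_sign_lists)
    also have "(\<Sum>es\<in>sign_lists n m. of_bool (r < (\<Sum>i<n. (walk n es i)\<^sup>2)))
       = real (card {es \<in> sign_lists n m. r < (\<Sum>i<n. (walk n es i)\<^sup>2)})"
      by (simp add: of_bool_def sum.If_cases Int_def)
    also have "\<bar>coeff (fejer_poly k) m\<bar> / 2 ^ (n * m) * \<dots> \<le> \<bar>coeff (fejer_poly k) m\<bar> / 2 ^ (n * m) * (2 ^ (n * m) * ?e)"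
      using m walk_tail[where N = ?N and k = m and r = r and n = n] by (intro mult_left_mono) auto
    finally show "(\<Sum>es\<in>sign_lists n m. \<bar>fejer_weight k n es\<bar> * of_bool (r < (\<Sum>i<n. (walk n es i)\<^sup>2)))
       \<le> \<bar>coeff (fejer_poly k) m\<bar> * ?e" by simp
  qed
  also have "\<dots> = (\<Sum>m\<le>?N. \<bar>coeff (fejer_poly k) m\<bar>) * ?e" by (simp add: sum_distrib_right)
  also have "\<dots> \<le> 3 ^ ?N * ?e" by (intro mult_right_mono fejer_poly_coeff_sum) auto
  finally show ?thesis by simp
qed

section \<open>From the Fejer kernel to the energy of the walks\<close>

lemma sum_cos_diff:
  fixes c s :: "'a \<Rightarrow> real"
  shows "(\<Sum>x\<in>X. \<Sum>y\<in>X. c x * c y * cos (s x - s y)) = (\<Sum>x\<in>X. c x * cos (s x))\<^sup>2 + (\<Sum>x\<in>X. c x * sin (s x))\<^sup>2"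
  unfolding power2_eq_square sum_product cos_diff
  by (simp add: sum.distrib[symmetric] algebra_simps)

lemma prod_one_minus_le:
  fixes x :: "nat \<Rightarrow> real"
  assumes "\<And>i. i < n \<Longrightarrow> 0 \<le> x i \<and> x i \<le> 1"
  shows "(\<Prod>i<n. 1 - x i) * (1 + (\<Sum>i<n. x i)) \<le> 1"
  using assms
proof (induction n)
  case (Suc n)
  let ?S = "\<Sum>i<n. x i" and ?P = "\<Prod>i<n. 1 - x i"
  have S: "0 \<le> ?S" by (rule sum_nonneg) (use Suc.prems in auto)
  have P: "0 \<le> ?P" by (rule prod_nonneg) (use Suc.prems in auto)
  have x: "0 \<le> x n" using Suc.prems by simp
  have "(1 - x n) * (1 + (?S + x n)) = 1 + ?S - (x n * ?S + x n * x n)" by (simp add: algebra_simps)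
  also have "\<dots> \<le> 1 + ?S" using mult_nonneg_nonneg[OF x S] mult_nonneg_nonneg[OF x x] by linarith
  finally have "?P * ((1 - x n) * (1 + (?S + x n))) \<le> ?P * (1 + ?S)" using P by (rule mult_left_mono)
  also have "\<dots> \<le> 1" using Suc by simp
  finally show ?case by (simp add: mult.assoc)
qed simp

text \<open>\<open>prod_one_minus_le\<close> bounds the product of the squared cosines by
  \<open>1 / (1 + s)\<close>, so \<open>1 - y\<^sup>2 \<ge> s / (1 + s)\<close>. The Fejer bound
  then gives \<open>p \<le> 1 - saturation D s\<close>, and \<open>p\<^sup>2 \<le> p\<close>
  finishes.\<close>

lemma fejer_saturation:
  fixes n :: nat and \<theta> :: "nat \<Rightarrow> real"
  assumes k: "1 \<le> k"
  shows "saturation (2 ^ k) (\<Sum>i<n. (sin (\<theta> i))\<^sup>2) \<le> 1 - (poly (fejer_poly k) (\<Prod>i<n. cos (\<theta> i)))\<^sup>2"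
proof -
  define y where "y = (\<Prod>i<n. cos (\<theta> i))"
  define s where "s = (\<Sum>i<n. (sin (\<theta> i))\<^sup>2)"
  define p where "p = poly (fejer_poly k) y"
  define D where "D = (2 ^ k :: real)"
  have s: "0 \<le> s" by (simp add: s_def sum_nonneg)
  have y: "\<bar>y\<bar> \<le> 1" unfolding y_def abs_prod by (rule prod_le_1) auto
  have "y\<^sup>2 = (\<Prod>i<n. 1 - (sin (\<theta> i))\<^sup>2)"
    unfolding y_def prod_power_distrib by (simp add: cos_squared_eq)
  also have "\<dots> * (1 + s) \<le> 1"
    unfolding s_def by (rule prod_one_minus_le[of n "\<lambda>i. (sin (\<theta> i))\<^sup>2"]) (auto simp: abs_square_le_1)
  finally have "y\<^sup>2 * (1 + s) \<le> 1" .
  then have "s / (1 + s) \<le> 1 - y\<^sup>2" using s by (simp add: field_simps)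
  then have X: "D\<^sup>2 / 4 * (s / (1 + s)) \<le> D\<^sup>2 / 4 * (1 - y\<^sup>2)" by (intro mult_left_mono) auto
  have p: "0 \<le> p" "p \<le> 1" using fejer_poly_nonneg fejer_poly_le_one[OF y] by (auto simp: p_def)
  have "p * (1 + D\<^sup>2 / 4 * (s / (1 + s))) \<le> p * (1 + D\<^sup>2 / 4 * (1 - y\<^sup>2))"
    using p X by (intro mult_left_mono) auto
  also have "\<dots> \<le> 1" using fejer_poly_bound[OF y k] by (simp add: p_def D_def)
  finally have 1: "p * (1 + D\<^sup>2 / 4 * (s / (1 + s))) \<le> 1" .
  define Z where "Z = 4 + 4 * s + D\<^sup>2 * s"
  have Z: "0 < Z" using s by (auto simp: Z_def intro!: add_pos_nonneg)
  have ZZ: "1 + D\<^sup>2 / 4 * (s / (1 + s)) = Z / (4 + 4 * s)" using s by (simp add: Z_def field_simps)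
  have "p * Z \<le> 4 + 4 * s" using 1[unfolded ZZ] s by (simp add: pos_divide_le_eq)
  then have "p \<le> (4 + 4 * s) / Z" using Z by (simp add: pos_le_divide_eq)
  also have "\<dots> = 1 - saturation D s" using Z by (simp add: saturation_def Z_def field_simps)
  finally have "saturation D s \<le> 1 - p" by simp
  also have "\<dots> \<le> 1 - p\<^sup>2" using p mult_right_le_one_le[of p p] by (simp add: power2_eq_square)
  finally show ?thesis by (simp add: D_def s_def p_def y_def)
qed

text \<open>For fixed \<open>g\<close> the Fourier representation turns the energy into the weighted
  integral of \<open>1 - p\<^sup>2\<close>, with \<open>p\<close> the characteristic function at
  \<open>t\<close> times \<open>g\<close>. Jensen's inequality then splits the integrand into single
  coordinates, each scaling explicitly in \<open>g i\<close>.\<close>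

lemma fejer_walk_directional_energy:
  assumes b: "0 < b" "b < 2" and k: "1 \<le> k" and n: "1 \<le> n"
  shows "saturation_const b (2 ^ k) n * (\<Sum>i<n. \<bar>g i\<bar> powr b) / real n \<le>
    riesz_const b * (\<Sum>es\<in>walk_lists n (2 * 2 ^ k). \<Sum>fs\<in>walk_lists n (2 * 2 ^ k).
      fejer_weight k n es * fejer_weight k n fs * \<bar>\<Sum>i<n. (walk n es i - walk n fs i) * g i\<bar> powr b)"
proof -
  let ?X = "walk_lists n (2 * 2 ^ k)" and ?c = "fejer_weight k n"
  define u where "u = (\<lambda>es. \<Sum>i<n. walk n es i * g i)"
  have ud: "(\<Sum>i<n. (walk n es i - walk n fs i) * g i) = u es - u fs" for es fs
    by (simp add: u_def left_diff_distrib sum_subtractf)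
  have 1: "has_bochner_integral lborel (\<lambda>t. \<Sum>es\<in>?X. \<Sum>fs\<in>?X. ?c es * ?c fs * (riesz_weight b t * (1 - cos ((u es - u fs) * t))))
    (\<Sum>es\<in>?X. \<Sum>fs\<in>?X. ?c es * ?c fs * (riesz_const b * \<bar>u es - u fs\<bar> powr b))"
    by (intro has_bochner_integral_sum has_bochner_integral_mult_right has_bochner_integral_riesz_cos b)
  have 2: "has_bochner_integral lborel (\<lambda>t. 1 / real n * (\<Sum>i<n. riesz_weight b t * saturation (2 ^ k) (real n * (sin (g i * t))\<^sup>2)))
    (1 / real n * (\<Sum>i<n. saturation_const b (2 ^ k) n * \<bar>g i\<bar> powr b))"
    by (intro has_bochner_integral_sum has_bochner_integral_mult_right has_bochner_integral_riesz_saturation b)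
  have "1 / real n * (\<Sum>i<n. saturation_const b (2 ^ k) n * \<bar>g i\<bar> powr b) \<le>
     (\<Sum>es\<in>?X. \<Sum>fs\<in>?X. ?c es * ?c fs * (riesz_const b * \<bar>u es - u fs\<bar> powr b))"
  proof (rule has_bochner_integral_mono[OF 2 1])
    fix t :: real
    define p where "p = poly (fejer_poly k) (\<Prod>i<n. cos (g i * t))"
    have "(\<Sum>es\<in>?X. of_real (?c es) * cis (u es * t)) = of_real p"
      using fejer_weight_cis[of k n "\<lambda>i. g i * t"]
      by (simp add: p_def u_def sum_distrib_right mult.assoc)
    from arg_cong[OF this, of Re] arg_cong[OF this, of Im]
    have cs: "(\<Sum>es\<in>?X. ?c es * cos (u es * t)) = p" "(\<Sum>es\<in>?X. ?c es * sin (u es * t)) = 0"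
      by simp_all
    have one: "(\<Sum>es\<in>?X. \<Sum>fs\<in>?X. ?c es * ?c fs) = 1"
      unfolding sum_product[symmetric] fejer_weight_sum by simp
    have "(\<Sum>es\<in>?X. \<Sum>fs\<in>?X. ?c es * ?c fs * (riesz_weight b t * (1 - cos ((u es - u fs) * t))))
      = riesz_weight b t * ((\<Sum>es\<in>?X. \<Sum>fs\<in>?X. ?c es * ?c fs) - (\<Sum>es\<in>?X. \<Sum>fs\<in>?X. ?c es * ?c fs * cos (u es * t - u fs * t)))"
      by (simp add: sum_subtractf[symmetric] sum_distrib_left algebra_simps)
    also have "\<dots> = riesz_weight b t * (1 - p\<^sup>2)"
      unfolding one sum_cos_diff cs by simp
    finally have eq: "(\<Sum>es\<in>?X. \<Sum>fs\<in>?X. ?c es * ?c fs * (riesz_weight b t * (1 - cos ((u es - u fs) * t))))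
      = riesz_weight b t * (1 - p\<^sup>2)" .
    have "1 / real n * (\<Sum>i<n. saturation (2 ^ k) (real n * (sin (g i * t))\<^sup>2)) \<le> saturation (2 ^ k) (\<Sum>i<n. (sin (g i * t))\<^sup>2)"
      using saturation_sum[of n "\<lambda>i. (sin (g i * t))\<^sup>2" "2 ^ k"] n by (simp add: field_simps)
    also have "\<dots> \<le> 1 - p\<^sup>2" unfolding p_def by (rule fejer_saturation[OF k])
    finally have "riesz_weight b t * (1 / real n * (\<Sum>i<n. saturation (2 ^ k) (real n * (sin (g i * t))\<^sup>2))) \<le> riesz_weight b t * (1 - p\<^sup>2)"
      by (intro mult_left_mono riesz_weight_nonneg)
    then show "1 / real n * (\<Sum>i<n. riesz_weight b t * saturation (2 ^ k) (real n * (sin (g i * t))\<^sup>2))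
      \<le> (\<Sum>es\<in>?X. \<Sum>fs\<in>?X. ?c es * ?c fs * (riesz_weight b t * (1 - cos ((u es - u fs) * t))))"
      unfolding eq by (simp add: sum_distrib_left mult.left_commute)
  qed
  also have "\<dots> = riesz_const b * (\<Sum>es\<in>?X. \<Sum>fs\<in>?X. ?c es * ?c fs * \<bar>u es - u fs\<bar> powr b)"
    by (simp add: sum_distrib_left mult.left_commute)
  finally show ?thesis
    unfolding ud by (simp add: sum_distrib_left[symmetric])
qed

text \<open>The directional inequality is averaged over a Gaussian \<open>g\<close>; the factor
  \<open>normal_moment b\<close> appears on both sides and cancels.\<close>

lemma fejer_walk_energy:
  assumes b: "0 < b" "b < 2" and k: "1 \<le> k" and n: "1 \<le> n"
  shows "(2 ^ k * sqrt (real n)) powr b / (256 * riesz_const b) \<le>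
    (\<Sum>es\<in>walk_lists n (2 * 2 ^ k). \<Sum>fs\<in>walk_lists n (2 * 2 ^ k).
      fejer_weight k n es * fejer_weight k n fs * L2_set (\<lambda>i. walk n es i - walk n fs i) {..<n} powr b)"
proof -
  let ?X = "walk_lists n (2 * 2 ^ k)" and ?c = "fejer_weight k n"
  have m: "0 < normal_moment b" using normal_moment_pos[of b] b by simp
  have \<kappa>: "0 < riesz_const b" by (rule riesz_const_pos[OF b])
  define s where "s = saturation_const b (2 ^ k) n"
  define E where "E = (\<Sum>es\<in>?X. \<Sum>fs\<in>?X. ?c es * ?c fs * L2_set (\<lambda>i. walk n es i - walk n fs i) {..<n} powr b)"
  have 1: "has_bochner_integral (gauss n) (\<lambda>g. s / real n * (\<Sum>i<n. \<bar>g i\<bar> powr b)) (s / real n * (\<Sum>i<n. normal_moment b))"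
    using b by (intro has_bochner_integral_mult_right has_bochner_integral_sum has_bochner_integral_gauss_component) auto
  have 2: "has_bochner_integral (gauss n) (\<lambda>g. riesz_const b * (\<Sum>es\<in>?X. \<Sum>fs\<in>?X.
      ?c es * ?c fs * \<bar>\<Sum>i<n. (walk n es i - walk n fs i) * g i\<bar> powr b))
      (riesz_const b * (\<Sum>es\<in>?X. \<Sum>fs\<in>?X. ?c es * ?c fs *
        (normal_moment b * L2_set (\<lambda>i. walk n es i - walk n fs i) {..<n} powr b)))"
    by (intro has_bochner_integral_mult_right has_bochner_integral_sum has_bochner_integral_gauss_inner b)
  have "s / real n * (\<Sum>i<n. normal_moment b) \<le> riesz_const b * (\<Sum>es\<in>?X. \<Sum>fs\<in>?X. ?c es * ?c fs *
        (normal_moment b * L2_set (\<lambda>i. walk n es i - walk n fs i) {..<n} powr b))"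
    by (rule has_bochner_integral_mono[OF 1 2])
       (use fejer_walk_directional_energy[OF b k n] in \<open>simp add: s_def\<close>)
  also have "\<dots> = riesz_const b * normal_moment b * E"
    by (simp add: E_def sum_distrib_left mult_ac)
  also have "s / real n * (\<Sum>i<n. normal_moment b) = s * normal_moment b" using n by simp
  finally have "s \<le> riesz_const b * E" using m by (simp add: mult.assoc mult.left_commute mult.commute[of _ "normal_moment b"])
  moreover have "(2 ^ k * sqrt (real n)) powr b / 256 \<le> s"
    unfolding s_def by (rule saturation_const_ge[OF b _ n]) simp
  ultimately have "(2 ^ k * sqrt (real n)) powr b / 256 \<le> riesz_const b * E" by linarith
  then show ?thesis unfolding E_def[symmetric] using \<kappa> by (simp add: field_simps)
qed

section \<open>The lower bound\<close>


text \<open>Masses at the same point are added up, which carries the bound over to families that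
  need not be injective.\<close>

lemma energy_bounded_family:
  assumes e: "energy_bounded K f C" and I: "finite I" and g: "\<And>i. i \<in> I \<Longrightarrow> g i \<in> K"
  shows "(\<Sum>i\<in>I. \<Sum>j\<in>I. c i * c j * f (g i) (g j)) \<le> C * (\<Sum>i\<in>I. c i)\<^sup>2"
proof -
  define d where "d = (\<lambda>x. \<Sum>i | i \<in> I \<and> g i = x. c i)"
  have gen: "(\<Sum>i\<in>I. c i * h (g i)) = (\<Sum>x\<in>g ` I. d x * h x)" for h
  proof -
    have "(\<Sum>i\<in>I. c i * h (g i)) = (\<Sum>x\<in>g ` I. \<Sum>i | i \<in> I \<and> g i = x. c i * h (g i))"
      by (rule sum.image_gen[OF I])
    also have "\<dots> = (\<Sum>x\<in>g ` I. d x * h x)"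
      unfolding d_def sum_distrib_right by (intro sum.cong) auto
    finally show ?thesis .
  qed
  have "(\<Sum>i\<in>I. \<Sum>j\<in>I. c i * c j * f (g i) (g j)) = (\<Sum>i\<in>I. c i * (\<Sum>j\<in>I. c j * f (g i) (g j)))"
    by (simp add: sum_distrib_left mult.assoc)
  also have "\<dots> = (\<Sum>x\<in>g ` I. d x * (\<Sum>y\<in>g ` I. d y * f x y))"
    unfolding gen[of "f _"] by (rule gen[of "\<lambda>x. \<Sum>y\<in>g ` I. d y * f x y"])
  also have "\<dots> = (\<Sum>x\<in>g ` I. \<Sum>y\<in>g ` I. d x * d y * f x y)"
    by (simp add: sum_distrib_left mult.assoc)
  also have "\<dots> \<le> C * (\<Sum>x\<in>g ` I. d x)\<^sup>2"
    using e I g by (auto simp: energy_bounded_def)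
  also have "(\<Sum>x\<in>g ` I. d x) = (\<Sum>i\<in>I. c i)"
    using gen[of "\<lambda>_. 1"] by simp
  finally show ?thesis .
qed

text \<open>Comparison of power means by the tangent at \<open>1 / n\<close>, the mean of the
  squared coordinates of a unit vector.\<close>

lemma scaled_l2_ball_in_lq_ball:
  assumes q: "1 < q" "q \<le> 2" and n: "1 \<le> n"
    and u: "\<And>i. i \<ge> n \<Longrightarrow> u i = 0" "(\<Sum>i<n. (u i)\<^sup>2) \<le> 1"
  shows "(\<lambda>i. real n powr (1 / 2 - 1 / q) * u i) \<in> lq_ball q n"
proof -
  define t where "t = q / 2"
  have t: "0 < t" "t \<le> 1" using q by (auto simp: t_def)
  have un: "(\<Sum>i<n. ((u i)\<^sup>2) powr t) \<le> real n powr (1 - t)"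
  \<comment> \<open>The case \<open>q = 2\<close> is separate because \<open>powr_le_tangent\<close>
    asks for an exponent below 1.\<close>
  proof (cases "t = 1")
    case True
    then show ?thesis using u n by simp
  next
    case False
    then have t1: "t < 1" using t by simp
    have "(\<Sum>i<n. ((u i)\<^sup>2) powr t) \<le> (\<Sum>i<n. (1 / real n) powr t * (1 - t + t * ((u i)\<^sup>2 / (1 / real n))))"
      using t t1 n by (intro sum_mono powr_le_tangent) auto
    also have "\<dots> = (1 / real n) powr t * (\<Sum>i<n. (1 - t) + t * real n * (u i)\<^sup>2)"
      unfolding sum_distrib_left by (intro sum.cong) (auto simp: mult_ac)
    also have "\<dots> = (1 / real n) powr t * (real n * (1 - t) + t * real n * (\<Sum>i<n. (u i)\<^sup>2))"
      by (simp only: sum.distrib sum_distrib_left[symmetric] sum_constant card_lessThan)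
    also have "\<dots> \<le> (1 / real n) powr t * (real n * (1 - t) + t * real n * 1)"
      using t u by (intro mult_left_mono add_left_mono) auto
    also have "\<dots> = real n powr (1 - t)"
      using n by (simp add: powr_diff powr_divide algebra_simps)
    finally show ?thesis .
  qed
  have "\<bar>real n powr (1 / 2 - 1 / q) * u i\<bar> powr q = real n powr (t - 1) * ((u i)\<^sup>2) powr t" for i
  proof -
    have "(u i)\<^sup>2 = \<bar>u i\<bar> powr 2" by (cases "u i = 0") auto
    then have "((u i)\<^sup>2) powr t = \<bar>u i\<bar> powr (2 * t)" by (simp only: powr_powr)
    then have "((u i)\<^sup>2) powr t = \<bar>u i\<bar> powr q" by (simp add: t_def)
    moreover have "(real n powr (1 / 2 - 1 / q)) powr q = real n powr (t - 1)"
      using q by (simp add: powr_powr t_def algebra_simps)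
    ultimately show ?thesis by (simp add: abs_mult powr_mult)
  qed
  then have "(\<Sum>i<n. \<bar>real n powr (1 / 2 - 1 / q) * u i\<bar> powr q) = real n powr (t - 1) * (\<Sum>i<n. ((u i)\<^sup>2) powr t)"
    by (simp add: sum_distrib_left)
  also have "\<dots> \<le> real n powr (t - 1) * real n powr (1 - t)"
    using un by (intro mult_left_mono) auto
  also have "\<dots> = 1" using n by (simp add: powr_add[symmetric])
  finally show ?thesis using u(1) by (simp add: lq_ball_def)
qed

lemma powr_le_one_plus_sq:
  fixes s :: real assumes "0 \<le> s" "0 < b" "b < 2" shows "s powr b \<le> 1 + s\<^sup>2"
proof (cases "s \<le> 1")
  case True
  then have "s powr b \<le> 1" using assms by (intro powr_le1) auto
  then show ?thesis by (simp add: add_increasing2)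
next
  case False
  then have "s powr b \<le> s powr 2" using assms by (intro powr_mono) auto
  then show ?thesis using False by simp
qed

text \<open>The three factors are at most 2 to the powers \<open>n\<close>, \<open>3 * n\<close> and
  \<open>16 * n\<close>, together \<open>2 ^ (20 * n)\<close>. The rate 31 is what the tail bound
  for the scaled walks supplies.\<close>

lemma exp_beats_powers:
  assumes "n \<ge> 1" "N \<le> 4 * n"
  shows "2 * (4 + real N) * 9 ^ N * exp (- 31 * real n) \<le> 1"
proof -
  have "1 + real n * 7 \<le> (1 + 7) ^ n" by (rule Bernoulli_inequality) simp
  moreover have "(8::real) ^ n = 2 ^ (3 * n)" by (simp add: power_mult)
  ultimately have 1: "4 + real N \<le> 2 ^ (3 * n)" using assms by simp
  have "(9::real) ^ N \<le> 16 ^ N" by (intro power_mono) auto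
  also have "\<dots> \<le> 16 ^ (4 * n)" using assms by (intro power_increasing) auto
  also have "\<dots> = 2 ^ (16 * n)" by (simp add: power_mult)
  finally have 2: "(9::real) ^ N \<le> 2 ^ (16 * n)" .
  have 3: "(2::real) \<le> 2 ^ n" using assms power_increasing[of 1 n "2::real"] by simp
  have "2 * (4 + real N) * 9 ^ N \<le> 2 ^ n * 2 ^ (3 * n) * 2 ^ (16 * n)"
    using 1 2 3 by (intro mult_mono) auto
  also have "\<dots> = 2 ^ (20 * n)" by (simp add: power_add[symmetric])
  also have "\<dots> \<le> (2::real) ^ (31 * n)" by (intro power_increasing) auto
  also have "\<dots> \<le> exp 1 ^ (31 * n)" using exp_ge_add_one_self[of 1] by (intro power_mono) auto
  also have "\<dots> = exp (31 * real n)" by (simp add: exp_of_nat_mult[symmetric])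
  finally show ?thesis by (simp add: exp_minus field_simps)
qed

lemma dyadic_above:
  fixes n :: nat
  assumes "n \<ge> 1" obtains k :: nat where "1 \<le> k" "n < 2 ^ k" "2 ^ k \<le> 2 * n"
proof -
  have ex: "n < 2 ^ n" by (rule less_exp)
  define k where "k = (LEAST k. n < 2 ^ k)"
  have k: "n < 2 ^ k" unfolding k_def by (rule LeastI[of "\<lambda>k. n < 2 ^ k", OF ex])
  then have k1: "1 \<le> k" using assms by (cases k) auto
  have "\<not> n < 2 ^ (k - 1)" using k1 not_less_Least[of "k - 1" "\<lambda>k. n < 2 ^ k"] by (simp add: k_def)
  then have "2 ^ k \<le> 2 * n" using k1 by (cases k) auto
  then show thesis using that k k1 by blast
qed

lemma L2_set_le_of_sq: "(\<Sum>i\<in>A. (f i)\<^sup>2) \<le> r\<^sup>2 \<Longrightarrow> 0 \<le> r \<Longrightarrow> L2_set f A \<le> r"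
  unfolding L2_set_def by (rule real_le_lsqrt) (auto simp: sum_nonneg)

lemma L2_set_diff_le: "L2_set (\<lambda>i. f i - g i) A \<le> L2_set f A + L2_set g A"
  using L2_set_triangle_ineq[of f "\<lambda>i. - g i" A] by (simp add: L2_set_def)

lemma L2_set_cmult: "0 \<le> r \<Longrightarrow> L2_set (\<lambda>i. r * f i - r * g i) A = r * L2_set (\<lambda>i. f i - g i) A"
  by (simp add: L2_set_right_distrib right_diff_distrib)

text \<open>The positions outside the unit ball are replaced by the origin.\<close>

lemma clipped_walk_energy:
  assumes b: "0 < b" "b < 2" and k: "1 \<le> k" and n: "1 \<le> n" "n < 2 ^ k" "2 ^ k \<le> 2 * n"
  shows "\<exists>u :: (nat \<Rightarrow> real) list \<Rightarrow> nat \<Rightarrow> real.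
    (\<forall>es i. i \<ge> n \<longrightarrow> u es i = 0) \<and> (\<forall>es. (\<Sum>i<n. (u es i)\<^sup>2) \<le> 1) \<and>
    (sqrt (real n) / 32) powr b / (256 * riesz_const b) - 1 \<le>
      (\<Sum>es\<in>walk_lists n (2 * 2 ^ k). \<Sum>fs\<in>walk_lists n (2 * 2 ^ k).
      fejer_weight k n es * fejer_weight k n fs * L2_set (\<lambda>i. u es i - u fs i) {..<n} powr b)"
proof -
  define N where "N = (2 * 2 ^ k :: nat)"
  let ?X = "walk_lists n N" and ?c = "fejer_weight k n"
  have N: "1 \<le> N" "N \<le> 4 * n" using n by (auto simp: N_def)
  \<comment> \<open>This step size makes the tail exponent \<open>(1 / h\<^sup>2) / (8 * N)\<close>
    equal to \<open>32 * n\<close>, enough against the coefficient sums \<open>3 ^ N\<close>, while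
    \<open>h\<close> is still of order \<open>1 / n\<close>.\<close>
  define h where "h = 1 / (16 * sqrt (real n * real N))"
  have h: "0 < h" using n N by (simp add: h_def)
  have h2: "h\<^sup>2 = 1 / (256 * real n * real N)" by (simp add: h_def power_divide power_mult_distrib)
  have \<kappa>: "0 < riesz_const b" by (rule riesz_const_pos[OF b])
  define sq where "sq = (\<lambda>es. \<Sum>i<n. (walk n es i)\<^sup>2)"
  define out where "out = (\<lambda>es. 1 / h\<^sup>2 < sq es)"
  define u where "u = (\<lambda>es i. if out es then 0 else h * walk n es i)"
  define w where "w = (\<lambda>es i. h * walk n es i)"
  have usq: "(\<Sum>i<n. (u es i)\<^sup>2) \<le> 1" for es
  proof (cases "out es")
    case False
    then have "h\<^sup>2 * sq es \<le> 1" using h by (simp add: out_def field_simps)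
    then show ?thesis using False by (simp add: u_def sq_def power_mult_distrib sum_distrib_left)
  qed (simp add: u_def)
  define dist2 where "dist2 = (\<lambda>f g :: nat \<Rightarrow> real. L2_set (\<lambda>i. f i - g i) {..<n} powr b)"
  have d0: "0 \<le> dist2 f g" for f g by (simp add: dist2_def)
  \<comment> \<open>The crude bound \<open>4 + N\<close> is chosen to hold for clipped and unclipped
    distances alike.\<close>
  have du: "dist2 (u es) (u fs) \<le> 4 + real N" for es fs
  proof -
    have "L2_set (\<lambda>i. u es i - u fs i) {..<n} \<le> L2_set (u es) {..<n} + L2_set (u fs) {..<n}"
      by (rule L2_set_diff_le)
    also have "\<dots> \<le> 1 + 1" using usq by (intro add_mono L2_set_le_of_sq) auto
    finally have l: "L2_set (\<lambda>i. u es i - u fs i) {..<n} \<le> 2" by simp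
    then have "dist2 (u es) (u fs) \<le> 2 powr b"
      unfolding dist2_def using b by (intro powr_mono2) auto
    also have "\<dots> \<le> 2 powr 2" using b by (intro powr_mono) auto
    finally show ?thesis by simp
  qed
  have wl: "L2_set (w es) {..<n} \<le> sqrt (real N) / 16" if X: "es \<in> ?X" for es
  proof (rule L2_set_le_of_sq)
    obtain m where m: "m \<le> N" "es \<in> sign_lists n m" using X by (auto simp: walk_lists_def)
    have "(walk n es i)\<^sup>2 \<le> (real N)\<^sup>2" for i
      using walk_abs_le[OF m(2), of i] m(1) by (subst abs_le_square_iff[symmetric]) simp
    then have "(\<Sum>i<n. (w es i)\<^sup>2) \<le> (\<Sum>i<n. h\<^sup>2 * (real N)\<^sup>2)"
      unfolding w_def power_mult_distrib by (intro sum_mono mult_left_mono) auto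
    also have "\<dots> = real N / 256" using n N by (simp add: h2) (simp add: power2_eq_square)
    finally show "(\<Sum>i<n. (w es i)\<^sup>2) \<le> (sqrt (real N) / 16)\<^sup>2" by (simp add: power_divide)
  qed simp
  have dw: "dist2 (w es) (w fs) \<le> 4 + real N" if "es \<in> ?X" "fs \<in> ?X" for es fs
  proof -
    have "L2_set (\<lambda>i. w es i - w fs i) {..<n} \<le> sqrt (real N) / 16 + sqrt (real N) / 16"
      using L2_set_diff_le[of "w es" "w fs"] wl[OF that(1)] wl[OF that(2)] by (meson add_mono order_trans)
    then have "(L2_set (\<lambda>i. w es i - w fs i) {..<n})\<^sup>2 \<le> (sqrt (real N) / 8)\<^sup>2"
      by (intro power_mono) auto
    also have "\<dots> \<le> real N" by (simp add: power_divide)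
    finally have "dist2 (w es) (w fs) \<le> 1 + real N"
      using powr_le_one_plus_sq[of "L2_set (\<lambda>i. w es i - w fs i) {..<n}" b] b by (simp add: dist2_def)
    then show ?thesis by simp
  qed
  have diff: "\<bar>dist2 (w es) (w fs) - dist2 (u es) (u fs)\<bar> \<le> (4 + real N) * (of_bool (out es) + of_bool (out fs))"
    if "es \<in> ?X" "fs \<in> ?X" for es fs
  proof (cases "out es \<or> out fs")
    case True
    have "\<bar>x - y\<bar> \<le> z" if "0 \<le> x" "x \<le> z" "0 \<le> y" "y \<le> z" for x y z :: real
      using that by linarith
    from this[OF d0 dw[OF that] d0 du]
    have "\<bar>dist2 (w es) (w fs) - dist2 (u es) (u fs)\<bar> \<le> (4 + real N) * 1" by simp
    also have "\<dots> \<le> (4 + real N) * (of_bool (out es) + of_bool (out fs))"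
      using True by (intro mult_left_mono) auto
    finally show ?thesis .
  next
    case False
    then have "u es = w es" "u fs = w fs" by (auto simp: u_def w_def)
    then show ?thesis by simp
  qed
  define A where "A = (\<Sum>es\<in>?X. \<bar>?c es\<bar>)"
  define T where "T = (\<Sum>es\<in>?X. \<bar>?c es\<bar> * of_bool (out es))"
  have A: "0 \<le> A" "A \<le> 3 ^ N"
    using fejer_weight_abs_sum[of k n] by (auto simp: A_def N_def sum_nonneg)
  have T: "T \<le> 3 ^ N * exp (- 31 * real n)"
  proof -
    have "T \<le> 3 ^ N * exp (real n / 4 - (1 / h\<^sup>2) / (8 * real N))"
      using fejer_weight_tail[where n = n and k = k and r = "1 / h\<^sup>2"] by (simp add: T_def out_def sq_def N_def)
    also have "(1 / h\<^sup>2) / (8 * real N) = 32 * real n" using N by (simp add: h2)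
    also have "exp (real n / 4 - 32 * real n) \<le> exp (- 31 * real n)" by simp
    finally show ?thesis by simp
  qed
  have "(\<Sum>es\<in>?X. \<Sum>fs\<in>?X. ?c es * ?c fs * dist2 (w es) (w fs)) - (\<Sum>es\<in>?X. \<Sum>fs\<in>?X. ?c es * ?c fs * dist2 (u es) (u fs))
     = (\<Sum>es\<in>?X. \<Sum>fs\<in>?X. ?c es * ?c fs * (dist2 (w es) (w fs) - dist2 (u es) (u fs)))"
    by (simp add: sum_subtractf[symmetric] right_diff_distrib)
  also have "\<dots> \<le> (\<Sum>es\<in>?X. \<Sum>fs\<in>?X. \<bar>?c es\<bar> * \<bar>?c fs\<bar> * ((4 + real N) * (of_bool (out es) + of_bool (out fs))))"
  proof (intro sum_mono)
    fix es fs assume X: "es \<in> ?X" "fs \<in> ?X"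
    have "?c es * ?c fs * (dist2 (w es) (w fs) - dist2 (u es) (u fs))
      \<le> \<bar>?c es\<bar> * \<bar>?c fs\<bar> * \<bar>dist2 (w es) (w fs) - dist2 (u es) (u fs)\<bar>"
      by (metis abs_ge_self abs_mult)
    also have "\<dots> \<le> \<bar>?c es\<bar> * \<bar>?c fs\<bar> * ((4 + real N) * (of_bool (out es) + of_bool (out fs)))"
      by (intro mult_left_mono diff X) auto
    finally show "?c es * ?c fs * (dist2 (w es) (w fs) - dist2 (u es) (u fs))
      \<le> \<bar>?c es\<bar> * \<bar>?c fs\<bar> * ((4 + real N) * (of_bool (out es) + of_bool (out fs)))" .
  qed
  also have "\<dots> = (4 + real N) * ((\<Sum>es\<in>?X. \<Sum>fs\<in>?X. (\<bar>?c es\<bar> * of_bool (out es)) * \<bar>?c fs\<bar>)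
      + (\<Sum>es\<in>?X. \<Sum>fs\<in>?X. \<bar>?c es\<bar> * (\<bar>?c fs\<bar> * of_bool (out fs))))"
    by (simp only: sum_distrib_left sum.distrib[symmetric] distrib_left) (intro sum.cong refl, simp add: algebra_simps)
  also have "\<dots> = 2 * (4 + real N) * (A * T)"
    unfolding sum_product[symmetric] A_def[symmetric] T_def[symmetric] by simp
  also have "\<dots> \<le> 2 * (4 + real N) * (3 ^ N * (3 ^ N * exp (- 31 * real n)))"
  proof (intro mult_left_mono mult_mono)
    show "0 \<le> T" by (auto simp: T_def intro!: sum_nonneg)
  qed (use A T in auto)
  also have "\<dots> = 2 * (4 + real N) * 9 ^ N * exp (- 31 * real n)"
    by (simp add: power_mult_distrib[symmetric] mult.assoc[symmetric]) 
  also have "\<dots> \<le> 1" by (rule exp_beats_powers[OF n(1) N(2)])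
  finally have clip: "(\<Sum>es\<in>?X. \<Sum>fs\<in>?X. ?c es * ?c fs * dist2 (w es) (w fs)) - 1 \<le>
      (\<Sum>es\<in>?X. \<Sum>fs\<in>?X. ?c es * ?c fs * dist2 (u es) (u fs))" by simp
  have "dist2 (w es) (w fs) = h powr b * L2_set (\<lambda>i. walk n es i - walk n fs i) {..<n} powr b" for es fs
    using h by (simp add: dist2_def w_def L2_set_cmult powr_mult)
  then have wE: "(\<Sum>es\<in>?X. \<Sum>fs\<in>?X. ?c es * ?c fs * dist2 (w es) (w fs)) =
     h powr b * (\<Sum>es\<in>?X. \<Sum>fs\<in>?X. ?c es * ?c fs * L2_set (\<lambda>i. walk n es i - walk n fs i) {..<n} powr b)"
    by (simp add: sum_distrib_left mult.left_commute)
  have "h powr b * ((2 ^ k * sqrt (real n)) powr b / (256 * riesz_const b)) \<le>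
    (\<Sum>es\<in>?X. \<Sum>fs\<in>?X. ?c es * ?c fs * dist2 (w es) (w fs))"
    unfolding wE unfolding N_def by (intro mult_left_mono fejer_walk_energy b k n) simp
  moreover have "(sqrt (real n) / 32) powr b / (256 * riesz_const b) \<le> h powr b * ((2 ^ k * sqrt (real n)) powr b / (256 * riesz_const b))"
  proof -
    \<comment> \<open>Since \<open>N = 2 * 2 ^ k\<close>, this gives
      \<open>h * 2 ^ k \<ge> 1 / 32\<close>: scaling into the ball costs only a constant factor of
      the energy.\<close>
    have "sqrt (real n) * sqrt (real N) \<le> 2 * 2 ^ k"
    proof -
      have "n \<le> N" using n(2) by (simp add: N_def)
      then have "sqrt (real n) * sqrt (real N) \<le> sqrt (real N) * sqrt (real N)" by (intro mult_right_mono) auto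
      then show ?thesis by (simp add: N_def)
    qed
    then have "sqrt (real n) / 32 \<le> h * (2 ^ k * sqrt (real n))"
      using n N by (simp add: h_def real_sqrt_mult field_simps)
    then have "(sqrt (real n) / 32) powr b \<le> (h * (2 ^ k * sqrt (real n))) powr b"
      using b by (intro powr_mono2) auto
    then show ?thesis using h \<kappa> by (simp add: powr_mult divide_right_mono)
  qed
  ultimately have "(sqrt (real n) / 32) powr b / (256 * riesz_const b) - 1 \<le>
     (\<Sum>es\<in>?X. \<Sum>fs\<in>?X. ?c es * ?c fs * dist2 (u es) (u fs))" using clip by linarith
  moreover have "u es i = 0" if "i \<ge> n" for es i using that by (simp add: u_def walk_def)
  ultimately show ?thesis using usq by (intro exI[of _ u]) (simp add: dist2_def N_def)
qed

lemma energy_lower_lq_ball: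
  fixes q q' a :: real
  assumes q: "1 < q" "q \<le> 2" "1 / q + 1 / q' = 1" and a: "0 < a" "a < 1"
  obtains c where "0 < c"
    "\<And>n C. n \<ge> 1 \<Longrightarrow> energy_bounded (lq_ball q n) (\<lambda>x y. (euclid_dist n x y powr a)\<^sup>2) C \<Longrightarrow>
      c * real n powr (2 * a / q') \<le> C"
proof -
  define b where "b = 2 * a"
  have b: "0 < b" "b < 2" using a by (auto simp: b_def)
  define c where "c = 1 / (32 powr b * (256 * riesz_const b))"
  have c: "0 < c" using riesz_const_pos[OF b] by (simp add: c_def)
  show thesis
  proof (rule that[of "c / 3"])
    show "0 < c / 3" using c by simp
    fix n :: nat and C assume n: "n \<ge> 1"
      and E: "energy_bounded (lq_ball q n) (\<lambda>x y. (euclid_dist n x y powr a)\<^sup>2) C"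
    obtain k :: nat where k: "1 \<le> k" "n < 2 ^ k" "2 ^ k \<le> 2 * n" using dyadic_above[OF n] .
    let ?X = "walk_lists n (2 * 2 ^ k)" and ?w = "fejer_weight k n"
    obtain u :: "(nat \<Rightarrow> real) list \<Rightarrow> nat \<Rightarrow> real" where
      u: "\<And>es i. i \<ge> n \<Longrightarrow> u es i = 0" "\<And>es. (\<Sum>i<n. (u es i)\<^sup>2) \<le> 1"
      and uE: "(sqrt (real n) / 32) powr b / (256 * riesz_const b) - 1 \<le>
        (\<Sum>es\<in>?X. \<Sum>fs\<in>?X. ?w es * ?w fs * L2_set (\<lambda>i. u es i - u fs i) {..<n} powr b)"
      using clipped_walk_energy[OF b k(1) n k(2,3)] by blast
    define r where "r = real n powr (1 / 2 - 1 / q)"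
    have r: "0 < r" using n by (simp add: r_def)
    \<comment> \<open>By \<open>r powr b \<le> 1\<close>, the two-point bound
      \<open>1 / 2 \<le> C\<close> also holds in the scaled form of \<open>C2\<close>.\<close>
    have r1: "r powr b \<le> 1"
    proof -
      have "1 / 2 - 1 / q \<le> 0" using q by (simp add: field_simps)
      then have "r \<le> real n powr 0" unfolding r_def using n by (intro powr_mono) auto
      then have "r \<le> 1" using n by simp
      then show ?thesis using r b by (intro powr_le1) auto
    qed
    have dE: "(euclid_dist n (\<lambda>i. r * x i) (\<lambda>i. r * y i) powr a)\<^sup>2 = r powr b * L2_set (\<lambda>i. x i - y i) {..<n} powr b" for x y
    proof -
      have "(z powr a)\<^sup>2 = z powr b" for z
        by (simp add: b_def power2_eq_square powr_add[symmetric])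
      then show ?thesis using r by (simp only: euclid_dist_def L2_set_cmult[OF less_imp_le] powr_mult power_mult_distrib)
    qed
    have "(\<Sum>es\<in>?X. \<Sum>fs\<in>?X. ?w es * ?w fs * (euclid_dist n (\<lambda>i. r * u es i) (\<lambda>i. r * u fs i) powr a)\<^sup>2)
       \<le> C * (\<Sum>es\<in>?X. ?w es)\<^sup>2"
      using E by (rule energy_bounded_family[where g = "\<lambda>es i. r * u es i"])
        (auto simp: r_def intro!: scaled_l2_ball_in_lq_ball q n u)
    then have "r powr b * (\<Sum>es\<in>?X. \<Sum>fs\<in>?X. ?w es * ?w fs * L2_set (\<lambda>i. u es i - u fs i) {..<n} powr b) \<le> C"
      unfolding dE fejer_weight_sum by (simp add: sum_distrib_left mult.left_commute)
    moreover have "r powr b * ((sqrt (real n) / 32) powr b / (256 * riesz_const b) - 1) \<le>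
       r powr b * (\<Sum>es\<in>?X. \<Sum>fs\<in>?X. ?w es * ?w fs * L2_set (\<lambda>i. u es i - u fs i) {..<n} powr b)"
      by (intro mult_left_mono uE) simp
    ultimately have C1: "r powr b * ((sqrt (real n) / 32) powr b / (256 * riesz_const b) - 1) \<le> C" by linarith
    define X where "X = c * sqrt (real n) powr b"
    have X: "(sqrt (real n) / 32) powr b / (256 * riesz_const b) = X"
      by (simp add: X_def c_def powr_divide)
    \<comment> \<open>The origin and the first unit vector, at distance 1. This covers dimensions in
      which the loss of 1 from clipping exceeds the main term.\<close>
    have C2: "r powr b * (1 / 2) \<le> C"
    proof -
      define e where "e = (\<lambda>i::nat. if i = 0 then 1 else 0 :: real)"
      have e_pow: "\<bar>e i\<bar> powr q = (if i = 0 then 1 else 0)" "(e i - 0)\<^sup>2 = (if i = 0 then 1 else 0)" for i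
        by (auto simp: e_def)
      have e: "e \<in> lq_ball q n"
        using n by (simp add: lq_ball_def e_pow) (simp add: e_def)
      have z: "(\<lambda>_. 0) \<in> lq_ball q n" by (simp add: lq_ball_def)
      have d: "euclid_dist n e (\<lambda>_. 0) = 1"
        unfolding euclid_dist_def L2_set_def e_pow using n by simp
      have sym: "euclid_dist n x y = euclid_dist n y x" for x y
        by (simp add: euclid_dist_def L2_set_def power2_commute)
      have diag: "euclid_dist n x x = 0" for x
        by (simp add: euclid_dist_def L2_set_def)
      have "(euclid_dist n e (\<lambda>_. 0) powr a)\<^sup>2 / 2 \<le> C"
        by (rule energy_bounded_two_points[OF E e z]) (simp_all add: diag sym)
      then show ?thesis using r1 by (simp add: d)
    qed
    \<comment> \<open>\<open>X / 3\<close> is at most the larger of \<open>1 / 2\<close> and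
      \<open>X - 1\<close>; the two agree with it at \<open>X = 3 / 2\<close>.\<close>
    have "r powr b * (X / 3) \<le> C"
    proof (cases "X \<le> 3 / 2")
      case True
      then have "r powr b * (X / 3) \<le> r powr b * (1 / 2)" by (intro mult_left_mono) auto
      then show ?thesis using C2 by linarith
    next
      case False
      then have "r powr b * (X / 3) \<le> r powr b * (X - 1)" by (intro mult_left_mono) auto
      then show ?thesis using C1 X by simp
    qed
    \<comment> \<open>The exponents \<open>(1 / 2 - 1 / q) * b\<close> from the scaling and
      \<open>b / 2\<close> from the Euclidean ball add up to \<open>b / q'\<close>.\<close>
    moreover have "r powr b * sqrt (real n) powr b = real n powr (2 * a / q')"
    proof -
      have "sqrt (real n) = real n powr (1 / 2)" by (simp add: powr_half_sqrt)
      then have "r powr b * sqrt (real n) powr b = real n powr ((1 / 2 - 1 / q) * b + 1 / 2 * b)"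
        by (simp add: r_def powr_powr powr_add)
      also have "(1 / 2 - 1 / q) * b + 1 / 2 * b = b * (1 - 1 / q)" by (simp add: algebra_simps)
      also have "1 - 1 / q = 1 / q'" using q by simp
      finally show ?thesis by (simp add: b_def)
    qed
    ultimately show "c / 3 * real n powr (2 * a / q') \<le> C"
      by (simp add: X_def mult.left_commute)
  qed
qed

theorem theorem2p14:
  fixes q q' \<alpha> :: real
  assumes "1 < q" and "q \<le> 2"
    and "0 < \<alpha>" and "\<alpha> < 1"
    and "1 / q + 1 / q' = 1"
  shows "\<exists>R :: nat \<Rightarrow> real.
    (\<forall>n\<ge>1. is_min_sphere_radius (lq_ball q n) (\<lambda>x y. euclid_dist n x y powr \<alpha>) (R n)) \<and>
    (\<exists>A>0. \<exists>B>0. \<forall>n\<ge>1.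
       A * real n powr (\<alpha> / q') \<le> R n \<and> R n \<le> B * real n powr (\<alpha> / q'))"
proof -
  obtain C where C: "0 < C" and upper: "\<And>n. n \<ge> 1 \<Longrightarrow>
      energy_bounded (lq_ball q n) (\<lambda>x y. (euclid_dist n x y powr \<alpha>)\<^sup>2) (C * real n powr (2 * \<alpha> / q'))"
    using energy_bounded_lq_ball[OF assms(1,2,5,3,4)] by blast
  obtain c where c: "0 < c" and lower: "\<And>n C. n \<ge> 1 \<Longrightarrow>
      energy_bounded (lq_ball q n) (\<lambda>x y. (euclid_dist n x y powr \<alpha>)\<^sup>2) C \<Longrightarrow> c * real n powr (2 * \<alpha> / q') \<le> C"
    using energy_lower_lq_ball[OF assms(1,2,5,3,4)] by blast
  have "\<exists>R. is_min_sphere_radius (lq_ball q n) (\<lambda>x y. euclid_dist n x y powr \<alpha>) R \<and>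
      sqrt (c / 2) * real n powr (\<alpha> / q') \<le> R \<and> R \<le> sqrt (C / 2) * real n powr (\<alpha> / q')" if n: "n \<ge> 1" for n
  proof -
    have q0: "0 < q" using assms by simp
    obtain p :: "nat \<Rightarrow> nat \<Rightarrow> real" where p: "\<And>m. p m \<in> lq_ball q n"
      and dense: "\<And>x e. x \<in> lq_ball q n \<Longrightarrow> e > 0 \<Longrightarrow> \<exists>m. euclid_dist n x (p m) powr \<alpha> < e"
      using lq_ball_dense_sequence[OF q0 assms(3), of n] by blast
    have ne: "lq_ball q n \<noteq> {}" using p by blast
    have sym: "euclid_dist n x y powr \<alpha> = euclid_dist n y x powr \<alpha>" for x y
      by (simp add: euclid_dist_def L2_set_def power2_commute)
    have diag: "euclid_dist n x x powr \<alpha> = 0" for x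
      by (simp add: euclid_dist_def L2_set_def)
    obtain R where R: "is_min_sphere_radius (lq_ball q n) (\<lambda>x y. euclid_dist n x y powr \<alpha>) R" "0 \<le> R"
      and eR: "energy_bounded (lq_ball q n) (\<lambda>x y. (euclid_dist n x y powr \<alpha>)\<^sup>2) (2 * R\<^sup>2)"
      and minR: "\<And>C. energy_bounded (lq_ball q n) (\<lambda>x y. (euclid_dist n x y powr \<alpha>)\<^sup>2) C \<Longrightarrow> 2 * R\<^sup>2 \<le> C"
      using is_min_sphere_radius_energy[of "lq_ball q n" "\<lambda>x y. euclid_dist n x y powr \<alpha>",
          OF ne upper[OF n] sym diag powr_ge_zero p dense] by blast
    have sq: "(real n powr (\<alpha> / q'))\<^sup>2 = real n powr (2 * \<alpha> / q')"
      by (simp add: power2_eq_square powr_add[symmetric])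
    \<comment> \<open>Since \<open>2 * R\<^sup>2\<close> is the least energy bound, it lies between
      the two bounds; taking roots halves the exponent.\<close>
    have "(sqrt (c / 2) * real n powr (\<alpha> / q'))\<^sup>2 \<le> R\<^sup>2"
      using lower[OF n eR] c by (simp add: power_mult_distrib sq)
    moreover have "R\<^sup>2 \<le> (sqrt (C / 2) * real n powr (\<alpha> / q'))\<^sup>2"
      using minR[OF upper[OF n]] C by (simp add: power_mult_distrib sq)
    ultimately show ?thesis
      using R C by (intro exI[of _ R] conjI) (auto intro: power2_le_imp_le)
  qed
  then obtain R where R: "\<And>n. n \<ge> 1 \<Longrightarrow> is_min_sphere_radius (lq_ball q n) (\<lambda>x y. euclid_dist n x y powr \<alpha>) (R n) \<and>
      sqrt (c / 2) * real n powr (\<alpha> / q') \<le> R n \<and> R n \<le> sqrt (C / 2) * real n powr (\<alpha> / q')"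
    by metis
  have "sqrt (c / 2) > 0" "sqrt (C / 2) > 0" using c C by auto
  then show ?thesis using R by (intro exI[of _ R]) blast
qed

end
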